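(* Let $\ell\ge1$, $m\geq 2$, and let $B$, $\overline{R}$, $\overline{V}$, $\overline{h}$, $U_m(B)$ be as in the context, with $\ell=2f$ or $\ell=2f-1$ according to whether $\ell$ is even or odd. Let $u\in\overline{V}$ be a primitive vector, let $t=\overline{h}(u,u)$, and let $S_u$ be the stabilizer of $u$ in $U_m(B)$. Let $b$ be the restriction of $\overline{h}$ to $\langle u\rangle^\perp$. Suppose $t$ is a unit. (i) If $m=2r+1$ is odd, then $$[U_m(B):S_u]=\begin{cases} q^{m\ell-m+r-f+1}(q^r+1) & \text{if } b \text{ is of kind I},\\ q^{m\ell-m+r-f+1}(q^r-1) & \text{if } b \text{ is of kind II}.\end{cases}$$ (ii) If $m=2r$ is even, then $$[U_m(B):S_u]=\begin{cases} q^{m\ell-m+r-f}(q^r-1) & \text{if } \overline{h} \text{ is of kind I},\\ q^{m\ell-m+r-f}(q^r+1) & \text{if } \overline{h} \text{ is of kind II}.\end{cases}$$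
   Context: $K$ is a non-archimedean local field with ring of integers $\mathcal{O}$, maximal ideal $\mathfrak{p}$ and residue field $F_q$ of odd characteristic; $F$ is a ramified quadratic extension of $K$ with ring of integers $\mathcal{R}=\mathcal{O}[\rho]$, where $\rho^2=\pi$ is a prime element of $\mathcal{O}$, and maximal ideal $\mathcal{P}=(\rho)$; $\mathcal{R}$ has the involution fixing $\mathcal{O}$ elementwise with $\rho\mapsto-\rho$. Put $A=\mathcal{R}/\mathcal{P}^{2\ell}$ with inherited involution $*$ and maximal ideal $\mathfrak{r}$, and $B=A/\mathfrak{r}^\ell\cong\mathcal{R}/\mathcal{P}^\ell$ with inherited involution $\circ$. Let $\overline{R}$ be the fixed ring of $\circ$ in $B$; it is local and $|\overline{R}|=q^f$. $V$ is a free $A$-module of rank $m$ with a non-degenerate $*$-hermitian form $h$ (biadditive, $A$-linear in the second variable, $h(v,u)=h(u,v)^*$, with $u\mapsto h(u,-)$ a bijection from $V$ onto $\mathrm{Hom}_A(V,A)$). $\overline{V}=V/V\mathfrak{r}^\ell$ is the free $B$-module of rank $m$ with the non-degenerate hermitian form $\overline{h}(v+V\mathfrak{r}^\ell,w+V\mathfrak{r}^\ell)=h(v,w)+\mathfrak{r}^\ell$. $U_m(B)$ is the unitary group of $(\overline{V},\overline{h})$, i.e. the group of $B$-linear automorphisms of $\overline{V}$ preserving $\overline{h}$. A vector of $\overline{V}$ is primitive if it belongs to a basis of $\overline{V}$; $\langle u\rangle^\perp=\{v\in\overline V:\overline{h}(u,v)=0\}$. Kinds. Fix a unit $\epsilon$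 of $\overline{R}$ that is not a square in $\overline{R}^*$. A non-degenerate hermitian form on a free $B$-module of rank $n$ is of kind I (resp. kind II) if relative to some basis its matrix is diagonal with diagonal entries: for $n$ even, $1,-1,\dots,1,-1$ (resp. $1,-1,\dots,1,-\epsilon$); for $n$ odd, $1,-1,\dots,1,-1,-1$ (resp. $1,-1,\dots,1,-1,-\epsilon$). Every such form is of exactly one kind. (The indices $[U_m(B):S_u]$, divided by $2q^{\ell-f}$, are the degrees of the irreducible constituents of the top layer of the Weil representation of $U_m(A)$.) *)

theory Defs
  imports "HOL-Algebra.Algebra"
begin

section \<open>Local fields\<close>

text \<open>
  The value of a valuation at zero is junk; \<open>val_ball\<close> takes \<open>\<nu> \<zero> = \<infinity>\<close> into account.
\<close>

definition val_ball :: "('a, 'c) ring_scheme \<Rightarrow> ('a \<Rightarrow> int) \<Rightarrow> int \<Rightarrow> 'a set" where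
  "val_ball K \<nu> n = {x \<in> carrier K. x = \<zero>\<^bsub>K\<^esub> \<or> n \<le> \<nu> x}"

abbreviation val_ring :: "('a, 'c) ring_scheme \<Rightarrow> ('a \<Rightarrow> int) \<Rightarrow> ('a, 'c) ring_scheme" where
  "val_ring K \<nu> \<equiv> K\<lparr>carrier := val_ball K \<nu> 0\<rparr>"

abbreviation val_ideal :: "('a, 'c) ring_scheme \<Rightarrow> ('a \<Rightarrow> int) \<Rightarrow> 'a set" where
  "val_ideal K \<nu> \<equiv> val_ball K \<nu> 1"

abbreviation residue_field :: "('a, 'c) ring_scheme \<Rightarrow> ('a \<Rightarrow> int) \<Rightarrow> 'a set ring" where
  "residue_field K \<nu> \<equiv> val_ring K \<nu> Quot val_ideal K \<nu>"

text \<open>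
  A non-archimedean local field: complete with respect to a normalized discrete valuation
  with finite residue field.
\<close>

locale nonarch_local_field = field K for K (structure) +
  fixes \<nu> :: "'a \<Rightarrow> int"
  assumes val_mult: "\<lbrakk>x \<in> carrier K - {\<zero>}; y \<in> carrier K - {\<zero>}\<rbrakk> \<Longrightarrow> \<nu> (x \<otimes> y) = \<nu> x + \<nu> y"
    and val_add: "\<lbrakk>x \<in> carrier K - {\<zero>}; y \<in> carrier K - {\<zero>}; x \<oplus> y \<noteq> \<zero>\<rbrakk>
      \<Longrightarrow> min (\<nu> x) (\<nu> y) \<le> \<nu> (x \<oplus> y)"
    and val_normalized: "\<exists>x \<in> carrier K - {\<zero>}. \<nu> x = 1"
    and val_complete: "\<lbrakk>range s \<subseteq> carrier K;
        \<forall>N. \<exists>k::nat. \<forall>i\<ge>k. \<forall>j\<ge>k. s i \<ominus> s j \<in> val_ball K \<nu> N\<rbrakk>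
      \<Longrightarrow> \<exists>x \<in> carrier K. \<forall>N. \<exists>k. \<forall>i\<ge>k. s i \<ominus> x \<in> val_ball K \<nu> N"
    and residue_finite: "finite (carrier (residue_field K \<nu>))"

text \<open>
  Characteristic of a unital ring of positive characteristic, as the additive order of \<open>\<one>\<close>
  (\<open>group.ord\<close> is \<open>0\<close> for infinite order, so this also gives \<open>0\<close> in characteristic zero).
\<close>

definition ring_char :: "('a, 'c) ring_scheme \<Rightarrow> nat" where
  "ring_char R = group.ord (add_monoid R) \<one>\<^bsub>R\<^esub>"

text \<open>
  A ramified quadratic extension \<open>F / K\<close> (the normalized valuations satisfy \<open>\<omega> = 2 \<nu>\<close> on \<open>K\<close>),
  whose ring of integers is \<open>\<O>[\<rho>]\<close> with \<open>\<rho>\<^sup>2\<close> a prime element of \<open>\<O>\<close>, together with the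
  involution \<open>\<sigma>\<close> of that ring.  Only the values of \<open>\<sigma>\<close> on the ring of integers matter.
\<close>

locale ramified_quadratic_extension =
  nonarch_local_field F \<omega> +
  subfield K F +
  base: nonarch_local_field "F\<lparr>carrier := K\<rparr>" \<nu>
  for F :: "('a, 'c) ring_scheme" (structure) and \<omega> :: "'a \<Rightarrow> int"
    and K :: "'a set" and \<nu> :: "'a \<Rightarrow> int" +
  fixes \<rho> :: 'a and \<sigma> :: "'a \<Rightarrow> 'a"
  assumes quadratic: "dimension 2 K (carrier F)"
    and ramified: "x \<in> K - {\<zero>} \<Longrightarrow> \<omega> x = 2 * \<nu> x"
    and rho_closed: "\<rho> \<in> carrier F"
    and rho_square_integral: "\<rho> [^] (2::nat) \<in> carrier (val_ring (F\<lparr>carrier := K\<rparr>) \<nu>)"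
    and rho_square_prime: "ring_prime\<^bsub>val_ring (F\<lparr>carrier := K\<rparr>) \<nu>\<^esub> (\<rho> [^] (2::nat))"
    and integers_eq: "carrier (val_ring F \<omega>) =
      {a \<oplus> b \<otimes> \<rho> | a b. a \<in> carrier (val_ring (F\<lparr>carrier := K\<rparr>) \<nu>) \<and>
                        b \<in> carrier (val_ring (F\<lparr>carrier := K\<rparr>) \<nu>)}"
    and sigma_hom: "\<sigma> \<in> ring_hom (val_ring F \<omega>) (val_ring F \<omega>)"
    and sigma_fixes: "x \<in> carrier (val_ring (F\<lparr>carrier := K\<rparr>) \<nu>) \<Longrightarrow> \<sigma> x = x"
    and sigma_rho: "\<sigma> \<rho> = \<ominus> \<rho>"


section \<open>Quotients\<close>

abbreviation ideal_pow :: "('a, 'c) ring_scheme \<Rightarrow> 'a set \<Rightarrow> nat \<Rightarrow> 'a set" where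
  "ideal_pow R I n \<equiv> I [^]\<^bsub>ideals_set R\<^esub> n"

text \<open>The image of an ideal \<open>J\<close> of \<open>R\<close> in \<open>R Quot I\<close>.\<close>

definition ideal_image :: "('a, 'c) ring_scheme \<Rightarrow> 'a set \<Rightarrow> 'a set \<Rightarrow> 'a set set" where
  "ideal_image R I J = (\<lambda>x. I +>\<^bsub>R\<^esub> x) ` J"

text \<open>
  The map induced on cosets by a ring automorphism \<open>f\<close> with \<open>f ` I = I\<close>:
  then \<open>f ` (I +> x) = I +> f x\<close>.
\<close>

definition quot_map :: "('a \<Rightarrow> 'a) \<Rightarrow> 'a set \<Rightarrow> 'a set" where
  "quot_map f C = f ` C"

definition ideal_smult :: "'a set \<Rightarrow> ('a, 'v, 'd) module_scheme \<Rightarrow> 'v set" where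
  "ideal_smult J M = generate (add_monoid M) {a \<odot>\<^bsub>M\<^esub> v | a v. a \<in> J \<and> v \<in> carrier M}"

text \<open>
  The module \<open>M / J M\<close> over \<open>R Quot J\<close>.  The fields \<open>mult\<close> and \<open>one\<close> of a module record
  carry no meaning.  Scalar multiplication follows the pattern of \<^const>\<open>rcoset_mult\<close>.
\<close>

definition quot_module :: "'a set \<Rightarrow> ('a, 'v, 'd) module_scheme \<Rightarrow> ('a set, 'v set) module" where
  "quot_module J M =
    \<lparr>carrier = a_rcosets\<^bsub>M\<^esub> (ideal_smult J M), monoid.mult = undefined, one = undefined,
     ring.zero = ideal_smult J M, ring.add = set_add M,
     module.smult = (\<lambda>C D. \<Union>a\<in>C. \<Union>v\<in>D. ideal_smult J M +>\<^bsub>M\<^esub> (a \<odot>\<^bsub>M\<^esub> v))\<rparr>"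

text \<open>The induced form \<open>(v + M J, w + M J) \<mapsto> h v w + J\<close>, in the same style.\<close>

definition quot_form ::
    "('a, 'c) ring_scheme \<Rightarrow> 'a set \<Rightarrow> ('v \<Rightarrow> 'v \<Rightarrow> 'a) \<Rightarrow> 'v set \<Rightarrow> 'v set \<Rightarrow> 'a set" where
  "quot_form R J h C D = (\<Union>v\<in>C. \<Union>w\<in>D. J +>\<^bsub>R\<^esub> h v w)"


section \<open>Free modules and hermitian forms\<close>

definition is_basis ::
    "('a, 'c) ring_scheme \<Rightarrow> ('a, 'v, 'd) module_scheme \<Rightarrow> nat \<Rightarrow> (nat \<Rightarrow> 'v) \<Rightarrow> bool" where
  "is_basis R M n e \<longleftrightarrow>
    (\<forall>i<n. e i \<in> carrier M) \<and>
    (\<forall>v \<in> carrier M. \<exists>c \<in> {..<n} \<rightarrow> carrier R. v = (\<Oplus>\<^bsub>M\<^esub>i\<in>{..<n}. c i \<odot>\<^bsub>M\<^esub> e i)) \<and>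
    (\<forall>c \<in> {..<n} \<rightarrow> carrier R.
       (\<Oplus>\<^bsub>M\<^esub>i\<in>{..<n}. c i \<odot>\<^bsub>M\<^esub> e i) = \<zero>\<^bsub>M\<^esub> \<longrightarrow> (\<forall>i<n. c i = \<zero>\<^bsub>R\<^esub>))"

definition free_of_rank ::
    "('a, 'c) ring_scheme \<Rightarrow> ('a, 'v, 'd) module_scheme \<Rightarrow> nat \<Rightarrow> bool" where
  "free_of_rank R M n \<longleftrightarrow> module R M \<and> (\<exists>e. is_basis R M n e)"

definition primitive ::
    "('a, 'c) ring_scheme \<Rightarrow> ('a, 'v, 'd) module_scheme \<Rightarrow> 'v \<Rightarrow> bool" where
  "primitive R M u \<longleftrightarrow> (\<exists>n e. is_basis R M n e \<and> u \<in> e ` {..<n})"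

definition dual_space ::
    "('a, 'c) ring_scheme \<Rightarrow> ('a, 'v, 'd) module_scheme \<Rightarrow> ('v \<Rightarrow> 'a) set" where
  "dual_space R M = {f \<in> carrier M \<rightarrow>\<^sub>E carrier R.
    (\<forall>v \<in> carrier M. \<forall>w \<in> carrier M. f (v \<oplus>\<^bsub>M\<^esub> w) = f v \<oplus>\<^bsub>R\<^esub> f w) \<and>
    (\<forall>a \<in> carrier R. \<forall>v \<in> carrier M. f (a \<odot>\<^bsub>M\<^esub> v) = a \<otimes>\<^bsub>R\<^esub> f v)}"

definition hermitian_form ::
    "('a, 'c) ring_scheme \<Rightarrow> ('a \<Rightarrow> 'a) \<Rightarrow> ('a, 'v, 'd) module_scheme \<Rightarrow> ('v \<Rightarrow> 'v \<Rightarrow> 'a) \<Rightarrow> bool"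
  where
  "hermitian_form R invol M h \<longleftrightarrow>
    (\<forall>v \<in> carrier M. \<forall>w \<in> carrier M. h v w \<in> carrier R) \<and>
    (\<forall>u \<in> carrier M. \<forall>v \<in> carrier M. \<forall>w \<in> carrier M.
       h (u \<oplus>\<^bsub>M\<^esub> v) w = h u w \<oplus>\<^bsub>R\<^esub> h v w \<and> h w (u \<oplus>\<^bsub>M\<^esub> v) = h w u \<oplus>\<^bsub>R\<^esub> h w v) \<and>
    (\<forall>v \<in> carrier M. \<forall>w \<in> carrier M. \<forall>a \<in> carrier R. h v (a \<odot>\<^bsub>M\<^esub> w) = h v w \<otimes>\<^bsub>R\<^esub> a) \<and>
    (\<forall>u \<in> carrier M. \<forall>v \<in> carrier M. h v u = invol (h u v))"

definition nondegenerate ::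
    "('a, 'c) ring_scheme \<Rightarrow> ('a, 'v, 'd) module_scheme \<Rightarrow> ('v \<Rightarrow> 'v \<Rightarrow> 'a) \<Rightarrow> bool" where
  "nondegenerate R M h \<longleftrightarrow>
    bij_betw (\<lambda>u. \<lambda>v \<in> carrier M. h u v) (carrier M) (dual_space R M)"

definition unitary_group ::
    "('a, 'c) ring_scheme \<Rightarrow> ('a, 'v, 'd) module_scheme \<Rightarrow> ('v \<Rightarrow> 'v \<Rightarrow> 'a) \<Rightarrow> ('v \<Rightarrow> 'v) monoid"
  where
  "unitary_group R M h = (BijGroup (carrier M))\<lparr>carrier := {g \<in> Bij (carrier M).
    (\<forall>v \<in> carrier M. \<forall>w \<in> carrier M. g (v \<oplus>\<^bsub>M\<^esub> w) = g v \<oplus>\<^bsub>M\<^esub> g w) \<and>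
    (\<forall>a \<in> carrier R. \<forall>v \<in> carrier M. g (a \<odot>\<^bsub>M\<^esub> v) = a \<odot>\<^bsub>M\<^esub> g v) \<and>
    (\<forall>v \<in> carrier M. \<forall>w \<in> carrier M. h (g v) (g w) = h v w)}\<rparr>"

definition perp ::
    "('a, 'c) ring_scheme \<Rightarrow> ('a, 'v, 'd) module_scheme \<Rightarrow> ('v \<Rightarrow> 'v \<Rightarrow> 'a) \<Rightarrow> 'v
      \<Rightarrow> ('a, 'v, 'd) module_scheme" where
  "perp R M h u = M\<lparr>carrier := {v \<in> carrier M. h u v = \<zero>\<^bsub>R\<^esub>}\<rparr>"

text \<open>
  \<open>diagonalizes_to R M h n \<delta>\<close>: relative to some basis of length \<open>n\<close> the matrix of \<open>h\<close> is
  diagonal with entries \<open>1, -1, 1, -1, \<dots>\<close>, except that the last entry is \<open>-\<delta>\<close>.  For \<open>n\<close> even this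
  is \<open>1, -1, \<dots>, 1, -\<delta>\<close>; for \<open>n\<close> odd it is \<open>1, -1, \<dots>, 1, -1, -\<delta>\<close>.
\<close>

definition diagonalizes_to ::
    "('a, 'c) ring_scheme \<Rightarrow> ('a, 'v, 'd) module_scheme \<Rightarrow> ('v \<Rightarrow> 'v \<Rightarrow> 'a) \<Rightarrow> nat \<Rightarrow> 'a \<Rightarrow> bool"
  where
  "diagonalizes_to R M h n \<delta> \<longleftrightarrow> (\<exists>e. is_basis R M n e \<and>
    (\<forall>i<n. \<forall>j<n. h (e i) (e j) =
       (if i \<noteq> j then \<zero>\<^bsub>R\<^esub>
        else if Suc i = n then \<ominus>\<^bsub>R\<^esub> \<delta>
        else if even i then \<one>\<^bsub>R\<^esub> else \<ominus>\<^bsub>R\<^esub> \<one>\<^bsub>R\<^esub>)))"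

text \<open>
  Over a nontrivial commutative ring the length \<open>n\<close> of a basis is the rank of the module, so it
  need not be a parameter.  Any form satisfying one of these predicates is non-degenerate, since
  its matrix is invertible.
\<close>

definition kind_I ::
    "('a, 'c) ring_scheme \<Rightarrow> ('a, 'v, 'd) module_scheme \<Rightarrow> ('v \<Rightarrow> 'v \<Rightarrow> 'a) \<Rightarrow> bool" where
  "kind_I R M h \<longleftrightarrow> (\<exists>n. diagonalizes_to R M h n \<one>\<^bsub>R\<^esub>)"

definition kind_II ::
    "('a, 'c) ring_scheme \<Rightarrow> 'a \<Rightarrow> ('a, 'v, 'd) module_scheme \<Rightarrow> ('v \<Rightarrow> 'v \<Rightarrow> 'a) \<Rightarrow> bool" where
  "kind_II R \<epsilon> M h \<longleftrightarrow> (\<exists>n. diagonalizes_to R M h n \<epsilon>)"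

definition group_index :: "('g, 'c) monoid_scheme \<Rightarrow> 'g set \<Rightarrow> nat" where
  "group_index G H = card (rcosets\<^bsub>G\<^esub> H)"

end

theory Submission
  imports Defs
begin

text \<open>
  The index of \<open>S\<^sub>u\<close> is the size of the orbit of \<open>u\<close>.  That orbit is the whole set of vectors
  \<open>v\<close> with \<open>h v v = t\<close>, so the theorem is a count of the solutions of one hermitian equation
  over the finite local ring \<open>B\<close>.

  The orbit.  Since the residue characteristic is odd and the involution is trivial modulo the
  maximal ideal, a quasi-reflection sends \<open>u\<close> to any vector \<open>v\<close> of the same unit norm, up to sign:
  with \<open>w = u - v\<close> and \<open>s = h w u\<close> one has \<open>h w w = s + s\<^sup>*\<close>, and
  \<open>x \<mapsto> x - w s\<^sup>-\<^sup>1 h(w, x)\<close> is unitary and sends \<open>u\<close> to \<open>v\<close> as soon as \<open>s\<close> is a unit.  If it is not,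
  then the corresponding scalar for the pair \<open>u\<close>, \<open>-v\<close> is a unit, because the two scalars add up
  to \<open>2 h u u\<close> (\<open>witt_transitivity\<close>).

  Reduction to the residue field.  The number of \<open>v\<close> with \<open>h v v = t\<close> depends only on the unit \<open>t\<close>
  modulo the maximal ideal: a fixed element \<open>1 + z\<close> with \<open>z\<close> in the maximal ideal is the square of
  a fixed unit \<open>w\<close> (squaring is injective on the finite set of such elements), and scaling by \<open>w\<close>
  carries norm \<open>t\<close> to norm \<open>t (1 + z)\<close>.  Summing over the \<open>q\<^sup>f\<^sup>-\<^sup>1\<close> fixed elements \<open>z\<close> of the maximal
  ideal counts all vectors whose norm is congruent to \<open>t\<close>, and those are the \<open>q\<^sup>(\<^sup>l\<^sup>-\<^sup>1\<^sup>)\<^sup>m\<close>-fold lifts of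
  the solutions of a diagonal quadratic equation over the residue field
  (\<open>card_norm_eq\<close>).  This replaces Hensel lifting.

  Counting over the residue field.  For the coefficients \<open>1, -1, 1, -1, \<dots>\<close> the count follows by
  adding one hyperbolic plane at a time.  If the last coefficient \<open>-1\<close> is replaced by \<open>-\<delta>\<close> with
  \<open>\<delta>\<close> a non-square, then the old and the new count add up to twice the average count over all right-hand sides, since
  \<open>y\<^sup>2\<close> and \<open>\<delta> y\<^sup>2\<close> together take every value exactly twice.  In odd rank the vector \<open>u\<close> itself is
  added to a diagonal basis of its orthogonal complement.

  The arithmetic input is that \<open>B\<close> is such a ring, with \<open>q\<^sup>l\<^sup>-\<^sup>1\<close> elements in its maximal ideal, of which
  \<open>q\<^sup>f\<^sup>-\<^sup>1\<close> are fixed.  For this \<open>B\<close> is viewed as the quotient of the ring of integers of \<open>F\<close> by the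
  elements of valuation at least \<open>l\<close>, and the elements are enumerated by their coordinates relative
  to \<open>1\<close> and \<open>\<rho>\<close>; the coordinate at \<open>1\<close> matters modulo \<open>\<pi>\<^sup>f\<close> and the one at \<open>\<rho>\<close> modulo \<open>\<pi>\<^sup>l\<^sup>-\<^sup>f\<close>.
\<close>

section \<open>Diagonal quadratic equations over a finite field of odd characteristic\<close>

text \<open>
  The number of solutions of \<open>a\<^sub>0 x\<^sub>0\<^sup>2 + \<dots> + a\<^sub>n\<^sub>-\<^sub>1 x\<^sub>n\<^sub>-\<^sub>1\<^sup>2 = c\<close>, obtained by summing over the last coordinate.
  The recursive form lets coordinates be added, and lifted to a ring with residue field \<open>k\<close>,
  one at a time.
\<close>

primrec quad_count :: "('a, 'c) ring_scheme \<Rightarrow> (nat \<Rightarrow> 'a) \<Rightarrow> nat \<Rightarrow> 'a \<Rightarrow> nat" where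
  "quad_count k a 0 c = (if c = \<zero>\<^bsub>k\<^esub> then 1 else 0)"
| "quad_count k a (Suc n) c =
     (\<Sum>y\<in>carrier k. quad_count k a n (c \<ominus>\<^bsub>k\<^esub> a n \<otimes>\<^bsub>k\<^esub> (y \<otimes>\<^bsub>k\<^esub> y)))"

lemma quad_count_cong:
  "(\<And>i. i < n \<Longrightarrow> a i = b i) \<Longrightarrow> quad_count k a n c = quad_count k b n c"
proof (induction n arbitrary: c)
  case (Suc n)
  have "a n = b n" "quad_count k a n d = quad_count k b n d" for d
    using Suc.prems by (auto intro: Suc.IH)
  then show ?case by simp
qed simp

definition alternating :: "('a, 'c) ring_scheme \<Rightarrow> nat \<Rightarrow> 'a" where
  "alternating k i = (if even i then \<one>\<^bsub>k\<^esub> else \<ominus>\<^bsub>k\<^esub> \<one>\<^bsub>k\<^esub>)"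

locale odd_finite_field = field k for k (structure) +
  assumes fin: "finite (carrier k)" and two: "\<one> \<oplus> \<one> \<noteq> \<zero>"
begin

abbreviation order_k :: nat where "order_k \<equiv> card (carrier k)"

lemma sum_translate:
  fixes G :: "'a \<Rightarrow> nat"
  assumes "c \<in> carrier k"
  shows "(\<Sum>d\<in>carrier k. G (c \<oplus> d)) = (\<Sum>d\<in>carrier k. G d)"
  by (rule sum.reindex_bij_witness[where i="\<lambda>d. d \<ominus> c" and j="\<lambda>d. c \<oplus> d"])
     (use assms in \<open>auto simp: a_minus_def a_ac r_neg r_neg1 r_neg2 a_lcomm[of c]\<close>)

lemma sum_minus_scale:
  fixes G :: "'a \<Rightarrow> nat"
  assumes "c \<in> carrier k" "s \<in> carrier k" "s \<noteq> \<zero>"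
  shows "(\<Sum>d\<in>carrier k. G (c \<ominus> s \<otimes> d)) = (\<Sum>d\<in>carrier k. G d)"
proof -
  have s: "s \<in> Units k" using assms field_Units by blast
  have 1: "inv s \<otimes> (c \<ominus> (c \<ominus> s \<otimes> d)) = d" if "d \<in> carrier k" for d
  proof -
    have "c \<ominus> (c \<ominus> s \<otimes> d) = s \<otimes> d" using assms that by algebra
    then show ?thesis using s that assms by (simp add: m_assoc[symmetric])
  qed
  have 2: "c \<ominus> s \<otimes> (inv s \<otimes> (c \<ominus> d)) = d" if "d \<in> carrier k" for d
  proof -
    have "s \<otimes> (inv s \<otimes> (c \<ominus> d)) = c \<ominus> d" using s assms that by (simp add: m_assoc[symmetric])
    moreover have "c \<ominus> (c \<ominus> d) = d"
      using assms that by (simp add: a_minus_def minus_add a_assoc[symmetric] r_neg)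
    ultimately show ?thesis by simp
  qed
  show ?thesis
    by (rule sum.reindex_bij_witness[where i="\<lambda>d. inv s \<otimes> (c \<ominus> d)" and j="\<lambda>d. c \<ominus> s \<otimes> d"])
       (use assms s 1 2 in auto)
qed

lemma quad_count_total:
  assumes "\<And>i. i < n \<Longrightarrow> a i \<in> carrier k"
  shows "(\<Sum>c\<in>carrier k. quad_count k a n c) = order_k ^ n"
  using assms
proof (induction n)
  case 0
  then show ?case using fin by (simp add: sum.delta)
next
  case (Suc n)
  have "(\<Sum>c\<in>carrier k. quad_count k a (Suc n) c)
      = (\<Sum>y\<in>carrier k. \<Sum>c\<in>carrier k. quad_count k a n (c \<ominus> a n \<otimes> (y \<otimes> y)))"
    unfolding quad_count.simps by (rule sum.swap)
  also have "\<dots> = (\<Sum>y\<in>carrier k. \<Sum>c\<in>carrier k. quad_count k a n c)"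
  proof (rule sum.cong[OF refl])
    fix y assume y: "y \<in> carrier k"
    have "(\<Sum>c\<in>carrier k. quad_count k a n (c \<ominus> a n \<otimes> (y \<otimes> y))) =
       (\<Sum>c\<in>carrier k. quad_count k a n (\<ominus> (a n \<otimes> (y \<otimes> y)) \<oplus> c))"
      using y Suc.prems[of n] by (intro sum.cong refl) (auto simp: a_minus_def a_comm)
    also have "\<dots> = (\<Sum>c\<in>carrier k. quad_count k a n c)"
      using y Suc.prems[of n] by (intro sum_translate) auto
    finally show "(\<Sum>c\<in>carrier k. quad_count k a n (c \<ominus> a n \<otimes> (y \<otimes> y))) =
       (\<Sum>c\<in>carrier k. quad_count k a n c)" .
  qed
  finally show ?case using Suc by simp
qed

text \<open>
  In the coordinates \<open>s = z - y\<close> and \<open>t = z + y\<close> the hyperbolic plane \<open>z\<^sup>2 - y\<^sup>2\<close> is the product \<open>s t\<close>.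
  For each \<open>s \<noteq> 0\<close> the value \<open>c - s t\<close> runs through \<open>k\<close> once, and \<open>s = 0\<close> gives \<open>G c\<close> for all \<open>t\<close>.
\<close>

lemma hyperbolic_plane_sum:
  fixes G :: "'a \<Rightarrow> nat"
  assumes c: "c \<in> carrier k"
  shows "(\<Sum>y\<in>carrier k. \<Sum>z\<in>carrier k. G (c \<ominus> \<ominus> \<one> \<otimes> (y \<otimes> y) \<ominus> \<one> \<otimes> (z \<otimes> z)))
           + (\<Sum>d\<in>carrier k. G d)
       = order_k * (\<Sum>d\<in>carrier k. G d) + order_k * G c"
proof -
  let ?K = "carrier k" and ?h = "inv (\<one> \<oplus> \<one>)"
  have u2: "\<one> \<oplus> \<one> \<in> Units k" using two field_Units by blast
  have h: "?h \<in> ?K" "?h \<otimes> (\<one> \<oplus> \<one>) = \<one>" using u2 by auto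
  have half: "?h \<otimes> (x \<oplus> x) = x" if "x \<in> ?K" for x
  proof -
    have "?h \<otimes> (x \<oplus> x) = (?h \<otimes> (\<one> \<oplus> \<one>)) \<otimes> x" using h(1) that by algebra
    then show ?thesis using h that by simp
  qed
  have e1: "(z \<oplus> y) \<ominus> (z \<ominus> y) = y \<oplus> y" "(z \<oplus> y) \<oplus> (z \<ominus> y) = z \<oplus> z"
       "?h \<otimes> (z \<oplus> y) \<ominus> ?h \<otimes> (z \<ominus> y) = ?h \<otimes> (y \<oplus> y)"
       "?h \<otimes> (z \<oplus> y) \<oplus> ?h \<otimes> (z \<ominus> y) = ?h \<otimes> (z \<oplus> z)"
       "c \<ominus> (z \<ominus> y) \<otimes> (z \<oplus> y) = c \<ominus> \<ominus> \<one> \<otimes> (y \<otimes> y) \<ominus> \<one> \<otimes> (z \<otimes> z)"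
    if "y \<in> ?K" "z \<in> ?K" for y z
    using that c h(1) by algebra+
  have "(\<Sum>y\<in>?K. \<Sum>z\<in>?K. G (c \<ominus> \<ominus> \<one> \<otimes> (y \<otimes> y) \<ominus> \<one> \<otimes> (z \<otimes> z)))
      = (\<Sum>(y, z)\<in>?K \<times> ?K. G (c \<ominus> \<ominus> \<one> \<otimes> (y \<otimes> y) \<ominus> \<one> \<otimes> (z \<otimes> z)))"
    by (rule sum.cartesian_product)
  also have "\<dots> = (\<Sum>(s, t)\<in>?K \<times> ?K. G (c \<ominus> s \<otimes> t))"
    by (rule sum.reindex_bij_witness[where
        j="\<lambda>(y, z). (z \<ominus> y, z \<oplus> y)" and
        i="\<lambda>(s, t). (?h \<otimes> (t \<ominus> s), ?h \<otimes> (t \<oplus> s))"])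
      (use h(1) e1 half in auto)
  also have "\<dots> = (\<Sum>s\<in>?K. \<Sum>d\<in>?K. G (c \<ominus> s \<otimes> d))"
    by (rule sum.cartesian_product[symmetric])
  also have "\<dots> = (\<Sum>d\<in>?K. G (c \<ominus> \<zero> \<otimes> d)) + (\<Sum>s\<in>?K - {\<zero>}. \<Sum>d\<in>?K. G (c \<ominus> s \<otimes> d))"
    using fin by (subst sum.remove[of _ \<zero>]) auto
  also have "(\<Sum>d\<in>?K. G (c \<ominus> \<zero> \<otimes> d)) = order_k * G c"
    using c by (simp add: a_minus_def)
  also have "(\<Sum>s\<in>?K - {\<zero>}. \<Sum>d\<in>?K. G (c \<ominus> s \<otimes> d)) = (order_k - 1) * (\<Sum>d\<in>?K. G d)"
    using c fin by (simp add: sum_minus_scale)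
  finally have split: "(\<Sum>y\<in>?K. \<Sum>z\<in>?K. G (c \<ominus> \<ominus> \<one> \<otimes> (y \<otimes> y) \<ominus> \<one> \<otimes> (z \<otimes> z)))
      = order_k * G c + (order_k - 1) * (\<Sum>d\<in>?K. G d)" .
  have "0 < order_k" using fin zero_closed card_gt_0_iff by blast
  then have "order_k * (\<Sum>d\<in>?K. G d) = (order_k - 1) * (\<Sum>d\<in>?K. G d) + (\<Sum>d\<in>?K. G d)"
    by (metis Suc_diff_1 add.commute mult_Suc)
  then show ?thesis unfolding split by simp
qed

lemma square_eq_iff:
  assumes "x \<in> carrier k" "y \<in> carrier k"
  shows "x \<otimes> x = y \<otimes> y \<longleftrightarrow> x = y \<or> x = \<ominus> y"
proof
  assume "x \<otimes> x = y \<otimes> y"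
  moreover have "(x \<ominus> y) \<otimes> (x \<oplus> y) = x \<otimes> x \<ominus> y \<otimes> y" using assms by algebra
  ultimately have "(x \<ominus> y) \<otimes> (x \<oplus> y) = \<zero>" using assms by simp
  then have "x \<ominus> y = \<zero> \<or> x \<oplus> y = \<zero>" using assms integral by blast
  then show "x = y \<or> x = \<ominus> y"
    using assms by (metis minus_equality a_comm r_right_minus_eq)
qed (use assms in \<open>auto simp: l_minus r_minus\<close>)

lemma card_roots_of_one: "card {x \<in> carrier k. x \<otimes> x = \<one>} = 2"
proof -
  have "{x \<in> carrier k. x \<otimes> x = \<one>} = {\<one>, \<ominus> \<one>}"
    using square_eq_iff[of _ \<one>] by auto
  moreover have "\<one> \<noteq> \<ominus> \<one>" using two by (metis one_closed r_neg)
  ultimately show ?thesis by simp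
qed

text \<open>
  No value is taken more than twice: a non-zero value has at most two square roots and is not
  at the same time a square and \<open>\<delta>\<close> times a square.  There are \<open>2 q\<close> arguments for \<open>q\<close> values, so
  every value is taken exactly twice.
\<close>

lemma nonsquare_fibres:
  assumes del: "\<delta> \<in> carrier k" and ns: "\<And>x. x \<in> carrier k \<Longrightarrow> \<delta> \<noteq> x \<otimes> x"
    and d: "d \<in> carrier k"
  shows "card {y \<in> carrier k. y \<otimes> y = d} + card {y \<in> carrier k. \<delta> \<otimes> (y \<otimes> y) = d} = 2"
proof -
  let ?K = "carrier k"
  define s where "s d = card {y \<in> ?K. y \<otimes> y = d} + card {y \<in> ?K. \<delta> \<otimes> (y \<otimes> y) = d}" for d
  have del0: "\<delta> \<noteq> \<zero>" using ns[of \<zero>] by auto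
  then have delU: "\<delta> \<in> Units k" using del field_Units by blast
  have root: "card {y \<in> ?K. y \<otimes> y = e} \<le> 2" if "e \<in> ?K" for e
  proof (cases "\<exists>y\<in>?K. y \<otimes> y = e")
    case True
    then obtain y where y: "y \<in> ?K" "y \<otimes> y = e" by blast
    then have "{y \<in> ?K. y \<otimes> y = e} \<subseteq> {y, \<ominus> y}" using square_eq_iff by auto
    then have "card {y \<in> ?K. y \<otimes> y = e} \<le> card {y, \<ominus> y}" by (intro card_mono) auto
    also have "\<dots> \<le> 2" by (simp add: card_insert_if)
    finally show ?thesis .
  next
    case False
    then have "{y \<in> ?K. y \<otimes> y = e} = {}" by blast
    then show ?thesis by (metis card.empty zero_le)
  qed
  have div: "{y \<in> ?K. \<delta> \<otimes> (y \<otimes> y) = e} = {y \<in> ?K. y \<otimes> y = inv \<delta> \<otimes> e}" if e: "e \<in> ?K" for e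
  proof -
    have "\<delta> \<otimes> (y \<otimes> y) = e \<longleftrightarrow> y \<otimes> y = inv \<delta> \<otimes> e" if "y \<in> ?K" for y
      using e that delU del by (metis Units_inv_closed Units_l_inv Units_r_inv l_one m_assoc m_closed)
    then show ?thesis by auto
  qed
  have le2: "s d \<le> 2" if d: "d \<in> ?K" for d
  proof (cases "d = \<zero>")
    case True
    have 1: "{y \<in> ?K. y \<otimes> y = \<zero>} = {\<zero>}" using integral by auto
    have 2: "{y \<in> ?K. \<delta> \<otimes> (y \<otimes> y) = \<zero>} = {\<zero>}"
      using integral del0 del by (auto simp: integral_iff)
    show ?thesis using True unfolding s_def by (simp add: 1 2)
  next
    case False
    show ?thesis
    proof (cases "\<exists>y\<in>?K. y \<otimes> y = d")
      case True
      then obtain y where y: "y \<in> ?K" "y \<otimes> y = d" by blast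
      have e: "{z \<in> ?K. \<delta> \<otimes> (z \<otimes> z) = d} = {}"
      proof (rule ccontr)
        assume "{z \<in> ?K. \<delta> \<otimes> (z \<otimes> z) = d} \<noteq> {}"
        then obtain z where z: "z \<in> ?K" "\<delta> \<otimes> (z \<otimes> z) = d" by blast
        have "z \<noteq> \<zero>" using z False del by auto
        then have zU: "z \<in> Units k" using z field_Units by blast
        have "(y \<otimes> inv z) \<otimes> (y \<otimes> inv z) = (y \<otimes> y) \<otimes> (inv z \<otimes> inv z)"
          using y(1) zU by (simp add: m_ac)
        also have "\<dots> = \<delta> \<otimes> ((z \<otimes> inv z) \<otimes> (z \<otimes> inv z))"
          unfolding y(2)[unfolded z(2)[symmetric]] using z(1) zU del by (simp add: m_ac)
        also have "\<dots> = \<delta>" using zU del by simp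
        finally show False using ns[of "y \<otimes> inv z"] y zU by auto
      qed
      show ?thesis unfolding s_def e using root[OF d] by simp
    next
      case False
      then have e: "{y \<in> ?K. y \<otimes> y = d} = {}" by blast
      show ?thesis unfolding s_def div[OF d] e using root[of "inv \<delta> \<otimes> d"] d delU by simp
    qed
  qed
  have fib: "(\<Sum>d\<in>?K. card {y \<in> ?K. g y = d}) = order_k" if g: "g \<in> ?K \<rightarrow> ?K" for g
  proof -
    have "(\<Sum>d\<in>?K. card {y \<in> ?K. g y = d}) = card (\<Union>d\<in>?K. {y \<in> ?K. g y = d})"
      using fin by (intro card_UN_disjoint[symmetric]) auto
    also have "(\<Union>d\<in>?K. {y \<in> ?K. g y = d}) = ?K" using g by auto
    finally show ?thesis .
  qed
  have tot: "(\<Sum>d\<in>?K. s d) = 2 * order_k"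
    unfolding s_def sum.distrib using del by (subst (1 2) fib) auto
  have "(\<Sum>d\<in>?K. 2 - s d) = 0"
    using le2 tot by (subst sum_subtractf_nat) auto
  then have "2 - s d = 0" using d fin by simp
  then have "s d = 2" using le2[OF d] by simp
  then show ?thesis unfolding s_def .
qed

lemma sum_over_fibres:
  fixes G :: "'a \<Rightarrow> nat"
  assumes g: "g \<in> carrier k \<rightarrow> carrier k"
  shows "(\<Sum>y\<in>carrier k. G (g y)) = (\<Sum>d\<in>carrier k. card {y \<in> carrier k. g y = d} * G d)"
proof -
  have "(\<Sum>y\<in>carrier k. G (g y)) =
      (\<Sum>d\<in>carrier k. \<Sum>y\<in>{y. y \<in> carrier k \<and> g y = d}. G (g y))"
    by (rule sum.group[symmetric]) (use fin g in auto)
  also have "\<dots> = (\<Sum>d\<in>carrier k. card {y \<in> carrier k. g y = d} * G d)"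
    by (rule sum.cong) auto
  finally show ?thesis .
qed

text \<open>
  This makes the counts for a coefficient and for its multiple by a non-square complementary:
  their sum does not depend on the right-hand side of the equation.
\<close>

lemma sum_squares_and_nonsquares:
  fixes G :: "'a \<Rightarrow> nat"
  assumes del: "\<delta> \<in> carrier k" and ns: "\<And>x. x \<in> carrier k \<Longrightarrow> \<delta> \<noteq> x \<otimes> x"
  shows "(\<Sum>y\<in>carrier k. G (y \<otimes> y)) + (\<Sum>y\<in>carrier k. G (\<delta> \<otimes> (y \<otimes> y)))
       = 2 * (\<Sum>d\<in>carrier k. G d)"
proof -
  have 1: "(\<Sum>y\<in>carrier k. G (y \<otimes> y)) =
      (\<Sum>d\<in>carrier k. card {y \<in> carrier k. y \<otimes> y = d} * G d)"
    by (rule sum_over_fibres) auto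
  have 2: "(\<Sum>y\<in>carrier k. G (\<delta> \<otimes> (y \<otimes> y))) =
      (\<Sum>d\<in>carrier k. card {y \<in> carrier k. \<delta> \<otimes> (y \<otimes> y) = d} * G d)"
    using del by (intro sum_over_fibres) auto
  show ?thesis
    unfolding 1 2 sum.distrib[symmetric] add_mult_distrib[symmetric] sum_distrib_left
    by (rule sum.cong) (auto simp: nonsquare_fibres[OF del ns])
qed

text \<open>
  Induction on the number of hyperbolic planes.  The factor \<open>q\<close> on the left keeps the exponents
  non-negative, so that \<open>r = 0\<close> can start the induction.
\<close>

lemma quad_count_hyperbolic:
  assumes "c \<in> carrier k"
  shows "order_k * quad_count k (alternating k) (2 * r) c + order_k ^ r
       = order_k ^ (2 * r) + (if c = \<zero> then order_k ^ Suc r else 0)"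
  using assms
proof (induction r arbitrary: c)
  case (Suc r)
  let ?q = order_k and ?n = "quad_count k (alternating k) (2 * r)"
  have tot: "(\<Sum>d\<in>carrier k. ?n d) = ?q ^ (2 * r)"
    by (rule quad_count_total) (auto simp: alternating_def)
  have "quad_count k (alternating k) (2 * Suc r) c + ?q ^ (2 * r) = ?q * ?q ^ (2 * r) + ?q * ?n c"
    using hyperbolic_plane_sum[OF Suc.prems, of ?n] tot by (simp add: alternating_def)
  then have "?q * (quad_count k (alternating k) (2 * Suc r) c + ?q ^ (2 * r)) + ?q * ?q ^ r
       = ?q * ?q * ?q ^ (2 * r) + ?q * (?q * ?n c + ?q ^ r)" 
    by (simp add: algebra_simps)
  also have "\<dots> = ?q * ?q * ?q ^ (2 * r) + ?q * (?q ^ (2 * r) + (if c = \<zero> then ?q ^ Suc r else 0))"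
    using Suc.IH[OF Suc.prems] by simp
  finally show ?case by (auto simp: algebra_simps)
qed simp

lemma quad_count_nonsquare_last:
  assumes c: "c \<in> carrier k"
    and del: "\<delta> \<in> carrier k" and ns: "\<And>x. x \<in> carrier k \<Longrightarrow> \<delta> \<noteq> x \<otimes> x"
    and r: "r \<ge> 1"
  shows "quad_count k ((alternating k)(2 * r - 1 := \<ominus> \<delta>)) (2 * r) c
       + quad_count k (alternating k) (2 * r) c = 2 * order_k ^ (2 * r - 1)"
proof -
  let ?a = "alternating k" and ?n = "2 * r - 1"
  have n: "2 * r = Suc ?n" "odd ?n" using r by auto
  define G where "G z = quad_count k ?a ?n (c \<oplus> z)" for z
  have tot: "(\<Sum>d\<in>carrier k. G d) = order_k ^ ?n"
    unfolding G_def by (subst sum_translate[OF c]) (simp add: quad_count_total alternating_def)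
  have "quad_count k (?a(?n := \<ominus> \<delta>)) ?n d = quad_count k ?a ?n d" for d
    by (rule quad_count_cong) auto
  moreover have "c \<ominus> (\<ominus> \<delta>) \<otimes> (y \<otimes> y) = c \<oplus> \<delta> \<otimes> (y \<otimes> y)" if "y \<in> carrier k" for y
    using that c del by algebra
  ultimately have 1: "quad_count k (?a(?n := \<ominus> \<delta>)) (Suc ?n) c = (\<Sum>y\<in>carrier k. G (\<delta> \<otimes> (y \<otimes> y)))"
    by (simp add: G_def)
  have "c \<ominus> (\<ominus> \<one>) \<otimes> (y \<otimes> y) = c \<oplus> (y \<otimes> y)" if "y \<in> carrier k" for y
    using that c by algebra
  then have 2: "quad_count k ?a (Suc ?n) c = (\<Sum>y\<in>carrier k. G (y \<otimes> y))"
    unfolding quad_count.simps G_def using n(2) by (simp add: alternating_def)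
  have "quad_count k (?a(?n := \<ominus> \<delta>)) (Suc ?n) c + quad_count k ?a (Suc ?n) c = 2 * order_k ^ ?n"
    unfolding 1 2 using sum_squares_and_nonsquares[OF del ns, of G] tot by simp
  then show ?thesis by (simp only: n(1)[symmetric])
qed

lemma order_k_pos: "0 < order_k"
  using fin zero_closed card_gt_0_iff by blast

lemma quad_count_even_split:
  assumes c: "c \<in> carrier k" "c \<noteq> \<zero>"
  shows "order_k * quad_count k (alternating k) (2 * r) c = order_k ^ r * (order_k ^ r - 1)"
proof -
  have "order_k * quad_count k (alternating k) (2 * r) c + order_k ^ r = order_k ^ r * order_k ^ r"
    using quad_count_hyperbolic[OF c(1), of r] c(2) by (simp add: power_add[symmetric] mult_2)
  then show ?thesis by (simp add: diff_mult_distrib2)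
qed

lemma quad_count_even_nonsplit:
  assumes c: "c \<in> carrier k" "c \<noteq> \<zero>"
    and del: "\<delta> \<in> carrier k" "\<And>x. x \<in> carrier k \<Longrightarrow> \<delta> \<noteq> x \<otimes> x" and r: "1 \<le> r"
  shows "order_k * quad_count k ((alternating k)(2 * r - 1 := \<ominus> \<delta>)) (2 * r) c
       = order_k ^ r * (order_k ^ r + 1)"
proof -
  let ?q = order_k and ?n = "quad_count k ((alternating k)(2 * r - 1 := \<ominus> \<delta>)) (2 * r) c"
    and ?h = "quad_count k (alternating k) (2 * r) c"
  have "?q * ?n + ?q * ?h = 2 * (?q * ?q ^ (2 * r - 1))"
    using quad_count_nonsquare_last[OF c(1) del r] by (simp add: add_mult_distrib2[symmetric])
  also have "?q * ?q ^ (2 * r - 1) = ?q ^ r * ?q ^ r"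
    using r by (simp add: power_Suc[symmetric] power_add[symmetric] mult_2 del: power_Suc)
  finally have "?q * ?n + ?q * ?h = 2 * (?q ^ r * ?q ^ r)" .
  moreover have "?q * ?h + ?q ^ r = ?q ^ r * ?q ^ r"
    using quad_count_hyperbolic[OF c(1), of r] c(2) by (simp add: power_add[symmetric] mult_2)
  ultimately show ?thesis by (simp add: add_mult_distrib2)
qed

lemma card_zeros_affine:
  assumes T: "T \<in> carrier k" "T \<noteq> \<zero>"
  shows "card {y \<in> carrier k. T \<ominus> T \<otimes> (y \<otimes> y) = \<zero>} = 2"
proof -
  have "T \<ominus> T \<otimes> (y \<otimes> y) = \<zero> \<longleftrightarrow> y \<otimes> y = \<one>" if y: "y \<in> carrier k" for y
  proof -
    have "T \<ominus> T \<otimes> (y \<otimes> y) = T \<otimes> (\<one> \<ominus> y \<otimes> y)"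
      using T y by (simp add: a_minus_def r_distr r_minus)
    then have "T \<ominus> T \<otimes> (y \<otimes> y) = \<zero> \<longleftrightarrow> \<one> \<ominus> y \<otimes> y = \<zero>" using T y integral_iff by simp
    then show ?thesis using y r_right_minus_eq[of \<one> "y \<otimes> y"] by auto
  qed
  then have "{y \<in> carrier k. T \<ominus> T \<otimes> (y \<otimes> y) = \<zero>} = {y \<in> carrier k. y \<otimes> y = \<one>}" by blast
  then show ?thesis using card_roots_of_one by simp
qed

text \<open>
  After fixing the last coordinate \<open>y\<close>, the hyperbolic part has to take the value \<open>T (1 - y\<^sup>2)\<close>, which is
  zero for exactly two \<open>y\<close>.
\<close>

lemma quad_count_odd_split:
  assumes T: "T \<in> carrier k" "T \<noteq> \<zero>"
  shows "quad_count k ((alternating k)(2 * r := T)) (Suc (2 * r)) T = order_k ^ r * (order_k ^ r + 1)"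
proof -
  let ?q = order_k and ?K = "carrier k" and ?h = "quad_count k (alternating k) (2 * r)"
  let ?z = "\<lambda>y. T \<ominus> T \<otimes> (y \<otimes> y)"
  have "quad_count k ((alternating k)(2 * r := T)) (2 * r) d = ?h d" for d
    by (rule quad_count_cong) auto
  then have N: "quad_count k ((alternating k)(2 * r := T)) (Suc (2 * r)) T = (\<Sum>y\<in>?K. ?h (?z y))" by simp
  have "?q * (\<Sum>y\<in>?K. ?h (?z y)) + ?q * ?q ^ r = (\<Sum>y\<in>?K. ?q * ?h (?z y) + ?q ^ r)"
    by (simp add: sum.distrib sum_distrib_left)
  also have "\<dots> = (\<Sum>y\<in>?K. ?q ^ (2 * r) + (if ?z y = \<zero> then ?q ^ Suc r else 0))"
    by (rule sum.cong[OF refl], rule quad_count_hyperbolic) (use T in auto)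
  also have "\<dots> = ?q * ?q ^ (2 * r) + (\<Sum>y\<in>{y \<in> ?K. ?z y = \<zero>}. ?q ^ Suc r)"
    unfolding sum.inter_filter[OF fin] by (simp add: sum.distrib)
  also have "(\<Sum>y\<in>{y \<in> ?K. ?z y = \<zero>}. ?q ^ Suc r) = 2 * ?q ^ Suc r"
    using card_zeros_affine[OF T] by simp
  finally have "?q * ((\<Sum>y\<in>?K. ?h (?z y)) + ?q ^ r) = ?q * (?q ^ (2 * r) + 2 * ?q ^ r)"
    by (simp add: algebra_simps)
  then have "(\<Sum>y\<in>?K. ?h (?z y)) + ?q ^ r = ?q ^ (2 * r) + 2 * ?q ^ r"
    unfolding nat_mult_eq_cancel1[OF order_k_pos] .
  then have "(\<Sum>y\<in>?K. ?h (?z y)) = ?q ^ (2 * r) + ?q ^ r" by linarith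
  also have "?q ^ (2 * r) = ?q ^ r * ?q ^ r" by (simp only: mult_2 power_add)
  finally show ?thesis unfolding N by simp
qed

lemma quad_count_odd_nonsplit:
  assumes T: "T \<in> carrier k" "T \<noteq> \<zero>"
    and del: "\<delta> \<in> carrier k" "\<And>x. x \<in> carrier k \<Longrightarrow> \<delta> \<noteq> x \<otimes> x" and r: "1 \<le> r"
  shows "quad_count k ((alternating k)(2 * r - 1 := \<ominus> \<delta>, 2 * r := T)) (Suc (2 * r)) T
       = order_k ^ r * (order_k ^ r - 1)"
proof -
  let ?q = order_k and ?K = "carrier k" and ?h = "quad_count k (alternating k) (2 * r)"
  let ?a = "(alternating k)(2 * r - 1 := \<ominus> \<delta>)"
  let ?z = "\<lambda>y. T \<ominus> T \<otimes> (y \<otimes> y)"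
  have "quad_count k (?a(2 * r := T)) (2 * r) d = quad_count k ?a (2 * r) d" for d
    by (rule quad_count_cong) auto
  then have N: "quad_count k (?a(2 * r := T)) (Suc (2 * r)) T = (\<Sum>y\<in>?K. quad_count k ?a (2 * r) (?z y))" by simp
  have "quad_count k ((alternating k)(2 * r := T)) (2 * r) d = ?h d" for d
    by (rule quad_count_cong) auto
  then have M: "quad_count k ((alternating k)(2 * r := T)) (Suc (2 * r)) T = (\<Sum>y\<in>?K. ?h (?z y))" by simp
  have "(\<Sum>y\<in>?K. quad_count k ?a (2 * r) (?z y)) + (\<Sum>y\<in>?K. ?h (?z y))
      = (\<Sum>y\<in>?K. quad_count k ?a (2 * r) (?z y) + ?h (?z y))" by (rule sum.distrib[symmetric])
  also have "\<dots> = (\<Sum>y\<in>?K. 2 * ?q ^ (2 * r - 1))"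
    by (rule sum.cong[OF refl], rule quad_count_nonsquare_last[OF _ del r]) (use T in auto)
  also have "\<dots> = 2 * (?q * ?q ^ (2 * r - 1))" by simp
  also have "?q * ?q ^ (2 * r - 1) = ?q ^ r * ?q ^ r"
    using r by (simp add: power_Suc[symmetric] power_add[symmetric] mult_2 del: power_Suc)
  finally show ?thesis
    using quad_count_odd_split[OF T, of r, unfolded M]
    unfolding N diff_mult_distrib2 add_mult_distrib2 mult_1_right by linarith
qed

end

section \<open>Finite local rings with an involution that is trivial on the residue field\<close>

text \<open>
  The properties of \<open>B\<close> on which the count rests: \<open>cj\<close> is the involution, and modulo the maximal
  ideal \<open>\<mm>\<close> it is trivial and \<open>2\<close> is invertible.
\<close>

locale local_involution_ring = cring B for B (structure) +
  fixes cj :: "'a \<Rightarrow> 'a" and \<mm> :: "'a set"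
  assumes fin_carrier: "finite (carrier B)"
    and maximal: "maximalideal \<mm> B"
    and unit_if_not_mem: "\<lbrakk>x \<in> carrier B; x \<notin> \<mm>\<rbrakk> \<Longrightarrow> x \<in> Units B"
    and cj_hom: "cj \<in> ring_hom B B"
    and cj_cj: "x \<in> carrier B \<Longrightarrow> cj (cj x) = x"
    and cj_cong: "x \<in> carrier B \<Longrightarrow> cj x \<ominus> x \<in> \<mm>"
    and two_not_mem: "\<one> \<oplus> \<one> \<notin> \<mm>"
begin

sublocale mm: maximalideal \<mm> B by (rule maximal)

abbreviation k where "k \<equiv> B Quot \<mm>"
abbreviation pr :: "'a \<Rightarrow> 'a set" where "pr x \<equiv> \<mm> +> x"

lemma cj_closed [simp]: "x \<in> carrier B \<Longrightarrow> cj x \<in> carrier B"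
  using ring_hom_closed[OF cj_hom] .
lemma cj_add [simp]: "\<lbrakk>x \<in> carrier B; y \<in> carrier B\<rbrakk> \<Longrightarrow> cj (x \<oplus> y) = cj x \<oplus> cj y"
  using ring_hom_add[OF cj_hom] .
lemma cj_mult [simp]: "\<lbrakk>x \<in> carrier B; y \<in> carrier B\<rbrakk> \<Longrightarrow> cj (x \<otimes> y) = cj x \<otimes> cj y"
  using ring_hom_mult[OF cj_hom] .
lemma cj_one [simp]: "cj \<one> = \<one>"
  using ring_hom_one[OF cj_hom] .

lemma cj_ring_hom_cring: "ring_hom_cring B B cj"
  by (unfold_locales) (rule cj_hom)

lemma cj_zero [simp]: "cj \<zero> = \<zero>"
  using ring_hom_cring.hom_zero[OF cj_ring_hom_cring] .
lemma cj_neg [simp]: "x \<in> carrier B \<Longrightarrow> cj (\<ominus> x) = \<ominus> cj x"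
  using ring_hom_cring.hom_a_inv[OF cj_ring_hom_cring] .
lemma cj_minus [simp]: "\<lbrakk>x \<in> carrier B; y \<in> carrier B\<rbrakk> \<Longrightarrow> cj (x \<ominus> y) = cj x \<ominus> cj y"
  by (simp add: a_minus_def)
lemma cj_inverse:
  assumes x: "x \<in> Units B"
  shows "cj x \<otimes> cj (inv x) = \<one>"
proof -
  have "cj x \<otimes> cj (inv x) = cj (x \<otimes> inv x)" using x by (simp add: Units_closed del: Units_r_inv)
  then show ?thesis using x by simp
qed

lemma cj_inv: "x \<in> Units B \<Longrightarrow> cj (inv x) = inv (cj x)"
  by (rule sym, rule comm_inv_char[OF _ _ cj_inverse]) (simp_all add: Units_closed)

lemma cj_Units: "x \<in> Units B \<Longrightarrow> cj x \<in> Units B"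
  by (rule unit_factor[of _ "cj (inv x)"]) (simp_all add: Units_closed cj_inverse)

lemma unit_not_mem: "x \<in> Units B \<Longrightarrow> x \<notin> \<mm>"
proof
  assume x: "x \<in> Units B" "x \<in> \<mm>"
  then have "inv x \<otimes> x \<in> \<mm>" by (intro mm.I_l_closed) auto
  then show False using x mm.one_imp_carrier mm.I_notcarr by simp
qed

lemma unit_iff: "x \<in> carrier B \<Longrightarrow> x \<in> Units B \<longleftrightarrow> x \<notin> \<mm>"
  using unit_if_not_mem unit_not_mem by blast

lemma pr_eq_iff: "\<lbrakk>x \<in> carrier B; y \<in> carrier B\<rbrakk> \<Longrightarrow> pr x = pr y \<longleftrightarrow> x \<ominus> y \<in> \<mm>"
  using quotient_eq_iff_same_a_r_cos[OF mm.is_ideal] by blast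

lemma pr_hom_cring: "ring_hom_cring B k pr" by (rule mm.rcos_ring_hom_cring) (rule is_cring)

lemma carrier_k: "carrier k = pr ` carrier B"
  by (auto simp: FactRing_def A_RCOSETS_def')

lemma carrier_k': "carrier k = a_rcosets \<mm>" by (simp add: FactRing_def)

lemma zero_k: "\<zero>\<^bsub>k\<^esub> = \<mm>" by (simp add: FactRing_def)

lemma pr_zero_iff: "x \<in> carrier B \<Longrightarrow> pr x = \<zero>\<^bsub>k\<^esub> \<longleftrightarrow> x \<in> \<mm>"
  using a_rcos_zero[OF mm.is_ideal, of x] mm.a_rcos_self[of x] unfolding zero_k by blast

lemma field_k: "field k" by (rule mm.quotient_is_field) (rule is_cring)

lemma odd_finite_field_k: "odd_finite_field k"
proof -
  interpret k: field k by (rule field_k)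
  interpret pr: ring_hom_cring B k pr by (rule pr_hom_cring)
  show ?thesis
  proof
    show "finite (carrier k)" unfolding carrier_k using fin_carrier by simp
    have "pr (\<one> \<oplus> \<one>) = \<one>\<^bsub>k\<^esub> \<oplus>\<^bsub>k\<^esub> \<one>\<^bsub>k\<^esub>" by simp
    then show "\<one>\<^bsub>k\<^esub> \<oplus>\<^bsub>k\<^esub> \<one>\<^bsub>k\<^esub> \<noteq> \<zero>\<^bsub>k\<^esub>" using pr_zero_iff[of "\<one> \<oplus> \<one>"] two_not_mem by auto
  qed
qed

sublocale k: odd_finite_field k by (rule odd_finite_field_k)
sublocale pr: ring_hom_cring B k pr by (rule pr_hom_cring)

lemma pr_cj: "x \<in> carrier B \<Longrightarrow> pr (cj x) = pr x"
  using pr_eq_iff[of "cj x" x] cj_cong by simp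

lemma card_pr_fibre:
  assumes "C \<in> carrier k"
  shows "card {x \<in> carrier B. pr x = C} = card \<mm>"
proof -
  have C: "C \<in> a_rcosets \<mm>" using assms unfolding carrier_k' .
  obtain y where y: "y \<in> carrier B" "C = pr y" using assms carrier_k by auto
  have "{x \<in> carrier B. pr x = C} = C"
    using y mm.a_rcos_self mm.a_repr_independence' mm.a_elemrcos_carrier by blast
  then show ?thesis using a_card_cosets_equal[OF C mm.a_subset fin_carrier] by simp
qed

lemma card_carrier: "card (carrier B) = card (carrier k) * card \<mm>"
  using a_lagrange[OF fin_carrier mm.is_additive_subgroup]
  unfolding carrier_k' order_def by simp

text \<open>
  Squaring preserves the set of fixed elements congruent to \<open>1\<close>.  It is injective there, because
  \<open>x\<^sup>2 = y\<^sup>2\<close> means \<open>(x + y) (x - y) = 0\<close> and \<open>x + y\<close> is congruent to the unit \<open>2\<close>; since the set is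
  finite, every element of it is a square.
\<close>

lemma principal_unit_sqrt:
  assumes z: "z \<in> \<mm>" "cj z = z"
  obtains w where "w \<in> Units B" "cj w = w" "w \<otimes> w = \<one> \<oplus> z"
proof -
  define E where "E = {x \<in> carrier B. cj x = x \<and> x \<ominus> \<one> \<in> \<mm>}"
  have pr1: "x \<ominus> \<one> \<in> \<mm> \<longleftrightarrow> pr x = \<one>\<^bsub>k\<^esub>" if "x \<in> carrier B" for x
    using pr_eq_iff[of x \<one>] that by simp
  have mem_E: "x \<in> E \<longleftrightarrow> x \<in> carrier B \<and> cj x = x \<and> pr x = \<one>\<^bsub>k\<^esub>" for x
    unfolding E_def using pr1 by blast
  have sq: "x \<otimes> x \<in> E" if "x \<in> E" for x
    using that by (auto simp: mem_E)
  have inj: "inj_on (\<lambda>x. x \<otimes> x) E"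
  proof
    fix x y assume x: "x \<in> E" and y: "y \<in> E" and e: "x \<otimes> x = y \<otimes> y"
    have xy: "x \<in> carrier B" "y \<in> carrier B" using x y by (auto simp: mem_E)
    have "(x \<oplus> y) \<otimes> (x \<ominus> y) = x \<otimes> x \<ominus> y \<otimes> y" using xy by algebra
    then have 0: "(x \<oplus> y) \<otimes> (x \<ominus> y) = \<zero>" using e xy by simp
    have "pr (x \<oplus> y) = pr (\<one> \<oplus> \<one>)" using x y by (simp add: mem_E)
    then have "x \<oplus> y \<notin> \<mm>" using pr_zero_iff[of "x \<oplus> y"] pr_zero_iff[of "\<one> \<oplus> \<one>"] two_not_mem xy by auto
    then have u: "x \<oplus> y \<in> Units B" using unit_iff xy by blast
    then have "x \<ominus> y = inv (x \<oplus> y) \<otimes> ((x \<oplus> y) \<otimes> (x \<ominus> y))"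
      using xy by (simp add: m_assoc[symmetric])
    then have "x \<ominus> y = \<zero>" using 0 u by simp
    then show "x = y" using xy by simp
  qed
  have "finite E" unfolding E_def using fin_carrier by simp
  then have "(\<lambda>x. x \<otimes> x) ` E = E" using sq inj by (intro endo_inj_surj) auto
  moreover have "\<one> \<oplus> z \<in> E"
    using z mm.Icarr[OF z(1)] pr_zero_iff[of z] by (simp add: mem_E)
  ultimately have "\<one> \<oplus> z \<in> (\<lambda>x. x \<otimes> x) ` E" by simp
  then obtain w where w: "w \<in> E" "w \<otimes> w = \<one> \<oplus> z" by (metis (no_types, lifting) imageE)
  then have "w \<in> Units B"
    using unit_iff[of w] pr_zero_iff[of w] by (auto simp: mem_E)
  with w show ?thesis using that by (auto simp: mem_E)
qed

text \<open>
  The mean of \<open>x\<close> and its conjugate is fixed and has the same residue as \<open>x\<close>.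
\<close>

lemma fixed_representative:
  assumes x: "x \<in> carrier B"
  obtains y where "y \<in> carrier B" "cj y = y" "pr y = pr x"
proof -
  have u: "\<one> \<oplus> \<one> \<in> Units B" using unit_iff two_not_mem by simp
  define y where "y = inv (\<one> \<oplus> \<one>) \<otimes> (x \<oplus> cj x)"
  have c: "cj y = y" using u x by (simp add: y_def cj_inv cj_cj a_comm)
  have "pr y = pr (inv (\<one> \<oplus> \<one>)) \<otimes>\<^bsub>k\<^esub> (pr x \<oplus>\<^bsub>k\<^esub> pr x)"
    using u x by (simp add: y_def pr_cj)
  also have "\<dots> = pr (inv (\<one> \<oplus> \<one>) \<otimes> (x \<oplus> x))" using u x by simp
  also have "inv (\<one> \<oplus> \<one>) \<otimes> (x \<oplus> x) = inv (\<one> \<oplus> \<one>) \<otimes> ((\<one> \<oplus> \<one>) \<otimes> x)"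
    using x by (simp add: l_distr)
  also have "\<dots> = x" using u x by (subst m_assoc[symmetric]) simp_all
  finally show ?thesis using that[of y] c u x by (simp add: y_def)
qed

text \<open>
  A square root of the residue of \<open>\<epsilon>\<close> lifts to a fixed unit, and a fixed square root of the remaining
  factor congruent to \<open>1\<close> turns that lift into a square root of \<open>\<epsilon>\<close> itself.
\<close>

lemma nonsquare_mod:
  assumes e: "\<epsilon> \<in> Units B" "cj \<epsilon> = \<epsilon>"
    and ns: "\<And>x. x \<in> Units B \<Longrightarrow> cj x = x \<Longrightarrow> \<epsilon> \<noteq> x \<otimes> x"
    and c: "c \<in> carrier k"
  shows "pr \<epsilon> \<noteq> c \<otimes>\<^bsub>k\<^esub> c"
proof
  assume eq: "pr \<epsilon> = c \<otimes>\<^bsub>k\<^esub> c"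
  obtain x where x: "x \<in> carrier B" "c = pr x" using c carrier_k by auto
  obtain y where y: "y \<in> carrier B" "cj y = y" "pr y = pr x" using fixed_representative[OF x(1)] .
  have prey: "pr \<epsilon> = pr (y \<otimes> y)" using eq x y by simp
  have "pr \<epsilon> \<noteq> \<zero>\<^bsub>k\<^esub>" using e unit_not_mem pr_zero_iff by blast
  then have "pr y \<noteq> \<zero>\<^bsub>k\<^esub>" using prey y by auto
  then have yU: "y \<in> Units B" using unit_iff y pr_zero_iff by blast
  have yyU: "y \<otimes> y \<in> Units B" using yU by simp
  \<comment> \<open>so that \<open>\<epsilon> = y\<^sup>2 (1 + z)\<close>\<close>
  define z where "z = inv (y \<otimes> y) \<otimes> (\<epsilon> \<ominus> y \<otimes> y)"
  have "\<epsilon> \<ominus> y \<otimes> y \<in> \<mm>" using iffD1[OF pr_eq_iff[OF Units_closed[OF e(1)], of "y \<otimes> y"] prey] y by simp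
  then have zm: "z \<in> \<mm>" unfolding z_def using yyU by (intro mm.I_l_closed) auto
  have cz: "cj z = z" using yyU e y unfolding z_def by (simp add: cj_inv Units_closed)
  obtain w where w: "w \<in> Units B" "cj w = w" "w \<otimes> w = \<one> \<oplus> z" using principal_unit_sqrt[OF zm cz] .
  have "(y \<otimes> w) \<otimes> (y \<otimes> w) = (y \<otimes> y) \<otimes> (w \<otimes> w)" using y w(1) by (simp add: m_ac Units_closed)
  also have "\<dots> = (y \<otimes> y) \<otimes> \<one> \<oplus> (y \<otimes> y) \<otimes> z"
    unfolding w(3) using y zm mm.Icarr[OF zm] by (intro r_distr) auto
  also have "(y \<otimes> y) \<otimes> z = \<epsilon> \<ominus> y \<otimes> y"
    unfolding z_def using yyU e y by (simp add: m_assoc[of "y \<otimes> y", symmetric] Units_closed)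
  also have "(y \<otimes> y) \<otimes> \<one> \<oplus> (\<epsilon> \<ominus> y \<otimes> y) = \<epsilon>"
    using y e Units_closed[OF e(1)] by (simp add: a_minus_def a_lcomm r_neg)
  finally show False using ns[of "y \<otimes> w"] yU w y by (simp add: Units_closed)
qed

end

section \<open>Unitary groups and transitivity on vectors of a given unit norm\<close>

locale finite_hermitian_module =
  R?: local_involution_ring B cj \<mm> + module B W
  for B :: "('a, 'c) ring_scheme" (structure) and cj and \<mm> and W :: "('a, 'v, 'd) module_scheme" (structure) +
  fixes h :: "'v \<Rightarrow> 'v \<Rightarrow> 'a"
  assumes herm: "hermitian_form B cj W h" and fin_W: "finite (carrier W)"
begin

lemma h_closed [simp]: "\<lbrakk>v \<in> carrier W; w \<in> carrier W\<rbrakk> \<Longrightarrow> h v w \<in> carrier B"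
  using herm unfolding hermitian_form_def by blast
lemma h_add_l: "\<lbrakk>u \<in> carrier W; v \<in> carrier W; w \<in> carrier W\<rbrakk> \<Longrightarrow> h (u \<oplus>\<^bsub>W\<^esub> v) w = h u w \<oplus> h v w"
  using herm unfolding hermitian_form_def by blast
lemma h_add_r: "\<lbrakk>u \<in> carrier W; v \<in> carrier W; w \<in> carrier W\<rbrakk> \<Longrightarrow> h w (u \<oplus>\<^bsub>W\<^esub> v) = h w u \<oplus> h w v"
  using herm unfolding hermitian_form_def by blast
lemma h_smult_r: "\<lbrakk>v \<in> carrier W; w \<in> carrier W; a \<in> carrier B\<rbrakk> \<Longrightarrow> h v (a \<odot>\<^bsub>W\<^esub> w) = h v w \<otimes> a"
  using herm unfolding hermitian_form_def by blast
lemma h_conj: "\<lbrakk>v \<in> carrier W; w \<in> carrier W\<rbrakk> \<Longrightarrow> h w v = cj (h v w)"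
  using herm unfolding hermitian_form_def by blast
lemma cj_h: "\<lbrakk>v \<in> carrier W; w \<in> carrier W\<rbrakk> \<Longrightarrow> cj (h v w) = h w v"
  by (rule h_conj[symmetric])
lemma h_smult_l:
  assumes "v \<in> carrier W" "w \<in> carrier W" "a \<in> carrier B"
  shows "h (a \<odot>\<^bsub>W\<^esub> v) w = cj a \<otimes> h v w"
proof -
  have "h (a \<odot>\<^bsub>W\<^esub> v) w = cj (h w (a \<odot>\<^bsub>W\<^esub> v))" using assms by (intro h_conj) auto
  also have "\<dots> = cj (h w v) \<otimes> cj a" using assms by (simp add: h_smult_r)
  finally show ?thesis using assms by (simp add: cj_h m_comm)
qed

lemma neg_smult: "v \<in> carrier W \<Longrightarrow> \<ominus>\<^bsub>W\<^esub> v = (\<ominus> \<one>) \<odot>\<^bsub>W\<^esub> v"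
  by (simp add: smult_l_minus)

lemma h_neg_r: "\<lbrakk>v \<in> carrier W; w \<in> carrier W\<rbrakk> \<Longrightarrow> h v (\<ominus>\<^bsub>W\<^esub> w) = \<ominus> h v w"
  by (simp add: neg_smult h_smult_r r_minus)
lemma h_neg_l: "\<lbrakk>v \<in> carrier W; w \<in> carrier W\<rbrakk> \<Longrightarrow> h (\<ominus>\<^bsub>W\<^esub> v) w = \<ominus> h v w"
  by (simp add: neg_smult h_smult_l l_minus)
lemma h_zero_r: "v \<in> carrier W \<Longrightarrow> h v \<zero>\<^bsub>W\<^esub> = \<zero>"
  using h_smult_r[of v "\<zero>\<^bsub>W\<^esub>" \<zero>] by simp
abbreviation U where "U \<equiv> unitary_group B W h"

lemma carrier_U: "carrier U = {g \<in> Bij (carrier W).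
    (\<forall>v \<in> carrier W. \<forall>w \<in> carrier W. g (v \<oplus>\<^bsub>W\<^esub> w) = g v \<oplus>\<^bsub>W\<^esub> g w) \<and>
    (\<forall>a \<in> carrier B. \<forall>v \<in> carrier W. g (a \<odot>\<^bsub>W\<^esub> v) = a \<odot>\<^bsub>W\<^esub> g v) \<and>
    (\<forall>v \<in> carrier W. \<forall>w \<in> carrier W. h (g v) (g w) = h v w)}"
  by (simp add: unitary_group_def)

text \<open>
  On a finite module surjectivity is enough for bijectivity.
\<close>

lemma U_memI:
  assumes "g \<in> extensional (carrier W)" "\<And>v. v \<in> carrier W \<Longrightarrow> g v \<in> carrier W"
    "\<And>v. v \<in> carrier W \<Longrightarrow> \<exists>w\<in>carrier W. g w = v"
    "\<And>v w. \<lbrakk>v \<in> carrier W; w \<in> carrier W\<rbrakk> \<Longrightarrow> g (v \<oplus>\<^bsub>W\<^esub> w) = g v \<oplus>\<^bsub>W\<^esub> g w"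
    "\<And>a v. \<lbrakk>a \<in> carrier B; v \<in> carrier W\<rbrakk> \<Longrightarrow> g (a \<odot>\<^bsub>W\<^esub> v) = a \<odot>\<^bsub>W\<^esub> g v"
    "\<And>v w. \<lbrakk>v \<in> carrier W; w \<in> carrier W\<rbrakk> \<Longrightarrow> h (g v) (g w) = h v w"
  shows "g \<in> carrier U"
proof -
  have "g ` carrier W = carrier W" using assms(2,3) by blast
  then have "bij_betw g (carrier W) (carrier W)"
    using fin_W by (simp add: bij_betw_def eq_card_imp_inj_on)
  then show ?thesis using assms(1,4-6) by (simp add: carrier_U Bij_def)
qed

lemma U_apply:
  assumes "g \<in> carrier U" "v \<in> carrier W"
  shows "g v \<in> carrier W"
  using assms Bij_imp_funcset[of g "carrier W"] by (auto simp: carrier_U)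

lemma group_action_U: "group_action U (carrier W) (\<lambda>g. g)"
proof -
  interpret BG: group "BijGroup (carrier W)" by (rule group_BijGroup)
  have sub: "subgroup (carrier U) (BijGroup (carrier W))"
  proof (rule BG.subgroupI)
    show "carrier U \<subseteq> carrier (BijGroup (carrier W))"
      unfolding carrier_U BijGroup_def by auto
    have "(\<lambda>x\<in>carrier W. x) \<in> carrier U" by (rule U_memI) auto
    then show "carrier U \<noteq> {}" by blast
  next
    fix g assume g: "g \<in> carrier U"
    then have gB: "g \<in> Bij (carrier W)" by (simp add: carrier_U)
    then have inv: "inv\<^bsub>BijGroup (carrier W)\<^esub> g = (\<lambda>x\<in>carrier W. inv_into (carrier W) g x)"
      by (rule inv_BijGroup)
    have bij: "inj_on g (carrier W)" "g ` carrier W = carrier W"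
      using gB by (auto simp: Bij_def bij_betw_def)
    let ?i = "inv_into (carrier W) g"
    have i: "?i v \<in> carrier W" "g (?i v) = v" if "v \<in> carrier W" for v
      using that bij by (auto simp: inv_into_into f_inv_into_f)
    have ig: "?i (g v) = v" if "v \<in> carrier W" for v
      using that bij by simp
    have eqI: "v = w" if "v \<in> carrier W" "w \<in> carrier W" "g v = g w" for v w
      using that bij by (auto dest: inj_onD)
    show "inv\<^bsub>BijGroup (carrier W)\<^esub> g \<in> carrier U"
      unfolding inv
    proof (rule U_memI)
      fix v w assume v: "v \<in> carrier W" and w: "w \<in> carrier W"
      have "?i (v \<oplus>\<^bsub>W\<^esub> w) = ?i v \<oplus>\<^bsub>W\<^esub> ?i w"
        by (rule eqI) (use v w i g in \<open>auto simp: carrier_U\<close>)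
      then show "restrict ?i (carrier W) (v \<oplus>\<^bsub>W\<^esub> w)
          = restrict ?i (carrier W) v \<oplus>\<^bsub>W\<^esub> restrict ?i (carrier W) w" using v w by simp
      have "h (g (?i v)) (g (?i w)) = h (?i v) (?i w)"
        using g i(1)[OF v] i(1)[OF w] unfolding carrier_U by blast
      then show "h (restrict ?i (carrier W) v) (restrict ?i (carrier W) w) = h v w"
        unfolding i(2)[OF v] i(2)[OF w] using v w by simp
    next
      fix a v assume v: "v \<in> carrier W" and a: "a \<in> carrier B"
      have "?i (a \<odot>\<^bsub>W\<^esub> v) = a \<odot>\<^bsub>W\<^esub> ?i v"
        by (rule eqI) (use v a i g in \<open>auto simp: carrier_U\<close>)
      then show "restrict ?i (carrier W) (a \<odot>\<^bsub>W\<^esub> v) = a \<odot>\<^bsub>W\<^esub> restrict ?i (carrier W) v"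
        using v a by simp
    next
      fix v assume v: "v \<in> carrier W"
      then show "\<exists>w\<in>carrier W. restrict ?i (carrier W) w = v"
        using ig U_apply[OF g] by (intro bexI[of _ "g v"]) auto
    qed (use i in auto)
  next
    fix g g' assume g: "g \<in> carrier U" "g' \<in> carrier U"
    then have "g \<otimes>\<^bsub>BijGroup (carrier W)\<^esub> g' = compose (carrier W) g g'"
      by (simp add: BijGroup_def carrier_U)
    moreover have "compose (carrier W) g g' \<in> carrier U"
      using g U_apply[OF g(2)] unfolding carrier_U by (simp add: compose_Bij compose_eq)
    ultimately show "g \<otimes>\<^bsub>BijGroup (carrier W)\<^esub> g' \<in> carrier U" by simp
  qed
  have U_eq: "U = (BijGroup (carrier W))\<lparr>carrier := carrier U\<rparr>"
    by (simp add: unitary_group_def)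
  have gU: "group U"
    by (subst U_eq) (rule subgroup.subgroup_is_group[OF sub BG.group_axioms])
  interpret GU: group U by (rule gU)
  show ?thesis
  proof (unfold_locales, unfold hom_def, safe)
    fix g assume "g \<in> carrier U"
    then show "g \<in> carrier (BijGroup (carrier W))" using sub subgroup.mem_carrier by fastforce
  next
    fix g g' assume "g \<in> carrier U" "g' \<in> carrier U"
    then show "g \<otimes>\<^bsub>U\<^esub> g' = g \<otimes>\<^bsub>BijGroup (carrier W)\<^esub> g'"
      by (simp add: unitary_group_def)
  qed
qed

lemma group_index_stabilizer:
  assumes "u \<in> carrier W"
  shows "group_index U (stabilizer U (\<lambda>g. g) u) = card {g u | g. g \<in> carrier U}"
proof -
  have "orbit U (\<lambda>g. g) u = {g u | g. g \<in> carrier U}" by (simp only: orbit_def)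
  then show ?thesis
    using bij_betw_same_card[OF group_action.orbit_stab_fun_is_bij[OF group_action_U assms]]
    by (simp only: group_index_def)
qed

lemma U_neg:
  assumes g: "g \<in> carrier U"
  shows "(\<lambda>v\<in>carrier W. \<ominus>\<^bsub>W\<^esub> g v) \<in> carrier U"
proof (rule U_memI)
  fix v assume v: "v \<in> carrier W"
  have "\<ominus>\<^bsub>W\<^esub> v \<in> g ` carrier W" using g v by (auto simp: carrier_U Bij_def bij_betw_def)
  then obtain w where "w \<in> carrier W" "g w = \<ominus>\<^bsub>W\<^esub> v" by force
  then show "\<exists>w\<in>carrier W. (\<lambda>v\<in>carrier W. \<ominus>\<^bsub>W\<^esub> g v) w = v"
    using v by (intro bexI[of _ w]) auto
next
  fix v w assume "v \<in> carrier W" "w \<in> carrier W"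
  then show "(\<lambda>v\<in>carrier W. \<ominus>\<^bsub>W\<^esub> g v) (v \<oplus>\<^bsub>W\<^esub> w)
      = (\<lambda>v\<in>carrier W. \<ominus>\<^bsub>W\<^esub> g v) v \<oplus>\<^bsub>W\<^esub> (\<lambda>v\<in>carrier W. \<ominus>\<^bsub>W\<^esub> g v) w"
    "h ((\<lambda>v\<in>carrier W. \<ominus>\<^bsub>W\<^esub> g v) v) ((\<lambda>v\<in>carrier W. \<ominus>\<^bsub>W\<^esub> g v) w) = h v w"
    using g U_apply[OF g] by (auto simp: carrier_U M.minus_add h_neg_l h_neg_r)
next
  fix a v assume "a \<in> carrier B" "v \<in> carrier W"
  then show "(\<lambda>v\<in>carrier W. \<ominus>\<^bsub>W\<^esub> g v) (a \<odot>\<^bsub>W\<^esub> v) = a \<odot>\<^bsub>W\<^esub> (\<lambda>v\<in>carrier W. \<ominus>\<^bsub>W\<^esub> g v) v"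
    using g U_apply[OF g] by (auto simp: carrier_U smult_r_minus)
qed (use U_apply[OF g] in auto)

text \<open>
  The reflection along \<open>w\<close> is the case \<open>s = h w w / 2\<close>.  Any \<open>s\<close> with \<open>s + s\<^sup>* = h w w\<close> also gives a
  unitary map, and this freedom is used to prescribe the image of one vector.
\<close>

definition quasi_reflection :: "'v \<Rightarrow> 'a \<Rightarrow> 'v \<Rightarrow> 'v" where
  "quasi_reflection w s = (\<lambda>x\<in>carrier W. x \<oplus>\<^bsub>W\<^esub> (\<ominus> (inv s \<otimes> h w x)) \<odot>\<^bsub>W\<^esub> w)"

text \<open>
  The inverse has the conjugate parameter: the term of second order in \<open>w\<close> contains
  \<open>s\<^sup>-\<^sup>1 h(w, w) s\<^sup>*\<^sup>-\<^sup>1\<close>, which is \<open>s\<^sup>-\<^sup>1 + s\<^sup>*\<^sup>-\<^sup>1\<close> and cancels the two terms of first order.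
\<close>

lemma quasi_reflection_inverse:
  assumes w: "w \<in> carrier W" and s: "s \<in> Units B" and ww: "h w w = s \<oplus> cj s"
    and x: "x \<in> carrier W"
  shows "quasi_reflection w s (quasi_reflection w (cj s) x) = x"
proof -
  define S S' where "S = inv s" and "S' = inv (cj s)"
  note sc = Units_closed[OF s] and s'c = Units_closed[OF cj_Units[OF s]]
  have S: "S \<in> carrier B" "S \<otimes> s = \<one>" "S' \<in> carrier B" "S' \<otimes> cj s = \<one>"
    using s cj_Units[OF s] by (auto simp: S_def S'_def)
  define p where "p = h w x"
  have p: "p \<in> carrier B" using w x by (simp add: p_def)
  define a where "a = \<ominus> (S' \<otimes> p)"
  have a: "a \<in> carrier B" using S p by (simp add: a_def)
  have 1: "quasi_reflection w (cj s) x = x \<oplus>\<^bsub>W\<^esub> a \<odot>\<^bsub>W\<^esub> w"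
    using x by (simp add: quasi_reflection_def a_def S'_def p_def)
  have "S \<otimes> (p \<oplus> (s \<oplus> cj s) \<otimes> a)
      = S \<otimes> p \<oplus> (S \<otimes> s) \<otimes> a \<ominus> S \<otimes> ((S' \<otimes> cj s) \<otimes> p)"
    unfolding a_def using S(1,3) p sc s'c by algebra
  also have "\<dots> = a" unfolding S(2,4) using S(1,3) p a by algebra
  finally have 2: "S \<otimes> (p \<oplus> (s \<oplus> cj s) \<otimes> a) = a" .
  have "h w (x \<oplus>\<^bsub>W\<^esub> a \<odot>\<^bsub>W\<^esub> w) = p \<oplus> (s \<oplus> cj s) \<otimes> a"
    using w x a by (simp add: h_add_r h_smult_r p_def ww)
  then have "quasi_reflection w s (x \<oplus>\<^bsub>W\<^esub> a \<odot>\<^bsub>W\<^esub> w)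
      = (x \<oplus>\<^bsub>W\<^esub> a \<odot>\<^bsub>W\<^esub> w) \<oplus>\<^bsub>W\<^esub> (\<ominus> a) \<odot>\<^bsub>W\<^esub> w"
    using x w a 2 by (simp add: quasi_reflection_def S_def)
  also have "\<dots> = x" using x w a by (simp add: smult_l_minus M.a_assoc M.r_neg)
  finally show ?thesis unfolding 1 .
qed

lemma quasi_reflection_unitary:
  assumes w: "w \<in> carrier W" and s: "s \<in> Units B" and ww: "h w w = s \<oplus> cj s"
  shows "quasi_reflection w s \<in> carrier U"
proof (rule U_memI)
  note sc = Units_closed[OF s] and s'c = Units_closed[OF cj_Units[OF s]]
  show "quasi_reflection w s \<in> extensional (carrier W)" by (simp add: quasi_reflection_def)
  have closed: "quasi_reflection w z x \<in> carrier W" if "x \<in> carrier W" "z \<in> Units B" for x z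
    using that w by (simp add: quasi_reflection_def)
  then show "quasi_reflection w s x \<in> carrier W" if "x \<in> carrier W" for x
    using that s by simp
  show "\<exists>y\<in>carrier W. quasi_reflection w s y = x" if x: "x \<in> carrier W" for x
    using quasi_reflection_inverse[OF w s ww x] closed[OF x cj_Units[OF s]] by blast
next
  fix x y assume x: "x \<in> carrier W" and y: "y \<in> carrier W"
  define S S' where "S = inv s" and "S' = inv (cj s)"
  note sc = Units_closed[OF s] and s'c = Units_closed[OF cj_Units[OF s]]
  have S: "S \<in> carrier B" "S \<otimes> s = \<one>" "S' \<in> carrier B" "S' \<otimes> cj s = \<one>" "cj S = S'"
    using s cj_Units[OF s] by (auto simp: S_def S'_def cj_inv)
  define a b where "a = \<ominus> (S \<otimes> h w x)" and "b = \<ominus> (S \<otimes> h w y)"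
  have ab: "a \<in> carrier B" "b \<in> carrier B" using S w x y by (auto simp: a_def b_def)
  have q: "quasi_reflection w s x = x \<oplus>\<^bsub>W\<^esub> a \<odot>\<^bsub>W\<^esub> w"
      "quasi_reflection w s y = y \<oplus>\<^bsub>W\<^esub> b \<odot>\<^bsub>W\<^esub> w"
    using x y by (auto simp: quasi_reflection_def a_def b_def S_def)
  have "\<ominus> (S \<otimes> h w (x \<oplus>\<^bsub>W\<^esub> y)) = a \<oplus> b"
    unfolding a_def b_def using x y w S by (simp add: h_add_r r_distr R.minus_add)
  then have "quasi_reflection w s (x \<oplus>\<^bsub>W\<^esub> y) = (x \<oplus>\<^bsub>W\<^esub> y) \<oplus>\<^bsub>W\<^esub> (a \<oplus> b) \<odot>\<^bsub>W\<^esub> w"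
    using x y by (simp add: quasi_reflection_def S_def)
  then show "quasi_reflection w s (x \<oplus>\<^bsub>W\<^esub> y) = quasi_reflection w s x \<oplus>\<^bsub>W\<^esub> quasi_reflection w s y"
    unfolding q using x y w ab by (simp add: smult_l_distr M.a_ac)
  define p r where "p = h x w" and "r = h w y"
  have pr: "p \<in> carrier B" "r \<in> carrier B" using x y w by (auto simp: p_def r_def)
  have ca: "cj a = \<ominus> (S' \<otimes> p)" unfolding a_def using S x w by (simp add: cj_h p_def)
  have "h (x \<oplus>\<^bsub>W\<^esub> a \<odot>\<^bsub>W\<^esub> w) (y \<oplus>\<^bsub>W\<^esub> b \<odot>\<^bsub>W\<^esub> w)
      = h x y \<oplus> cj a \<otimes> r \<oplus> (p \<oplus> cj a \<otimes> (s \<oplus> cj s)) \<otimes> b"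
    using x y w ab by (simp add: h_add_l h_add_r h_smult_l h_smult_r p_def r_def ww)
  also have "\<dots> = (h x y \<ominus> p \<otimes> (S \<otimes> r)) \<ominus> S' \<otimes> p \<otimes> r
      \<oplus> (S' \<otimes> p \<otimes> r) \<otimes> (S \<otimes> s) \<oplus> (S' \<otimes> cj s) \<otimes> (p \<otimes> (S \<otimes> r))"
    unfolding ca b_def r_def[symmetric] using S(1,3) pr sc s'c h_closed[OF x y] by algebra
  also have "\<dots> = h x y"
    unfolding S(2,4) using S(1,3) pr h_closed[OF x y] by algebra
  finally show "h (quasi_reflection w s x) (quasi_reflection w s y) = h x y" unfolding q .
next
  fix a x assume a: "a \<in> carrier B" and x: "x \<in> carrier W"
  have "\<ominus> (inv s \<otimes> h w (a \<odot>\<^bsub>W\<^esub> x)) = a \<otimes> (\<ominus> (inv s \<otimes> h w x))"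
    using a x w s by (simp add: h_smult_r r_minus m_ac)
  then show "quasi_reflection w s (a \<odot>\<^bsub>W\<^esub> x) = a \<odot>\<^bsub>W\<^esub> quasi_reflection w s x"
    using a x w s by (simp add: quasi_reflection_def smult_r_distr smult_assoc1)
qed

text \<open>
  The quasi-reflection along \<open>w = u - v\<close> with parameter \<open>s = h w u\<close> moves \<open>u\<close> by exactly \<open>- w\<close>.  The
  equality of norms is what gives \<open>h w w = s + s\<^sup>*\<close>.
\<close>

lemma unitary_maps_if_unit:
  assumes u: "u \<in> carrier W" and v: "v \<in> carrier W" and eq: "h v v = h u u"
    and unit: "h u u \<ominus> h v u \<in> Units B"
  obtains g where "g \<in> carrier U" "g u = v"
proof -
  define w s where "w = u \<oplus>\<^bsub>W\<^esub> \<ominus>\<^bsub>W\<^esub> v" and "s = h u u \<ominus> h v u"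
  have w: "w \<in> carrier W" using u v by (simp add: w_def)
  have sU: "s \<in> Units B" using unit by (simp add: s_def)
  have wu: "h w u = s" using u v by (simp add: w_def s_def h_add_l h_neg_l a_minus_def)
  have cs: "cj s = h u u \<ominus> h u v" using u v by (simp add: s_def cj_h)
  have "h w w = (h u u \<ominus> h v u) \<oplus> (h u u \<ominus> h u v)"
    unfolding w_def using u v
    by (simp add: h_add_l h_add_r h_neg_l h_neg_r eq a_minus_def R.minus_add R.a_ac)
  then have "h w w = s \<oplus> cj s" unfolding cs by (simp only: s_def)
  then have "quasi_reflection w s \<in> carrier U" by (rule quasi_reflection_unitary[OF w sU])
  moreover have "quasi_reflection w s u = v"
  proof -
    have "quasi_reflection w s u = u \<oplus>\<^bsub>W\<^esub> (\<ominus> \<one>) \<odot>\<^bsub>W\<^esub> w"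
      using u sU by (simp add: quasi_reflection_def wu)
    also have "\<dots> = u \<oplus>\<^bsub>W\<^esub> \<ominus>\<^bsub>W\<^esub> w" by (simp only: neg_smult[OF w])
    also have "\<dots> = v"
      unfolding w_def using u v
      by (simp add: M.minus_add M.a_assoc[symmetric] M.r_neg)
    finally show ?thesis .
  qed
  ultimately show ?thesis using that by blast
qed

text \<open>
  The parameters belonging to the pairs \<open>u\<close>, \<open>v\<close> and \<open>u\<close>, \<open>-v\<close> have the unit \<open>2 h u u\<close> as their
  sum, so in a local ring one of them is a unit.  In the second case \<open>-1\<close> is applied afterwards.
\<close>

theorem witt_transitivity:
  assumes u: "u \<in> carrier W" and v: "v \<in> carrier W" and eq: "h v v = h u u"
    and unit: "h u u \<in> Units B"
  obtains g where "g \<in> carrier U" "g u = v"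
proof (cases "h u u \<ominus> h v u \<in> Units B")
  case True
  then show ?thesis using unitary_maps_if_unit[OF u v eq] that by blast
next
  case False
  have c: "h u u \<in> carrier B" "h v u \<in> carrier B" using u v by auto
  have m: "h u u \<ominus> h v u \<in> \<mm>" using False unit_if_not_mem c by blast
  have "h u u \<oplus> h v u \<in> Units B"
  proof (rule unit_if_not_mem, goal_cases)
    case 2
    show ?case
    proof
      assume "h u u \<oplus> h v u \<in> \<mm>"
      with m have "(h u u \<ominus> h v u) \<oplus> (h u u \<oplus> h v u) \<in> \<mm>" by (rule mm.a_closed)
      moreover have "(h u u \<ominus> h v u) \<oplus> (h u u \<oplus> h v u) = h u u \<otimes> (\<one> \<oplus> \<one>)"
        using c by algebra
      moreover have "h u u \<otimes> (\<one> \<oplus> \<one>) \<in> Units B"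
        using unit unit_iff[of "\<one> \<oplus> \<one>"] two_not_mem by simp
      ultimately show False using unit_not_mem by metis
    qed
  qed (use c in auto)
  then have "h u u \<ominus> h (\<ominus>\<^bsub>W\<^esub> v) u \<in> Units B" using u v by (simp add: h_neg_l a_minus_def)
  moreover have "h (\<ominus>\<^bsub>W\<^esub> v) (\<ominus>\<^bsub>W\<^esub> v) = h u u" using u v eq by (simp add: h_neg_l h_neg_r)
  ultimately obtain g where g: "g \<in> carrier U" "g u = \<ominus>\<^bsub>W\<^esub> v"
    using unitary_maps_if_unit[OF u, of "\<ominus>\<^bsub>W\<^esub> v"] v by blast
  show ?thesis using that[OF U_neg[OF g(1)]] g(2) u v by simp
qed

theorem stabilizer_index:
  assumes u: "u \<in> carrier W" and unit: "h u u \<in> Units B"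
  shows "group_index U (stabilizer U (\<lambda>g. g) u) = card {v \<in> carrier W. h v v = h u u}"
proof -
  have "{g u | g. g \<in> carrier U} = {v \<in> carrier W. h v v = h u u}"
  proof safe
    fix g assume g: "g \<in> carrier U"
    then show "g u \<in> carrier W" "h (g u) (g u) = h u u" using u U_apply by (auto simp: carrier_U)
  next
    fix v assume v: "v \<in> carrier W" "h v v = h u u"
    then show "\<exists>g. v = g u \<and> g \<in> carrier U" using witt_transitivity[OF u v unit] by metis
  qed
  then show ?thesis using group_index_stabilizer[OF u] by simp
qed

end

section \<open>Counting vectors of a given unit norm\<close>

definition lincomb ::
    "('a, 'v, 'd) module_scheme \<Rightarrow> nat \<Rightarrow> (nat \<Rightarrow> 'v) \<Rightarrow> (nat \<Rightarrow> 'a) \<Rightarrow> 'v" where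
  "lincomb M n e x = (\<Oplus>\<^bsub>M\<^esub>i\<in>{..<n}. x i \<odot>\<^bsub>M\<^esub> e i)"

context module
begin

lemma lincomb_closed:
  assumes "\<And>i. i < n \<Longrightarrow> e i \<in> carrier M" "\<And>i. i < n \<Longrightarrow> x i \<in> carrier R"
  shows "lincomb M n e x \<in> carrier M"
  unfolding lincomb_def by (rule M.finsum_closed) (use assms in auto)

lemma lincomb_0: "lincomb M 0 e x = \<zero>\<^bsub>M\<^esub>"
  by (simp add: lincomb_def)

lemma lincomb_Suc:
  assumes "\<And>i. i < Suc n \<Longrightarrow> e i \<in> carrier M" "\<And>i. i < Suc n \<Longrightarrow> x i \<in> carrier R"
  shows "lincomb M (Suc n) e x = lincomb M n e x \<oplus>\<^bsub>M\<^esub> x n \<odot>\<^bsub>M\<^esub> e n"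
proof -
  have "lincomb M (Suc n) e x = x n \<odot>\<^bsub>M\<^esub> e n \<oplus>\<^bsub>M\<^esub> lincomb M n e x"
    unfolding lincomb_def lessThan_Suc using assms by (intro M.finsum_insert) auto
  then show ?thesis using M.a_comm lincomb_closed[of n e x] assms by simp
qed

lemma lincomb_cong:
  assumes "\<And>i. i < n \<Longrightarrow> e i \<in> carrier M" "\<And>i. i < n \<Longrightarrow> x i \<in> carrier R"
    and "\<And>i. i < n \<Longrightarrow> x i = y i" "\<And>i. i < n \<Longrightarrow> e i = e' i"
  shows "lincomb M n e x = lincomb M n e' y"
  unfolding lincomb_def by (rule M.finsum_cong') (use assms in auto)

lemma lincomb_add:
  assumes "\<And>i. i < n \<Longrightarrow> e i \<in> carrier M" "\<And>i. i < n \<Longrightarrow> x i \<in> carrier R"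
    "\<And>i. i < n \<Longrightarrow> y i \<in> carrier R"
  shows "lincomb M n e (\<lambda>i. x i \<oplus> y i) = lincomb M n e x \<oplus>\<^bsub>M\<^esub> lincomb M n e y"
  using assms
proof (induction n)
  case (Suc n)
  then show ?case
    by (simp add: lincomb_Suc lincomb_closed smult_l_distr M.a_ac)
qed (simp add: lincomb_0)

lemma lincomb_smult:
  assumes "\<And>i. i < n \<Longrightarrow> e i \<in> carrier M" "\<And>i. i < n \<Longrightarrow> x i \<in> carrier R" "a \<in> carrier R"
  shows "lincomb M n e (\<lambda>i. a \<otimes> x i) = a \<odot>\<^bsub>M\<^esub> lincomb M n e x"
  using assms
proof (induction n)
  case (Suc n)
  then show ?case
    by (simp add: lincomb_Suc lincomb_closed smult_r_distr smult_assoc1)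
qed (simp add: lincomb_0)

lemma lincomb_minus:
  assumes "\<And>i. i < n \<Longrightarrow> e i \<in> carrier M" "\<And>i. i < n \<Longrightarrow> x i \<in> carrier R"
    "\<And>i. i < n \<Longrightarrow> y i \<in> carrier R"
  shows "lincomb M n e (\<lambda>i. x i \<ominus> y i) = lincomb M n e x \<ominus>\<^bsub>M\<^esub> lincomb M n e y"
proof -
  have "lincomb M n e (\<lambda>i. x i \<ominus> y i) = lincomb M n e (\<lambda>i. x i \<oplus> (\<ominus> \<one>) \<otimes> y i)"
    by (rule lincomb_cong) (use assms in \<open>auto simp: a_minus_def R.l_minus\<close>)
  also have "\<dots> = lincomb M n e x \<oplus>\<^bsub>M\<^esub> (\<ominus> \<one>) \<odot>\<^bsub>M\<^esub> lincomb M n e y"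
    using assms by (simp add: lincomb_add lincomb_smult)
  also have "\<dots> = lincomb M n e x \<ominus>\<^bsub>M\<^esub> lincomb M n e y"
    using assms lincomb_closed[of n e y] by (simp add: a_minus_def smult_l_minus)
  finally show ?thesis .
qed

lemma basis_coordinates:
  assumes "is_basis R M n e"
  shows "bij_betw (lincomb M n e) ({..<n} \<rightarrow>\<^sub>E carrier R) (carrier M)"
proof -
  have e: "e i \<in> carrier M" if "i < n" for i using assms that by (simp add: is_basis_def)
  have span: "\<exists>c\<in>{..<n} \<rightarrow> carrier R. v = lincomb M n e c" if "v \<in> carrier M" for v
    using assms that unfolding is_basis_def lincomb_def by blast
  have indep: "c i = \<zero>" if "c \<in> {..<n} \<rightarrow> carrier R" "lincomb M n e c = \<zero>\<^bsub>M\<^esub>" "i < n" for c i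
    using assms that unfolding is_basis_def lincomb_def by blast
  show ?thesis
  proof (rule bij_betw_imageI)
    show "inj_on (lincomb M n e) ({..<n} \<rightarrow>\<^sub>E carrier R)"
    proof
      fix x y assume x: "x \<in> {..<n} \<rightarrow>\<^sub>E carrier R" and y: "y \<in> {..<n} \<rightarrow>\<^sub>E carrier R"
        and eq: "lincomb M n e x = lincomb M n e y"
      have xy: "x i \<in> carrier R" "y i \<in> carrier R" if "i < n" for i
        using x y that by (auto simp: PiE_iff)
      have "lincomb M n e (\<lambda>i. x i \<ominus> y i) = lincomb M n e x \<ominus>\<^bsub>M\<^esub> lincomb M n e y"
        using e xy by (rule lincomb_minus)
      also have "\<dots> = \<zero>\<^bsub>M\<^esub>"
        unfolding eq using lincomb_closed[of n e y] e xy by (simp add: a_minus_def M.r_neg)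
      finally have z: "lincomb M n e (\<lambda>i. x i \<ominus> y i) = \<zero>\<^bsub>M\<^esub>" .
      show "x = y"
      proof (rule PiE_ext[OF x y])
        fix i assume "i \<in> {..<n}"
        then have "x i \<ominus> y i = \<zero>" using indep[OF _ z, of i] xy by auto
        then show "x i = y i" using xy \<open>i \<in> {..<n}\<close> by simp
      qed
    qed
    show "lincomb M n e ` ({..<n} \<rightarrow>\<^sub>E carrier R) = carrier M"
    proof safe
      fix x assume "x \<in> {..<n} \<rightarrow>\<^sub>E carrier R"
      then show "lincomb M n e x \<in> carrier M" using e by (intro lincomb_closed) (auto simp: PiE_iff)
    next
      fix v assume "v \<in> carrier M"
      then obtain c where c: "c \<in> {..<n} \<rightarrow> carrier R" "v = lincomb M n e c" using span by blast
      have "lincomb M n e c = lincomb M n e (restrict c {..<n})"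
        by (rule lincomb_cong) (use e c in auto)
      then show "v \<in> lincomb M n e ` ({..<n} \<rightarrow>\<^sub>E carrier R)"
        using c by (intro image_eqI[of _ _ "restrict c {..<n}"]) auto
    qed
  qed
qed

lemma card_free:
  assumes "is_basis R M n e"
  shows "card (carrier M) = card (carrier R) ^ n"
  using bij_betw_same_card[OF basis_coordinates[OF assms]] by (simp add: card_PiE)

end

definition orthogonal_system ::
    "('a, 'c) ring_scheme \<Rightarrow> ('v \<Rightarrow> 'v \<Rightarrow> 'a) \<Rightarrow> nat \<Rightarrow> (nat \<Rightarrow> 'v) \<Rightarrow> bool" where
  "orthogonal_system R h n e \<longleftrightarrow> (\<forall>i<n. \<forall>j<n. i \<noteq> j \<longrightarrow> h (e i) (e j) = \<zero>\<^bsub>R\<^esub>)"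

lemma card_PiE_Suc:
  assumes A: "finite A"
  shows "card {x \<in> {..<Suc n} \<rightarrow>\<^sub>E A. P x} = (\<Sum>y\<in>A. card {x \<in> {..<n} \<rightarrow>\<^sub>E A. P (x(n := y))})"
proof -
  have "card {x \<in> {..<Suc n} \<rightarrow>\<^sub>E A. P x} =
      card (SIGMA y:A. {x \<in> {..<n} \<rightarrow>\<^sub>E A. P (x(n := y))})"
  proof (rule bij_betw_same_card[OF bij_betw_byWitness[where
        f="\<lambda>x. (x n, x(n := undefined))" and f'="\<lambda>(y, x). x(n := y)"]])
    show "(\<lambda>x. (x n, x(n := undefined))) ` {x \<in> {..<Suc n} \<rightarrow>\<^sub>E A. P x}
        \<subseteq> (SIGMA y:A. {x \<in> {..<n} \<rightarrow>\<^sub>E A. P (x(n := y))})"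
      by (auto simp: PiE_iff extensional_def)
    show "(\<lambda>(y, x). x(n := y)) ` (SIGMA y:A. {x \<in> {..<n} \<rightarrow>\<^sub>E A. P (x(n := y))})
        \<subseteq> {x \<in> {..<Suc n} \<rightarrow>\<^sub>E A. P x}"
      by (auto simp: PiE_iff extensional_def less_Suc_eq)
  qed (auto simp: PiE_iff extensional_def fun_eq_iff)
  also have "\<dots> = (\<Sum>y\<in>A. card {x \<in> {..<n} \<rightarrow>\<^sub>E A. P (x(n := y))})"
  proof (rule card_SigmaI[OF A], rule ballI)
    fix y
    have "finite ({..<n} \<rightarrow>\<^sub>E A)" using A by (intro finite_PiE) auto
    then show "finite {x \<in> {..<n} \<rightarrow>\<^sub>E A. P (x(n := y))}" by simp
  qed
  finally show ?thesis .
qed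

context finite_hermitian_module
begin

lemma h_lincomb_orthogonal:
  assumes "\<And>i. i < n \<Longrightarrow> e i \<in> carrier W" "\<And>i. i < n \<Longrightarrow> x i \<in> carrier B"
    and "w \<in> carrier W" "\<And>i. i < n \<Longrightarrow> h w (e i) = \<zero>"
  shows "h w (lincomb W n e x) = \<zero>"
  using assms
proof (induction n)
  case (Suc n)
  then show ?case by (simp add: lincomb_Suc lincomb_closed h_add_r h_smult_r)
qed (simp add: lincomb_0 h_zero_r)

lemma norm_lincomb_Suc:
  assumes e: "\<And>i. i < Suc n \<Longrightarrow> e i \<in> carrier W" and x: "\<And>i. i < Suc n \<Longrightarrow> x i \<in> carrier B"
    and orth: "orthogonal_system B h (Suc n) e"
  shows "h (lincomb W (Suc n) e x) (lincomb W (Suc n) e x) =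
    h (lincomb W n e x) (lincomb W n e x) \<oplus> h (e n) (e n) \<otimes> (cj (x n) \<otimes> x n)"
proof -
  let ?s = "lincomb W n e x"
  have s: "?s \<in> carrier W" using e x by (intro lincomb_closed) auto
  have 1: "h (e n) ?s = \<zero>"
    using e x orth by (intro h_lincomb_orthogonal) (auto simp: orthogonal_system_def)
  then have 2: "h ?s (e n) = \<zero>" using h_conj[of "e n" ?s] s e by simp
  have en: "e n \<in> carrier W" "x n \<in> carrier B" using e x by auto
  have "h (?s \<oplus>\<^bsub>W\<^esub> x n \<odot>\<^bsub>W\<^esub> e n) (?s \<oplus>\<^bsub>W\<^esub> x n \<odot>\<^bsub>W\<^esub> e n)
      = h ?s ?s \<oplus> cj (x n) \<otimes> h (e n) (e n) \<otimes> x n"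
    using s en by (simp add: h_add_l h_add_r h_smult_l h_smult_r 1 2)
  then show ?thesis
    using lincomb_Suc[OF e x] en by (simp add: R.m_ac)
qed

text \<open>
  The involution is trivial on residues, so the norm of a combination of orthogonal vectors reduces
  to a diagonal quadratic form in the residues of the coordinates, and each residue has as many
  lifts as \<open>\<mm>\<close> has elements.
\<close>

lemma card_norm_residue:
  assumes e: "\<And>i. i < n \<Longrightarrow> e i \<in> carrier W" and orth: "orthogonal_system B h n e"
    and C: "C \<in> carrier k"
  shows "card {x \<in> {..<n} \<rightarrow>\<^sub>E carrier B. pr (h (lincomb W n e x) (lincomb W n e x)) = C}
       = card \<mm> ^ n * quad_count k (\<lambda>i. pr (h (e i) (e i))) n C"
  using assms
proof (induction n arbitrary: C)
  case 0
  have "pr \<zero> = C \<longleftrightarrow> C = \<zero>\<^bsub>k\<^esub>" using pr.hom_zero by auto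
  then show ?case by (auto simp: lincomb_0 h_zero_r)
next
  case (Suc n)
  let ?N = "\<lambda>n x. h (lincomb W n e x) (lincomb W n e x)"
  let ?a = "\<lambda>i. pr (h (e i) (e i))"
  have en: "h (e n) (e n) \<in> carrier B" using Suc.prems(1)[of n] by simp
  have orth: "orthogonal_system B h n e" using Suc.prems(2) by (simp add: orthogonal_system_def)
  have rest: "?N n (x(n := y)) = ?N n x" if x: "x \<in> {..<n} \<rightarrow>\<^sub>E carrier B" for x y
  proof -
    have "lincomb W n e (x(n := y)) = lincomb W n e x"
      using Suc.prems(1) x by (intro lincomb_cong) (auto simp: PiE_iff)
    then show ?thesis by simp
  qed
  have step: "pr (?N (Suc n) (x(n := y))) = C \<longleftrightarrow>
      pr (?N n x) = C \<ominus>\<^bsub>k\<^esub> ?a n \<otimes>\<^bsub>k\<^esub> (pr y \<otimes>\<^bsub>k\<^esub> pr y)"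
    if x: "x \<in> {..<n} \<rightarrow>\<^sub>E carrier B" and y: "y \<in> carrier B" for x y
  proof -
    have xc: "x i \<in> carrier B" if "i < n" for i using x that by auto
    have N: "?N n x \<in> carrier B"
      using Suc.prems(1) xc by (intro h_closed lincomb_closed) auto
    have upd: "(x(n := y)) i \<in> carrier B" if "i < Suc n" for i
      using xc y that by (cases "i = n") auto
    have "?N (Suc n) (x(n := y)) = ?N n (x(n := y)) \<oplus> h (e n) (e n) \<otimes> (cj y \<otimes> y)"
      using norm_lincomb_Suc[where x = "x(n := y)", OF Suc.prems(1) upd Suc.prems(2)] by simp
    then have eq: "pr (?N (Suc n) (x(n := y))) = pr (?N n x) \<oplus>\<^bsub>k\<^esub> ?a n \<otimes>\<^bsub>k\<^esub> (pr y \<otimes>\<^bsub>k\<^esub> pr y)"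
      using N en y by (simp add: rest[OF x] pr_cj)
    define P Q where "P = pr (?N n x)" and "Q = ?a n \<otimes>\<^bsub>k\<^esub> (pr y \<otimes>\<^bsub>k\<^esub> pr y)"
    have PQ: "P \<in> carrier k" "Q \<in> carrier k" using N en y by (auto simp: P_def Q_def)
    have "P \<oplus>\<^bsub>k\<^esub> Q = C \<longleftrightarrow> P = C \<ominus>\<^bsub>k\<^esub> Q"
    proof
      assume "P \<oplus>\<^bsub>k\<^esub> Q = C"
      then have "C \<ominus>\<^bsub>k\<^esub> Q = (P \<oplus>\<^bsub>k\<^esub> Q) \<ominus>\<^bsub>k\<^esub> Q" by simp
      also have "\<dots> = P" using PQ by (simp add: a_minus_def k.a_assoc k.r_neg)
      finally show "P = C \<ominus>\<^bsub>k\<^esub> Q" ..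
    next
      assume "P = C \<ominus>\<^bsub>k\<^esub> Q"
      then show "P \<oplus>\<^bsub>k\<^esub> Q = C"
        using PQ Suc.prems(3) by (simp add: a_minus_def k.a_assoc k.l_neg)
    qed
    then show ?thesis unfolding eq P_def Q_def .
  qed
  have aC: "?a n \<in> carrier k" using en by simp
  have "card {x \<in> {..<Suc n} \<rightarrow>\<^sub>E carrier B. pr (?N (Suc n) x) = C}
      = (\<Sum>y\<in>carrier B. card {x \<in> {..<n} \<rightarrow>\<^sub>E carrier B. pr (?N (Suc n) (x(n := y))) = C})"
    by (rule card_PiE_Suc[OF fin_carrier])
  also have "\<dots> = (\<Sum>y\<in>carrier B. card {x \<in> {..<n} \<rightarrow>\<^sub>E carrier B.
      pr (?N n x) = C \<ominus>\<^bsub>k\<^esub> ?a n \<otimes>\<^bsub>k\<^esub> (pr y \<otimes>\<^bsub>k\<^esub> pr y)})"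
    using step by (intro sum.cong refl arg_cong[where f=card]) blast
  also have "\<dots> = (\<Sum>y\<in>carrier B. card \<mm> ^ n * quad_count k ?a n (C \<ominus>\<^bsub>k\<^esub> ?a n \<otimes>\<^bsub>k\<^esub> (pr y \<otimes>\<^bsub>k\<^esub> pr y)))"
  proof (rule sum.cong[OF refl])
    fix y assume y: "y \<in> carrier B"
    have "C \<ominus>\<^bsub>k\<^esub> ?a n \<otimes>\<^bsub>k\<^esub> (pr y \<otimes>\<^bsub>k\<^esub> pr y) \<in> carrier k" using y aC Suc.prems(3) by simp
    then show "card {x \<in> {..<n} \<rightarrow>\<^sub>E carrier B.
        pr (?N n x) = C \<ominus>\<^bsub>k\<^esub> ?a n \<otimes>\<^bsub>k\<^esub> (pr y \<otimes>\<^bsub>k\<^esub> pr y)}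
      = card \<mm> ^ n * quad_count k ?a n (C \<ominus>\<^bsub>k\<^esub> ?a n \<otimes>\<^bsub>k\<^esub> (pr y \<otimes>\<^bsub>k\<^esub> pr y))"
      using Suc.prems(1) orth by (intro Suc.IH) auto
  qed
  also have "\<dots> = (\<Sum>Y\<in>carrier k. \<Sum>y\<in>{y. y \<in> carrier B \<and> pr y = Y}.
      card \<mm> ^ n * quad_count k ?a n (C \<ominus>\<^bsub>k\<^esub> ?a n \<otimes>\<^bsub>k\<^esub> (pr y \<otimes>\<^bsub>k\<^esub> pr y)))"
    by (rule sum.group[symmetric]) (use fin_carrier k.fin in auto)
  also have "\<dots> = (\<Sum>Y\<in>carrier k. card {y. y \<in> carrier B \<and> pr y = Y} *
      (card \<mm> ^ n * quad_count k ?a n (C \<ominus>\<^bsub>k\<^esub> ?a n \<otimes>\<^bsub>k\<^esub> (Y \<otimes>\<^bsub>k\<^esub> Y))))"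
    by (rule sum.cong[OF refl]) simp
  also have "\<dots> = (\<Sum>Y\<in>carrier k. card \<mm> *
      (card \<mm> ^ n * quad_count k ?a n (C \<ominus>\<^bsub>k\<^esub> ?a n \<otimes>\<^bsub>k\<^esub> (Y \<otimes>\<^bsub>k\<^esub> Y))))"
    by (rule sum.cong[OF refl]) (simp only: card_pr_fibre)
  also have "\<dots> = card \<mm> ^ Suc n * quad_count k ?a (Suc n) C"
    by (simp add: sum_distrib_left mult.assoc)
  finally show ?case .
qed

text \<open>
  A fixed \<open>w\<close> with \<open>w\<^sup>2 = 1 + z\<close> multiplies all norms by \<open>1 + z\<close>.
\<close>

lemma card_norm_scale:
  assumes z: "z \<in> \<mm>" "cj z = z" and t: "t \<in> carrier B"
  shows "card {v \<in> carrier W. h v v = t \<otimes> (\<one> \<oplus> z)} = card {v \<in> carrier W. h v v = t}"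
proof -
  obtain w where w: "w \<in> Units B" "cj w = w" "w \<otimes> w = \<one> \<oplus> z" using principal_unit_sqrt[OF z] .
  have wc: "w \<in> carrier B" "inv w \<in> carrier B" "cj (inv w) = inv w"
    using w by (auto simp: cj_inv)
  have ww: "(inv w \<otimes> inv w) \<otimes> (w \<otimes> w) = \<one>"
  proof -
    have "(inv w \<otimes> inv w) \<otimes> (w \<otimes> w) = inv w \<otimes> ((inv w \<otimes> w) \<otimes> w)" using wc by (simp add: R.m_assoc)
    then show ?thesis using w wc by simp
  qed
  have sc: "h (a \<odot>\<^bsub>W\<^esub> v) (a \<odot>\<^bsub>W\<^esub> v) = h v v \<otimes> (a \<otimes> a)"
    if "a \<in> carrier B" "cj a = a" "v \<in> carrier W" for a v
    using that by (simp add: h_smult_l h_smult_r R.m_ac)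
  have i1: "inv w \<odot>\<^bsub>W\<^esub> (w \<odot>\<^bsub>W\<^esub> v) = v" "w \<odot>\<^bsub>W\<^esub> (inv w \<odot>\<^bsub>W\<^esub> v) = v" if "v \<in> carrier W" for v
    using that w wc by (simp_all add: smult_assoc1[symmetric])
  have "bij_betw (\<lambda>v. w \<odot>\<^bsub>W\<^esub> v) {v \<in> carrier W. h v v = t} {v \<in> carrier W. h v v = t \<otimes> (\<one> \<oplus> z)}"
  proof (rule bij_betw_byWitness[where f'="\<lambda>v. inv w \<odot>\<^bsub>W\<^esub> v"])
    show "(\<lambda>v. w \<odot>\<^bsub>W\<^esub> v) ` {v \<in> carrier W. h v v = t} \<subseteq> {v \<in> carrier W. h v v = t \<otimes> (\<one> \<oplus> z)}"
      using wc w by (auto simp: sc)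
    have "t \<otimes> (w \<otimes> w) \<otimes> (inv w \<otimes> inv w) = t"
    proof -
      have "t \<otimes> (w \<otimes> w) \<otimes> (inv w \<otimes> inv w) = t \<otimes> ((inv w \<otimes> inv w) \<otimes> (w \<otimes> w))"
        using t wc by (simp add: R.m_ac)
      then show ?thesis unfolding ww using t by simp
    qed
    then show "(\<lambda>v. inv w \<odot>\<^bsub>W\<^esub> v) ` {v \<in> carrier W. h v v = t \<otimes> (\<one> \<oplus> z)} \<subseteq> {v \<in> carrier W. h v v = t}"
      using wc w(3)[symmetric] by (auto simp: sc)
  qed (use i1 in auto)
  then show ?thesis by (rule bij_betw_same_card[symmetric])
qed

text \<open>
  The vectors whose norm has the residue of \<open>t\<close> are sorted by their norm.  Norms are fixed by the
  involution, so these norms are the elements \<open>t (1 + z)\<close> with \<open>z\<close> fixed in \<open>\<mm>\<close>, and each of them is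
  taken equally often.
\<close>

theorem card_norm_eq:
  assumes basis: "is_basis B W n e" and orth: "orthogonal_system B h n e"
    and t: "t \<in> Units B" "cj t = t"
  shows "card {z \<in> \<mm>. cj z = z} * card {v \<in> carrier W. h v v = t}
       = card \<mm> ^ n * quad_count k (\<lambda>i. pr (h (e i) (e i))) n (pr t)"
proof -
  have tc: "t \<in> carrier B" using t(1) by (rule R.Units_closed)
  have cancel: "inv t \<otimes> (t \<otimes> y) = y" "t \<otimes> (inv t \<otimes> y) = y" if "y \<in> carrier B" for y
    using that t(1) tc by (simp_all add: R.m_assoc[symmetric])
  have e: "e i \<in> carrier W" if "i < n" for i using basis that by (simp add: is_basis_def)
  let ?F = "{z \<in> \<mm>. cj z = z}" and ?L = "lincomb W n e"
  have fF: "finite ?F" using finite_subset[OF mm.a_subset fin_carrier] by simp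
  have disj: "{v \<in> carrier W. h v v = t \<otimes> (\<one> \<oplus> z)} \<inter> {v \<in> carrier W. h v v = t \<otimes> (\<one> \<oplus> z')} = {}"
    if "z \<in> ?F" "z' \<in> ?F" "z \<noteq> z'" for z z'
  proof -
    have "t \<otimes> (\<one> \<oplus> z) \<noteq> t \<otimes> (\<one> \<oplus> z')"
    proof
      assume eq: "t \<otimes> (\<one> \<oplus> z) = t \<otimes> (\<one> \<oplus> z')"
      have zc: "z \<in> carrier B" "z' \<in> carrier B" using that mm.Icarr by blast+
      have "inv t \<otimes> (t \<otimes> (\<one> \<oplus> z)) = inv t \<otimes> (t \<otimes> (\<one> \<oplus> z'))" using eq by simp
      then have "\<one> \<oplus> z = \<one> \<oplus> z'" using zc by (simp add: cancel)
      then show False using that(3) zc by simp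
    qed
    then show ?thesis by auto
  qed
  have "{v \<in> carrier W. pr (h v v) = pr t} = (\<Union>z\<in>?F. {v \<in> carrier W. h v v = t \<otimes> (\<one> \<oplus> z)})"
  proof (intro equalityI subsetI)
    fix v assume "v \<in> {v \<in> carrier W. pr (h v v) = pr t}"
    then have v: "v \<in> carrier W" and eq: "pr (h v v) = pr t" by auto
    \<comment> \<open>so that \<open>h v v = t (1 + z)\<close>\<close>
    define z where "z = inv t \<otimes> (h v v \<ominus> t)"
    have d: "h v v \<ominus> t \<in> \<mm>" using eq pr_eq_iff[of "h v v" t] v tc by simp
    have zm: "z \<in> \<mm>" unfolding z_def by (rule mm.I_l_closed[OF d]) (use t in auto)
    have hv: "cj (h v v) = h v v" using v cj_h by simp
    have "cj z = z" unfolding z_def using t tc v hv by (simp add: cj_inv)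
    moreover have "t \<otimes> (\<one> \<oplus> z) = h v v"
    proof -
      have "t \<otimes> (\<one> \<oplus> z) = t \<oplus> t \<otimes> z" using tc mm.Icarr[OF zm] by (simp add: R.r_distr)
      also have "t \<otimes> z = h v v \<ominus> t" unfolding z_def using tc v by (simp add: cancel)
      also have "t \<oplus> (h v v \<ominus> t) = h v v"
        using R.a_lcomm[of t "h v v" "\<ominus> t"] tc v by (simp add: a_minus_def R.r_neg)
      finally show ?thesis .
    qed
    ultimately show "v \<in> (\<Union>z\<in>?F. {v \<in> carrier W. h v v = t \<otimes> (\<one> \<oplus> z)})" using zm v by auto
  next
    fix v assume "v \<in> (\<Union>z\<in>?F. {v \<in> carrier W. h v v = t \<otimes> (\<one> \<oplus> z)})"
    then obtain z where v: "v \<in> carrier W" and z: "z \<in> \<mm>" and eq: "h v v = t \<otimes> (\<one> \<oplus> z)" by auto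
    have "pr z = \<zero>\<^bsub>k\<^esub>" using z pr_zero_iff[of z] by simp
    then have "pr (h v v) = pr t" unfolding eq using tc mm.Icarr[OF z] by simp
    then show "v \<in> {v \<in> carrier W. pr (h v v) = pr t}" using v by blast
  qed
  then have "card {v \<in> carrier W. pr (h v v) = pr t}
      = (\<Sum>z\<in>?F. card {v \<in> carrier W. h v v = t \<otimes> (\<one> \<oplus> z)})"
    using disj fF fin_W by (simp only:) (rule card_UN_disjoint, auto)
  also have "\<dots> = card ?F * card {v \<in> carrier W. h v v = t}"
    by (simp add: card_norm_scale tc)
  finally have 1: "card {v \<in> carrier W. pr (h v v) = pr t} = card ?F * card {v \<in> carrier W. h v v = t}" .
  have bij: "bij_betw ?L ({..<n} \<rightarrow>\<^sub>E carrier B) (carrier W)" by (rule basis_coordinates[OF basis])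
  have "bij_betw ?L {x \<in> {..<n} \<rightarrow>\<^sub>E carrier B. pr (h (?L x) (?L x)) = pr t} {v \<in> carrier W. pr (h v v) = pr t}"
    by (rule bij_betw_subset[OF bij]) (use bij in \<open>auto simp: bij_betw_def\<close>)
  then have "card {v \<in> carrier W. pr (h v v) = pr t} =
      card {x \<in> {..<n} \<rightarrow>\<^sub>E carrier B. pr (h (?L x) (?L x)) = pr t}" by (rule bij_betw_same_card[symmetric])
  also have "\<dots> = card \<mm> ^ n * quad_count k (\<lambda>i. pr (h (e i) (e i))) n (pr t)"
    by (rule card_norm_residue) (use e orth tc in auto)
  finally show ?thesis using 1 by simp
qed

end

section \<open>Reduction of modules and forms modulo an ideal\<close>

context cring
begin

lemma ideal_prod_cgenideal:
  assumes "a \<in> carrier R" "b \<in> carrier R"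
  shows "ideal_prod R (PIdl a) (PIdl b) = PIdl (a \<otimes> b)"
proof -
  have "ideal_prod R (PIdl a) (PIdl b) = Idl (PIdl a <#> PIdl b)"
    by (rule ideal_prod_eq_genideal) (use assms cgenideal_ideal in auto)
  also have "\<dots> = Idl (PIdl (a \<otimes> b))" using cgenideal_prod[OF assms] by simp
  also have "\<dots> = PIdl (a \<otimes> b)"
    using genideal_minimal[OF cgenideal_ideal, of "a \<otimes> b" "PIdl (a \<otimes> b)"]
      genideal_self[of "PIdl (a \<otimes> b)"] ideal.Icarr[OF cgenideal_ideal, of "a \<otimes> b"] assms
    by (intro equalityI) auto
  finally show ?thesis .
qed

lemma ideal_pow_cgenideal:
  assumes "a \<in> carrier R"
  shows "ideal_pow R (PIdl a) n = PIdl (a [^] n)"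
proof (induction n)
  case 0
  have "PIdl \<one> = carrier R" unfolding cgenideal_def using r_one m_closed one_closed by force
  then show ?case by (simp add: ideals_set_def nat_pow_def)
next
  case (Suc n)
  have "ideal_pow R (PIdl a) (Suc n) = ideal_prod R (ideal_pow R (PIdl a) n) (PIdl a)"
    by (simp add: ideals_set_def nat_pow_def)
  then show ?case using Suc assms by (simp add: ideal_prod_cgenideal)
qed

lemma ideal_image_cgenideal:
  assumes I: "ideal I R" and a: "a \<in> carrier R"
  shows "ideal_image R I (PIdl a) = PIdl\<^bsub>R Quot I\<^esub> (I +> a)"
proof -
  interpret I: ideal I R by (rule I)
  have 1: "(I +> x) \<otimes>\<^bsub>R Quot I\<^esub> (I +> a) = I +> (x \<otimes> a)" if "x \<in> carrier R" for x
    using ring_hom_mult[OF I.rcos_ring_hom that a] by simp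
  have 2: "carrier (R Quot I) = (\<lambda>x. I +> x) ` carrier R"
    by (auto simp: FactRing_def A_RCOSETS_def')
  show ?thesis
    unfolding ideal_image_def cgenideal_def 2 using 1 by force
qed

end

lemma quot_map_coset:
  assumes "f \<in> ring_hom R R" "f ` I = I" "I \<subseteq> carrier R" "x \<in> carrier R"
  shows "quot_map f (I +>\<^bsub>R\<^esub> x) = I +>\<^bsub>R\<^esub> f x"
proof -
  have "f (i \<oplus>\<^bsub>R\<^esub> x) = f i \<oplus>\<^bsub>R\<^esub> f x" if "i \<in> I" for i
    using assms that by (auto intro: ring_hom_add)
  then have "quot_map f (I +>\<^bsub>R\<^esub> x) = (\<lambda>i. f i \<oplus>\<^bsub>R\<^esub> f x) ` I"
    unfolding quot_map_def a_r_coset_def' by force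
  also have "\<dots> = (\<lambda>i. i \<oplus>\<^bsub>R\<^esub> f x) ` (f ` I)" by (simp add: image_image)
  also have "\<dots> = I +>\<^bsub>R\<^esub> f x" unfolding assms(2) a_r_coset_def' by blast
  finally show ?thesis .
qed

lemma hermitian_formD:
  assumes "hermitian_form R invol M h"
  shows "\<lbrakk>x \<in> carrier M; y \<in> carrier M\<rbrakk> \<Longrightarrow> h x y \<in> carrier R"
    and "\<lbrakk>x \<in> carrier M; y \<in> carrier M; z \<in> carrier M\<rbrakk> \<Longrightarrow> h (x \<oplus>\<^bsub>M\<^esub> y) z = h x z \<oplus>\<^bsub>R\<^esub> h y z"
    and "\<lbrakk>x \<in> carrier M; y \<in> carrier M; z \<in> carrier M\<rbrakk> \<Longrightarrow> h z (x \<oplus>\<^bsub>M\<^esub> y) = h z x \<oplus>\<^bsub>R\<^esub> h z y"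
    and "\<lbrakk>x \<in> carrier M; z \<in> carrier M; a \<in> carrier R\<rbrakk> \<Longrightarrow> h z (a \<odot>\<^bsub>M\<^esub> x) = h z x \<otimes>\<^bsub>R\<^esub> a"
    and "\<lbrakk>x \<in> carrier M; y \<in> carrier M\<rbrakk> \<Longrightarrow> h y x = invol (h x y)"
  using assms unfolding hermitian_form_def by blast+

locale module_mod_ideal = module R M + J: ideal J R for R (structure) and M (structure) and J
begin

abbreviation N where "N \<equiv> ideal_smult J M"
abbreviation Q where "Q \<equiv> quot_module J M"
abbreviation RJ where "RJ \<equiv> R Quot J"

lemma gens_subset: "{a \<odot>\<^bsub>M\<^esub> v | a v. a \<in> J \<and> v \<in> carrier M} \<subseteq> carrier M"
  using J.Icarr by auto

lemma N_subgroup: "subgroup N (add_monoid M)"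
  unfolding ideal_smult_def by (rule M.add.generate_is_subgroup[OF gens_subset])

lemma abelian_subgroup_N: "abelian_subgroup N M"
  using N_subgroup M.abelian_group_axioms
  by (intro abelian_subgroupI3 additive_subgroup.intro)

sublocale N: abelian_subgroup N M by (rule abelian_subgroup_N)

lemma smult_mem_N: "\<lbrakk>a \<in> J; v \<in> carrier M\<rbrakk> \<Longrightarrow> a \<odot>\<^bsub>M\<^esub> v \<in> N"
  unfolding ideal_smult_def by (rule generate.incl) blast

lemma N_induct [consumes 1, case_names zero gen neg add]:
  assumes "n \<in> N" "P \<zero>\<^bsub>M\<^esub>" "\<And>a v. \<lbrakk>a \<in> J; v \<in> carrier M\<rbrakk> \<Longrightarrow> P (a \<odot>\<^bsub>M\<^esub> v)"
    "\<And>a v. \<lbrakk>a \<in> J; v \<in> carrier M\<rbrakk> \<Longrightarrow> P (\<ominus>\<^bsub>M\<^esub> (a \<odot>\<^bsub>M\<^esub> v))"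
    "\<And>x y. \<lbrakk>x \<in> N; y \<in> N; P x; P y\<rbrakk> \<Longrightarrow> P (x \<oplus>\<^bsub>M\<^esub> y)"
  shows "P n"
  using assms(1) unfolding ideal_smult_def
proof (induction n rule: generate.induct)
  case one
  then show ?case using assms(2) by simp
next
  case (incl x)
  then show ?case using assms(3) by blast
next
  case (inv x)
  then show ?case using assms(4) unfolding a_inv_def by blast
next
  case (eng x y)
  then show ?case using assms(5) unfolding ideal_smult_def by simp
qed

lemma smult_N: 
  assumes a: "a \<in> carrier R" and n: "n \<in> N"
  shows "a \<odot>\<^bsub>M\<^esub> n \<in> N"
  using n
proof (induction rule: N_induct)
  case (gen b v)
  then have "a \<odot>\<^bsub>M\<^esub> (b \<odot>\<^bsub>M\<^esub> v) = (a \<otimes> b) \<odot>\<^bsub>M\<^esub> v" using a by (simp add: smult_assoc1)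
  then show ?case using gen a by (simp add: smult_mem_N J.I_l_closed)
next
  case (neg b v)
  then have "a \<odot>\<^bsub>M\<^esub> (\<ominus>\<^bsub>M\<^esub> (b \<odot>\<^bsub>M\<^esub> v)) = \<ominus>\<^bsub>M\<^esub> ((a \<otimes> b) \<odot>\<^bsub>M\<^esub> v)"
    using a by (simp add: smult_assoc1 smult_r_minus)
  then show ?case using neg a by (simp add: smult_mem_N J.I_l_closed)
next
  case (add x y)
  then show ?case using a by (simp add: smult_r_distr)
qed (use a in simp)

abbreviation cls :: "'c \<Rightarrow> 'c set" where "cls v \<equiv> N +>\<^bsub>M\<^esub> v"

lemma cls_eq_iff: "\<lbrakk>v \<in> carrier M; w \<in> carrier M\<rbrakk> \<Longrightarrow> cls v = cls w \<longleftrightarrow> v \<ominus>\<^bsub>M\<^esub> w \<in> N"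
  using N.a_rcos_module[of w v] N.a_repr_independence'[of v w] N.a_rcos_self[of v]
  unfolding a_minus_def by blast

lemma coset_eq_iff: "\<lbrakk>a \<in> carrier R; b \<in> carrier R\<rbrakk> \<Longrightarrow> J +> a = J +> b \<longleftrightarrow> a \<ominus> b \<in> J"
  using R.quotient_eq_iff_same_a_r_cos[OF J.is_ideal] by blast

lemma carrier_Q: "carrier Q = cls ` carrier M"
  by (auto simp: quot_module_def A_RCOSETS_def')

lemma carrier_RJ: "carrier RJ = (\<lambda>a. J +> a) ` carrier R"
  by (auto simp: FactRing_def A_RCOSETS_def')

lemma cls_closed: "v \<in> carrier M \<Longrightarrow> cls v \<in> carrier Q"
  by (simp add: carrier_Q)

lemma cls_add: "\<lbrakk>v \<in> carrier M; w \<in> carrier M\<rbrakk> \<Longrightarrow> cls v \<oplus>\<^bsub>Q\<^esub> cls w = cls (v \<oplus>\<^bsub>M\<^esub> w)"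
  using N.a_rcos_sum[of v w] by (simp add: quot_module_def)

lemma cls_zero: "\<zero>\<^bsub>Q\<^esub> = cls \<zero>\<^bsub>M\<^esub>"
  using N.a_rcos_const[OF N.zero_closed] by (simp add: quot_module_def)

lemma mem_cls: "\<lbrakk>v \<in> carrier M; x \<in> cls v\<rbrakk> \<Longrightarrow> x \<in> carrier M \<and> cls x = cls v"
  using N.a_elemrcos_carrier N.a_repr_independence' by blast

lemma mem_coset: "\<lbrakk>a \<in> carrier R; x \<in> J +> a\<rbrakk> \<Longrightarrow> x \<in> carrier R \<and> J +> x = J +> a"
  using J.a_elemrcos_carrier J.a_repr_independence' by blast

text \<open>
  This makes the union in the definition of the scalar multiplication of \<^const>\<open>quot_module\<close> a union
  of equal cosets.
\<close>

lemma smult_cls_cong: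
  assumes "a \<in> carrier R" "b \<in> carrier R" "J +> a = J +> b"
    "v \<in> carrier M" "w \<in> carrier M" "cls v = cls w"
  shows "cls (a \<odot>\<^bsub>M\<^esub> v) = cls (b \<odot>\<^bsub>M\<^esub> w)"
proof -
  have "a \<ominus> b \<in> J" "v \<ominus>\<^bsub>M\<^esub> w \<in> N" using assms coset_eq_iff[of a b] cls_eq_iff[of v w] by auto
  then have "(a \<ominus> b) \<odot>\<^bsub>M\<^esub> v \<oplus>\<^bsub>M\<^esub> b \<odot>\<^bsub>M\<^esub> (v \<ominus>\<^bsub>M\<^esub> w) \<in> N"
    using assms by (intro N.a_closed smult_mem_N smult_N)
  also have "(a \<ominus> b) \<odot>\<^bsub>M\<^esub> v \<oplus>\<^bsub>M\<^esub> b \<odot>\<^bsub>M\<^esub> (v \<ominus>\<^bsub>M\<^esub> w) = a \<odot>\<^bsub>M\<^esub> v \<ominus>\<^bsub>M\<^esub> b \<odot>\<^bsub>M\<^esub> w"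
    using assms by (simp add: a_minus_def smult_l_distr smult_r_distr smult_l_minus smult_r_minus
        M.a_assoc M.r_neg1)
  finally show ?thesis using assms cls_eq_iff[of "a \<odot>\<^bsub>M\<^esub> v" "b \<odot>\<^bsub>M\<^esub> w"] by simp
qed

lemma cls_smult:
  assumes "a \<in> carrier R" "v \<in> carrier M"
  shows "(J +> a) \<odot>\<^bsub>Q\<^esub> cls v = cls (a \<odot>\<^bsub>M\<^esub> v)"
proof -
  have "(J +> a) \<odot>\<^bsub>Q\<^esub> cls v = (\<Union>b\<in>J +> a. \<Union>w\<in>cls v. cls (b \<odot>\<^bsub>M\<^esub> w))"
    by (simp add: quot_module_def)
  also have "\<dots> = (\<Union>b\<in>J +> a. \<Union>w\<in>cls v. cls (a \<odot>\<^bsub>M\<^esub> v))"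
  proof (intro SUP_cong refl)
    fix b w assume "b \<in> J +> a" "w \<in> cls v"
    then show "cls (b \<odot>\<^bsub>M\<^esub> w) = cls (a \<odot>\<^bsub>M\<^esub> v)"
      using mem_coset[OF assms(1)] mem_cls[OF assms(2)] assms by (intro smult_cls_cong) auto
  qed
  also have "\<dots> = cls (a \<odot>\<^bsub>M\<^esub> v)"
    using J.a_rcos_self[OF assms(1)] N.a_rcos_self[OF assms(2)] by auto
  finally show ?thesis .
qed

lemma module_Q: "module RJ Q"
proof -
  interpret RJ: cring RJ by (rule J.quotient_is_cring) (rule R.is_cring)
  have hom: "(\<lambda>a. J +> a) \<in> ring_hom R RJ" by (rule J.rcos_ring_hom)
  note rj = ring_hom_add[OF hom, symmetric] ring_hom_mult[OF hom, symmetric] ring_hom_one[OF hom, symmetric]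
  have cases: "\<exists>v\<in>carrier M. C = cls v" if "C \<in> carrier Q" for C using that carrier_Q by auto
  have rcases: "\<exists>a\<in>carrier R. C = J +> a" if "C \<in> carrier RJ" for C using that carrier_RJ by auto
  show ?thesis
  proof (rule moduleI)
    show "cring RJ" ..
    show "abelian_group Q"
    proof (rule abelian_groupI)
      fix C D assume "C \<in> carrier Q" "D \<in> carrier Q"
      then obtain v w where "v \<in> carrier M" "w \<in> carrier M" "C = cls v" "D = cls w" using cases by meson
      then show "C \<oplus>\<^bsub>Q\<^esub> D \<in> carrier Q" "C \<oplus>\<^bsub>Q\<^esub> D = D \<oplus>\<^bsub>Q\<^esub> C"
        by (simp_all add: cls_add cls_closed M.a_comm)
    next
      fix C D E assume "C \<in> carrier Q" "D \<in> carrier Q" "E \<in> carrier Q"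
      then obtain v w x where "v \<in> carrier M" "w \<in> carrier M" "x \<in> carrier M"
        "C = cls v" "D = cls w" "E = cls x" using cases by meson
      then show "C \<oplus>\<^bsub>Q\<^esub> D \<oplus>\<^bsub>Q\<^esub> E = C \<oplus>\<^bsub>Q\<^esub> (D \<oplus>\<^bsub>Q\<^esub> E)"
        by (simp add: cls_add M.a_assoc)
    next
      show "\<zero>\<^bsub>Q\<^esub> \<in> carrier Q" by (simp add: cls_zero cls_closed)
    next
      fix C assume "C \<in> carrier Q"
      then obtain v where v: "v \<in> carrier M" "C = cls v" using cases by meson
      then show "\<zero>\<^bsub>Q\<^esub> \<oplus>\<^bsub>Q\<^esub> C = C" by (simp add: cls_zero cls_add)
      have "cls (\<ominus>\<^bsub>M\<^esub> v) \<oplus>\<^bsub>Q\<^esub> C = \<zero>\<^bsub>Q\<^esub>" using v by (simp add: cls_add cls_zero M.l_neg)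
      then show "\<exists>y\<in>carrier Q. y \<oplus>\<^bsub>Q\<^esub> C = \<zero>\<^bsub>Q\<^esub>" using v cls_closed by blast
    qed
  next
    fix a C assume "a \<in> carrier RJ" "C \<in> carrier Q"
    then obtain b v where "b \<in> carrier R" "v \<in> carrier M" "a = J +> b" "C = cls v"
      using cases rcases by meson
    then show "a \<odot>\<^bsub>Q\<^esub> C \<in> carrier Q" by (simp add: cls_smult cls_closed)
  next
    fix a a' C assume "a \<in> carrier RJ" "a' \<in> carrier RJ" "C \<in> carrier Q"
    then obtain b b' v where "b \<in> carrier R" "b' \<in> carrier R" "v \<in> carrier M"
      "a = J +> b" "a' = J +> b'" "C = cls v" using cases rcases by meson
    then show "(a \<oplus>\<^bsub>RJ\<^esub> a') \<odot>\<^bsub>Q\<^esub> C = a \<odot>\<^bsub>Q\<^esub> C \<oplus>\<^bsub>Q\<^esub> a' \<odot>\<^bsub>Q\<^esub> C"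
       "(a \<otimes>\<^bsub>RJ\<^esub> a') \<odot>\<^bsub>Q\<^esub> C = a \<odot>\<^bsub>Q\<^esub> (a' \<odot>\<^bsub>Q\<^esub> C)"
      by (simp_all add: rj cls_smult cls_add smult_l_distr smult_assoc1)
  next
    fix a C D assume "a \<in> carrier RJ" "C \<in> carrier Q" "D \<in> carrier Q"
    then obtain b v w where "b \<in> carrier R" "v \<in> carrier M" "w \<in> carrier M"
      "a = J +> b" "C = cls v" "D = cls w" using cases rcases by meson
    then show "a \<odot>\<^bsub>Q\<^esub> (C \<oplus>\<^bsub>Q\<^esub> D) = a \<odot>\<^bsub>Q\<^esub> C \<oplus>\<^bsub>Q\<^esub> a \<odot>\<^bsub>Q\<^esub> D"
      by (simp add: cls_smult cls_add smult_r_distr)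
  next
    fix C assume "C \<in> carrier Q"
    then obtain v where "v \<in> carrier M" "C = cls v" using cases by meson
    then show "\<one>\<^bsub>RJ\<^esub> \<odot>\<^bsub>Q\<^esub> C = C" by (simp add: rj(3) cls_smult)
  qed
qed

lemma lincomb_Q:
  assumes "\<And>i. i < n \<Longrightarrow> e i \<in> carrier M" "\<And>i. i < n \<Longrightarrow> x i \<in> carrier R"
  shows "lincomb Q n (\<lambda>i. cls (e i)) (\<lambda>i. J +> x i) = cls (lincomb M n e x)"
  using assms
proof (induction n)
  case 0
  then show ?case by (simp add: module.lincomb_0[OF module_Q] lincomb_0 cls_zero)
next
  case (Suc n)
  have "lincomb Q (Suc n) (\<lambda>i. cls (e i)) (\<lambda>i. J +> x i)
    = lincomb Q n (\<lambda>i. cls (e i)) (\<lambda>i. J +> x i) \<oplus>\<^bsub>Q\<^esub> (J +> x n) \<odot>\<^bsub>Q\<^esub> cls (e n)"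
    using Suc.prems by (intro module.lincomb_Suc[OF module_Q]) (auto simp: cls_closed carrier_RJ)
  then show ?case
    using Suc by (simp add: cls_smult cls_add lincomb_closed lincomb_Suc)
qed

text \<open>
  The submodule \<open>J M\<close> consists of the combinations of the basis with coefficients in \<open>J\<close>; hence
  a relation between the reduced basis vectors has all its coefficients in \<open>J\<close>.
\<close>

lemma N_lincomb:
  assumes basis: "is_basis R M n e" and x: "x \<in> N"
  obtains c where "\<And>i. i < n \<Longrightarrow> c i \<in> J" "x = lincomb M n e c"
proof -
  have e: "e i \<in> carrier M" if "i < n" for i using basis that by (simp add: is_basis_def)
  have gen: "\<exists>c. (\<forall>i<n. c i \<in> J) \<and> a \<odot>\<^bsub>M\<^esub> v = lincomb M n e c"
    if a: "a \<in> J" and v: "v \<in> carrier M" for a v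
  proof -
    obtain c where c: "c \<in> {..<n} \<rightarrow> carrier R" "v = lincomb M n e c"
      using basis v unfolding is_basis_def lincomb_def by blast
    have "a \<odot>\<^bsub>M\<^esub> v = lincomb M n e (\<lambda>i. a \<otimes> c i)"
      unfolding c(2) by (rule lincomb_smult[symmetric]) (use e c J.Icarr[OF a] in auto)
    moreover have "a \<otimes> c i \<in> J" if "i < n" for i
      using c that by (intro J.I_r_closed[OF a]) auto
    ultimately show ?thesis by (intro exI[of _ "\<lambda>i. a \<otimes> c i"]) simp
  qed
  have "\<exists>c. (\<forall>i<n. c i \<in> J) \<and> x = lincomb M n e c"
    using x
  proof (induction rule: N_induct)
    case zero
    show ?case using gen[of \<zero> "\<zero>\<^bsub>M\<^esub>"] by simp
  next
    case (gen a v)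
    then show ?case by fact
  next
    case (neg a v)
    have "\<ominus>\<^bsub>M\<^esub> (a \<odot>\<^bsub>M\<^esub> v) = (\<ominus> a) \<odot>\<^bsub>M\<^esub> v" using neg by (simp add: smult_l_minus)
    then show ?case using gen[of "\<ominus> a" v] neg by simp
  next
    case (add x y)
    then obtain c d where c: "\<forall>i<n. c i \<in> J" "x = lincomb M n e c"
      and d: "\<forall>i<n. d i \<in> J" "y = lincomb M n e d" by blast
    have "x \<oplus>\<^bsub>M\<^esub> y = lincomb M n e (\<lambda>i. c i \<oplus> d i)"
      unfolding c(2) d(2) by (rule lincomb_add[symmetric]) (use e c d in auto)
    then show ?case using c d by (intro exI[of _ "\<lambda>i. c i \<oplus> d i"]) auto
  qed
  then show ?thesis using that by blast
qed

lemma basis_Q: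
  assumes basis: "is_basis R M n e"
  shows "is_basis RJ Q n (\<lambda>i. cls (e i))"
proof -
  have e: "e i \<in> carrier M" if "i < n" for i using basis that by (simp add: is_basis_def)
  have indep: "c i = \<zero>" if "c \<in> {..<n} \<rightarrow> carrier R" "lincomb M n e c = \<zero>\<^bsub>M\<^esub>" "i < n" for c i
    using basis that unfolding is_basis_def lincomb_def by blast
  have lift: "\<exists>x. (\<forall>i<n. x i \<in> carrier R) \<and> lincomb Q n (\<lambda>i. cls (e i)) C = cls (lincomb M n e x) \<and> (\<forall>i<n. C i = J +> x i)"
    if C: "C \<in> {..<n} \<rightarrow> carrier RJ" for C
  proof -
    have "\<exists>y. y \<in> carrier R \<and> C i = J +> y" if "i < n" for i
    proof -
      have "C i \<in> carrier RJ" using C that by auto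
      then show ?thesis unfolding carrier_RJ by blast
    qed
    then obtain x where x: "\<And>i. i < n \<Longrightarrow> x i \<in> carrier R" "\<And>i. i < n \<Longrightarrow> C i = J +> x i"
      by metis
    have "lincomb Q n (\<lambda>i. cls (e i)) C = lincomb Q n (\<lambda>i. cls (e i)) (\<lambda>i. J +> x i)"
      by (rule module.lincomb_cong[OF module_Q]) (use x e cls_closed carrier_RJ in auto)
    then show ?thesis using lincomb_Q[OF e x(1)] x by auto
  qed
  show ?thesis
    unfolding is_basis_def lincomb_def[symmetric]
  proof (intro conjI allI impI ballI)
    fix i assume "i < n"
    then show "cls (e i) \<in> carrier Q" using e cls_closed by blast
  next
    fix V assume "V \<in> carrier Q"
    then obtain v where v: "v \<in> carrier M" "V = cls v" using carrier_Q by auto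
    obtain c where c: "c \<in> {..<n} \<rightarrow> carrier R" "v = lincomb M n e c"
      using basis v(1) unfolding is_basis_def lincomb_def by blast
    have "V = lincomb Q n (\<lambda>i. cls (e i)) (\<lambda>i. J +> c i)"
      unfolding v(2) c(2) by (rule lincomb_Q[symmetric]) (use e c in auto)
    then show "\<exists>c\<in>{..<n} \<rightarrow> carrier RJ. V = lincomb Q n (\<lambda>i. cls (e i)) c"
      using c by (intro bexI[of _ "\<lambda>i. J +> c i"]) (auto simp: carrier_RJ)
  next
    fix C i assume C: "C \<in> {..<n} \<rightarrow> carrier RJ" "lincomb Q n (\<lambda>i. cls (e i)) C = \<zero>\<^bsub>Q\<^esub>" and i: "i < n"
    obtain x where x: "\<And>i. i < n \<Longrightarrow> x i \<in> carrier R" "\<And>i. i < n \<Longrightarrow> C i = J +> x i"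
      "lincomb Q n (\<lambda>i. cls (e i)) C = cls (lincomb M n e x)" using lift[OF C(1)] by blast
    have lx: "lincomb M n e x \<in> carrier M" using e x(1) by (rule lincomb_closed)
    have "cls (lincomb M n e x) = N" using C(2) x(3) by (simp add: quot_module_def)
    then have "lincomb M n e x \<in> N" using N.a_rcos_self[OF lx] by simp
    then obtain c where c: "\<And>i. i < n \<Longrightarrow> c i \<in> J" "lincomb M n e x = lincomb M n e c"
      using N_lincomb[OF basis] by metis
    have "lincomb M n e (\<lambda>i. x i \<ominus> c i) = lincomb M n e x \<ominus>\<^bsub>M\<^esub> lincomb M n e c"
      by (rule lincomb_minus) (use e x c in auto)
    also have "\<dots> = \<zero>\<^bsub>M\<^esub>" unfolding c(2)[symmetric] using lx by (simp add: a_minus_def M.r_neg)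
    finally have z: "lincomb M n e (\<lambda>i. x i \<ominus> c i) = \<zero>\<^bsub>M\<^esub>" .
    have "(\<lambda>i. x i \<ominus> c i) \<in> {..<n} \<rightarrow> carrier R" using x c by auto
    then have "x i \<ominus> c i = \<zero>" using indep z i by blast
    then have "x i = c i" using x(1)[OF i] J.Icarr[OF c(1)[OF i]] by simp
    then have "C i = J" using x(2)[OF i] c(1)[OF i] J.a_rcos_const by simp
    then show "C i = \<zero>\<^bsub>RJ\<^esub>" by (simp add: FactRing_def)
  qed
qed

lemma quot_form_cls:
  assumes h: "hermitian_form R star M h" and star: "\<And>a. a \<in> J \<Longrightarrow> star a \<in> J"
    and v: "v \<in> carrier M" and w: "w \<in> carrier M"
  shows "quot_form R J h (cls v) (cls w) = J +> h v w"
proof -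
  note hc = hermitian_formD(1)[OF h] and hl = hermitian_formD(2,3)[OF h]
    and hs = hermitian_formD(4)[OF h] and hconj = hermitian_formD(5)[OF h]
  have zero: "h z \<zero>\<^bsub>M\<^esub> \<in> J" if "z \<in> carrier M" for z
    using hs[of "\<zero>\<^bsub>M\<^esub>" z \<zero>] that hc[of z "\<zero>\<^bsub>M\<^esub>"] by simp
  have r: "h z n \<in> J" if z: "z \<in> carrier M" and n: "n \<in> N" for z n
    using n
  proof (induction rule: N_induct)
    case (gen a v)
    then show ?case using z J.I_l_closed[of a "h z v"] hc[of z v] hs[of v z a] by simp
  next
    case (neg a v)
    have "\<ominus>\<^bsub>M\<^esub> (a \<odot>\<^bsub>M\<^esub> v) = (\<ominus> a) \<odot>\<^bsub>M\<^esub> v" using neg by (simp add: smult_l_minus)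
    then show ?case using z neg J.I_l_closed[of "\<ominus> a" "h z v"] hc[of z v] hs[of v z "\<ominus> a"] by simp
  next
    case (add x y)
    then show ?case using hl(2)[of x y z] z by simp
  qed (rule zero[OF z])
  have l: "h n z \<in> J" if "z \<in> carrier M" "n \<in> N" for z n
    using r[OF that] star hconj[of z n] that by simp
  have cong: "J +> h x y = J +> h v w" if x: "x \<in> cls v" and y: "y \<in> cls w" for x y
  proof -
    obtain n where n: "n \<in> N" "x = n \<oplus>\<^bsub>M\<^esub> v" using x by (auto simp: a_r_coset_def')
    obtain n' where n': "n' \<in> N" "y = n' \<oplus>\<^bsub>M\<^esub> w" using y by (auto simp: a_r_coset_def')
    have c: "n \<in> carrier M" "n' \<in> carrier M" using n n' by auto
    define a where "a = h n y \<oplus> h v n'"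
    have a: "a \<in> J" unfolding a_def using l[of y n] r[of v n'] n n' v w c by simp
    have "h x y = h n y \<oplus> h v y" unfolding n(2) using hl(1)[of n v y] c v w n'(2) by simp
    also have "h v y = h v n' \<oplus> h v w" unfolding n'(2) using hl(2)[of n' w v] c v w by simp
    finally have "h x y = a \<oplus> h v w" unfolding a_def
      using hc[of n y] hc[of v n'] hc[of v w] c v w n' by (simp add: R.a_assoc)
    then have "h x y \<ominus> h v w = a" using J.Icarr[OF a] hc[OF v w]
      by (simp add: a_minus_def R.a_assoc R.r_neg)
    moreover have "h x y \<in> carrier R" using hc[of x y] n n' c v w by simp
    ultimately show ?thesis using a coset_eq_iff[of "h x y" "h v w"] hc[OF v w] by simp
  qed
  have "quot_form R J h (cls v) (cls w) = (\<Union>x\<in>cls v. \<Union>y\<in>cls w. J +> h v w)"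
    unfolding quot_form_def by (intro SUP_cong refl cong)
  then show ?thesis using N.a_rcos_self v w by auto
qed

lemma hermitian_Q:
  assumes h: "hermitian_form R star M h" and star: "\<And>a. a \<in> J \<Longrightarrow> star a \<in> J"
    and circ: "\<And>a. a \<in> carrier R \<Longrightarrow> circ (J +> a) = J +> star a"
  shows "hermitian_form RJ circ Q (quot_form R J h)"
proof -
  have hom: "(\<lambda>a. J +> a) \<in> ring_hom R RJ" by (rule J.rcos_ring_hom)
  note rj = ring_hom_add[OF hom, symmetric] ring_hom_mult[OF hom, symmetric]
  have cases: "\<exists>v\<in>carrier M. C = cls v" if "C \<in> carrier Q" for C using that carrier_Q by auto
  have rcases: "\<exists>a\<in>carrier R. C = J +> a" if "C \<in> carrier RJ" for C using that carrier_RJ by auto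
  note qf = quot_form_cls[OF h star]
  note hc = hermitian_formD(1)[OF h] and hl = hermitian_formD(2,3)[OF h]
    and hs = hermitian_formD(4)[OF h] and hconj = hermitian_formD(5)[OF h]
  show ?thesis
    unfolding hermitian_form_def
  proof (intro conjI ballI)
    fix C D assume "C \<in> carrier Q" "D \<in> carrier Q"
    then obtain v w where vw: "v \<in> carrier M" "w \<in> carrier M" "C = cls v" "D = cls w" using cases by meson
    then show "quot_form R J h C D \<in> carrier RJ" using hc by (simp add: qf carrier_RJ)
    show "quot_form R J h D C = circ (quot_form R J h C D)"
      using vw hc[of v w] hconj[of v w] by (simp add: qf circ)
  next
    fix C D E assume "C \<in> carrier Q" "D \<in> carrier Q" "E \<in> carrier Q"
    then obtain v w x where "v \<in> carrier M" "w \<in> carrier M" "x \<in> carrier M"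
      "C = cls v" "D = cls w" "E = cls x" using cases by meson
    then show "quot_form R J h (C \<oplus>\<^bsub>Q\<^esub> D) E = quot_form R J h C E \<oplus>\<^bsub>RJ\<^esub> quot_form R J h D E"
      "quot_form R J h E (C \<oplus>\<^bsub>Q\<^esub> D) = quot_form R J h E C \<oplus>\<^bsub>RJ\<^esub> quot_form R J h E D"
      by (simp_all add: cls_add qf rj hc hl)
  next
    fix C D a assume "C \<in> carrier Q" "D \<in> carrier Q" "a \<in> carrier RJ"
    then obtain v w b where "v \<in> carrier M" "w \<in> carrier M" "b \<in> carrier R"
      "C = cls v" "D = cls w" "a = J +> b" using cases rcases by meson
    then show "quot_form R J h C (a \<odot>\<^bsub>Q\<^esub> D) = quot_form R J h C D \<otimes>\<^bsub>RJ\<^esub> a"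
      by (simp add: cls_smult qf rj hc hs)
  qed
qed

end

section \<open>Balls of a discrete valuation\<close>

context nonarch_local_field
begin

abbreviation ball :: "int \<Rightarrow> 'a set" where "ball n \<equiv> val_ball K \<nu> n"

lemma val_nz [simp]: "x \<in> carrier K - {\<zero>} \<Longrightarrow> y \<in> carrier K - {\<zero>} \<Longrightarrow> x \<otimes> y \<in> carrier K - {\<zero>}"
  using integral by auto

lemma val_one: "\<nu> \<one> = 0"
  using val_mult[of \<one> \<one>] one_not_zero by simp

lemma val_neg_one: "\<nu> (\<ominus> \<one>) = 0"
proof -
  have "\<ominus> \<one> \<noteq> \<zero>" using one_not_zero by (metis minus_minus minus_zero one_closed)
  moreover have "\<ominus> \<one> \<otimes> \<ominus> \<one> = \<one>" by (simp add: l_minus)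
  ultimately show ?thesis using val_mult[of "\<ominus> \<one>" "\<ominus> \<one>"] val_one by simp
qed

lemma val_inv:
  assumes x: "x \<in> carrier K" "x \<noteq> \<zero>"
  shows "inv x \<in> carrier K - {\<zero>}" "\<nu> (inv x) = - \<nu> x" "x \<otimes> inv x = \<one>"
proof -
  have u: "x \<in> Units K" using x field_Units by blast
  then show 1: "inv x \<in> carrier K - {\<zero>}" using Units_inv_Units[OF u] field_Units by blast
  show 2: "x \<otimes> inv x = \<one>" using u by simp
  show "\<nu> (inv x) = - \<nu> x" using val_mult[of x "inv x"] 1 2 x val_one by simp
qed

lemma ball_carrier: "x \<in> ball n \<Longrightarrow> x \<in> carrier K"
  by (simp add: val_ball_def)
lemma ball_subset: "ball n \<subseteq> carrier K"
  by (auto simp: val_ball_def)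
lemma ball_zero [simp]: "\<zero> \<in> ball n"
  by (simp add: val_ball_def)
lemma ball_mono: "x \<in> ball n \<Longrightarrow> m \<le> n \<Longrightarrow> x \<in> ball m"
  by (auto simp: val_ball_def)
lemma ball_add: "x \<in> ball n \<Longrightarrow> y \<in> ball n \<Longrightarrow> x \<oplus> y \<in> ball n"
  using val_add[of x y] by (cases "x = \<zero>"; cases "y = \<zero>") (auto simp: val_ball_def)

lemma ball_mult: "x \<in> ball m \<Longrightarrow> y \<in> ball n \<Longrightarrow> x \<otimes> y \<in> ball (m + n)"
  using val_mult[of x y] by (cases "x = \<zero>"; cases "y = \<zero>") (auto simp: val_ball_def)

lemma one_ball [simp]: "\<one> \<in> ball 0"
  by (simp add: val_ball_def val_one)

lemma one_not_ball: "\<one> \<notin> ball 1"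
  by (simp add: val_ball_def val_one)

lemma ball_neg: "x \<in> ball n \<Longrightarrow> \<ominus> x \<in> ball n"
proof -
  assume x: "x \<in> ball n"
  have "\<ominus> \<one> \<in> ball 0" by (simp add: val_ball_def val_neg_one)
  then have "\<ominus> \<one> \<otimes> x \<in> ball n" using ball_mult[of "\<ominus> \<one>" 0 x n] x by simp
  then show ?thesis using ball_carrier[OF x] by (simp add: l_minus)
qed

lemma ball_minus: "x \<in> ball n \<Longrightarrow> y \<in> ball n \<Longrightarrow> x \<ominus> y \<in> ball n"
  by (simp add: a_minus_def ball_add ball_neg)

abbreviation VR where "VR \<equiv> val_ring K \<nu>"

lemma subring_ball: "subring (ball 0) K"
  using ball_mult[of _ 0 _ 0]
  by (intro subringI) (auto simp: ball_subset ball_neg ball_add)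

lemma cring_VR: "cring VR"
  using subring_ball subcringI'[of "ball 0"] subcring_iff[OF ball_subset] by blast

lemma neg_VR:
  assumes x: "x \<in> ball 0"
  shows "\<ominus>\<^bsub>VR\<^esub> x = \<ominus> x"
proof -
  interpret VR: cring VR by (rule cring_VR)
  show ?thesis
    by (rule VR.minus_equality) (use x ball_neg[OF x] ball_carrier[OF x] in \<open>auto simp: l_neg\<close>)
qed

lemma minus_VR: "x \<in> carrier K \<Longrightarrow> y \<in> ball 0 \<Longrightarrow> x \<ominus>\<^bsub>VR\<^esub> y = x \<ominus> y"
  by (simp add: a_minus_def neg_VR)

lemma unit_VR: "x \<in> ball 0 \<Longrightarrow> x \<notin> ball 1 \<Longrightarrow> inv x \<in> ball 0 \<and> x \<otimes> inv x = \<one>"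
proof -
  assume x: "x \<in> ball 0" "x \<notin> ball 1"
  then have nz: "x \<in> carrier K" "x \<noteq> \<zero>" by (auto simp: val_ball_def)
  then have "\<nu> x = 0" using x by (simp add: val_ball_def)
  then show ?thesis using val_inv[OF nz] by (simp add: val_ball_def)
qed

text \<open>
  Let \<open>x\<close> have valuation \<open>1\<close>.  Then \<open>p\<close> divides the product of \<open>x\<close> and \<open>p / x\<close>, but it cannot divide
  \<open>p / x\<close>, whose valuation is smaller; so it divides \<open>x\<close>
  and has valuation at most \<open>1\<close>.
\<close>

lemma prime_val:
  assumes p: "p \<in> ball 0" and prime: "ring_prime\<^bsub>VR\<^esub> p"
  shows "p \<noteq> \<zero>" "\<nu> p = 1"
proof -
  have pr: "p \<noteq> \<zero>" "p \<notin> Units VR"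
    "\<And>a b. \<lbrakk>a \<in> ball 0; b \<in> ball 0; p divides\<^bsub>VR\<^esub> (a \<otimes> b)\<rbrakk> \<Longrightarrow> p divides\<^bsub>VR\<^esub> a \<or> p divides\<^bsub>VR\<^esub> b"
    using prime unfolding ring_prime_def prime_def by auto
  then show "p \<noteq> \<zero>" by simp
  have pK: "p \<in> carrier K - {\<zero>}" using p pr(1) by (simp add: val_ball_def)
  have ge: "1 \<le> \<nu> p"
  proof (rule ccontr)
    assume "\<not> 1 \<le> \<nu> p"
    then have "p \<notin> ball 1" using pK by (simp add: val_ball_def)
    then have u: "inv p \<in> ball 0" "p \<otimes> inv p = \<one>" using unit_VR[OF p] by auto
    then have "inv p \<otimes> p = \<one>" using m_comm[of p "inv p"] pK ball_carrier[OF u(1)] by simp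
    then have "p \<in> Units VR" using u p by (auto simp: Units_def)
    then show False using pr(2) by simp
  qed
  obtain x where x: "x \<in> carrier K - {\<zero>}" "\<nu> x = 1" using val_normalized by blast
  define y where "y = inv x \<otimes> p"
  have y: "y \<in> carrier K - {\<zero>}" "\<nu> y = \<nu> p - 1" "x \<otimes> y = p"
  proof -
    have ix: "inv x \<in> carrier K - {\<zero>}" "\<nu> (inv x) = -1" "x \<otimes> inv x = \<one>" using val_inv[of x] x by auto
    show "y \<in> carrier K - {\<zero>}" unfolding y_def by (rule val_nz[OF ix(1) pK])
    show "\<nu> y = \<nu> p - 1" unfolding y_def using val_mult[OF ix(1) pK] ix(2) by simp
    show "x \<otimes> y = p" unfolding y_def using m_assoc[of x "inv x" p] ix x pK by simp
  qed
  have xy: "x \<in> ball 0" "y \<in> ball 0" using x y ge by (auto simp: val_ball_def)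
  have div: "\<nu> p \<le> \<nu> z" if z: "z \<in> carrier K - {\<zero>}" "p divides\<^bsub>VR\<^esub> z" for z
  proof -
    obtain c where c: "c \<in> ball 0" "z = p \<otimes> c" using z(2) unfolding factor_def by auto
    then have "c \<in> carrier K - {\<zero>}" using z(1) pK by (auto simp: val_ball_def)
    then show ?thesis using val_mult[OF pK, of c] c by (simp add: val_ball_def)
  qed
  have "p divides\<^bsub>VR\<^esub> (x \<otimes> y)"
    unfolding factor_def y(3) using pK by (intro bexI[of _ \<one>]) auto
  then have "p divides\<^bsub>VR\<^esub> x \<or> p divides\<^bsub>VR\<^esub> y" using pr(3) xy by blast
  then have "\<nu> p \<le> \<nu> x \<or> \<nu> p \<le> \<nu> y" using div x(1) y(1) by blast
  then show "\<nu> p = 1" using x(2) y(2) ge by auto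
qed

lemma ideal_ball: "ideal (ball 1) VR"
proof -
  interpret VR: cring VR by (rule cring_VR)
  show ?thesis
  proof (rule idealI)
    show "ring VR" ..
    show "subgroup (ball 1) (add_monoid VR)"
    proof (rule VR.add.subgroupI)
      show "ball 1 \<noteq> {}" using ball_zero[of 1] by blast
      fix a assume a: "a \<in> ball 1"
      then have "\<ominus>\<^bsub>VR\<^esub> a = \<ominus> a" using neg_VR ball_mono[of a 1 0] by simp
      then show "\<ominus>\<^bsub>VR\<^esub> a \<in> ball 1" using a ball_neg by simp
    qed (use ball_mono[of _ 1 0] in \<open>auto simp: ball_add\<close>)
  qed (use ball_mult[of _ 1 _ 0] ball_mult[of _ 0 _ 1] in auto)
qed

lemma residue_coset_eq_iff:
  assumes x: "x \<in> ball 0" and y: "y \<in> ball 0"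
  shows "val_ideal K \<nu> +>\<^bsub>VR\<^esub> x = val_ideal K \<nu> +>\<^bsub>VR\<^esub> y \<longleftrightarrow> x \<ominus> y \<in> ball 1"
proof -
  interpret VR: cring VR by (rule cring_VR)
  show ?thesis using VR.quotient_eq_iff_same_a_r_cos[OF ideal_ball, of x y] x y
    by (simp add: minus_VR ball_carrier)
qed

text \<open>
  If \<open>2\<close> vanished in the residue field, the additive order of \<open>1\<close> there would be an odd divisor of \<open>2\<close>.
\<close>

lemma residue_two_nonzero:
  assumes "odd (ring_char (residue_field K \<nu>))"
  shows "\<one> \<oplus> \<one> \<notin> ball 1"
proof
  assume two: "\<one> \<oplus> \<one> \<in> ball 1"
  interpret I: ideal "ball 1" VR by (rule ideal_ball)
  let ?k = "residue_field K \<nu>" and ?c = "\<lambda>x. ball 1 +>\<^bsub>VR\<^esub> x"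
  interpret k: ring ?k by (rule I.quotient_is_ring)
  have hom: "?c \<in> ring_hom VR ?k" by (rule I.rcos_ring_hom)
  have k0: "\<zero>\<^bsub>?k\<^esub> = ball 1" by (simp add: FactRing_def)
  have k1: "\<one>\<^bsub>?k\<^esub> = ?c \<one>" by (simp add: FactRing_def)
  have "\<one>\<^bsub>?k\<^esub> \<oplus>\<^bsub>?k\<^esub> \<one>\<^bsub>?k\<^esub> = ?c (\<one> \<oplus> \<one>)"
    unfolding k1 using ring_hom_add[OF hom, of \<one> \<one>] by simp
  also have "\<dots> = \<zero>\<^bsub>?k\<^esub>" unfolding k0 using I.a_rcos_const[OF two] by simp
  finally have "\<one>\<^bsub>?k\<^esub> [^]\<^bsub>add_monoid ?k\<^esub> (2::nat) = \<one>\<^bsub>add_monoid ?k\<^esub>"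
    by (simp add: numeral_2_eq_2)
  then have "[(2::nat)] \<cdot>\<^bsub>?k\<^esub> \<one>\<^bsub>?k\<^esub> = \<zero>\<^bsub>?k\<^esub>" by (simp add: add_pow_def)
  then have "ring_char ?k dvd 2"
    unfolding ring_char_def using iffD1[OF k.add.pow_eq_id[OF k.one_closed]] by blast
  then have "ring_char ?k = 1" using assms two_is_prime_nat unfolding prime_nat_iff by auto
  then have "\<one>\<^bsub>?k\<^esub> = \<zero>\<^bsub>?k\<^esub>"
    unfolding ring_char_def using k.add.ord_eq_1[OF k.one_closed] by blast
  then have "?c \<one> = ?c \<zero>" unfolding k0 k1 using I.a_rcos_const[OF ball_zero] by simp
  then have "\<one> \<ominus> \<zero> \<in> ball 1" using residue_coset_eq_iff[of \<one> \<zero>] by simp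
  then show False using one_not_ball by (simp add: a_minus_def)
qed

end

section \<open>Arithmetic of a ramified quadratic extension\<close>

context ramified_quadratic_extension
begin

abbreviation BK where "BK \<equiv> F\<lparr>carrier := K\<rparr>"

lemmas K_props = subringE[OF subfieldE(1)[OF subfield_axioms]]

lemma K_carrier: "x \<in> K \<Longrightarrow> x \<in> carrier F"
  using K_props(1) by blast

lemma base_ball: "val_ball BK \<nu> n = K \<inter> ball (2 * n)"
proof (rule Set.set_eqI)
  fix x
  have "x \<in> K \<and> (x = \<zero> \<or> n \<le> \<nu> x) \<longleftrightarrow> x \<in> K \<and> x \<in> carrier F \<and> (x = \<zero> \<or> 2 * n \<le> \<omega> x)"
    using ramified[of x] K_carrier[of x] by (cases "x = \<zero>") auto
  then show "x \<in> val_ball BK \<nu> n \<longleftrightarrow> x \<in> K \<inter> ball (2 * n)"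
    unfolding val_ball_def by simp
qed

text \<open>
  The extension is ramified, so elements of \<open>K\<close> have even valuation in \<open>F\<close>.
\<close>

lemma K_ball_even: "x \<in> K \<Longrightarrow> x \<in> ball (2 * n - 1) \<Longrightarrow> x \<in> ball (2 * n)"
  using ramified[of x] by (cases "x = \<zero>") (auto simp: val_ball_def)

text \<open>
  The prime \<open>\<rho>\<^sup>2\<close> has valuation \<open>1\<close> in \<open>K\<close>, hence \<open>2\<close> in \<open>F\<close>.
\<close>

lemma rho_val: "\<rho> \<in> carrier F - {\<zero>}" "\<omega> \<rho> = 1"
proof -
  let ?p = "\<rho> \<otimes> \<rho>"
  have sq: "\<rho> [^] (2::nat) = ?p" using rho_closed by (simp add: numeral_2_eq_2)
  have "?p \<noteq> \<zero>" "\<nu> ?p = 1" "?p \<in> K"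
    using base.prime_val[of ?p] rho_square_integral rho_square_prime unfolding sq
    by (auto simp: base_ball)
  then have w: "\<omega> ?p = 2" using ramified[of ?p] by simp
  show 1: "\<rho> \<in> carrier F - {\<zero>}" using \<open>?p \<noteq> \<zero>\<close> rho_closed by auto
  show "\<omega> \<rho> = 1" using val_mult[OF 1 1] w by simp
qed

lemma rho_in_K: "\<rho> \<otimes> \<rho> \<in> K"
  using rho_square_integral rho_closed by (simp add: base_ball numeral_2_eq_2)

lemma rho_pow: "\<rho> [^] n \<in> carrier F - {\<zero>}" "\<omega> (\<rho> [^] n) = int n"
proof (induction n)
  case 0
  { case 1 then show ?case using one_not_zero by simp }
  { case 2 then show ?case by (simp add: val_one) }
next
  case (Suc n)
  { case 1 then show ?case using val_nz[OF Suc.IH(1) rho_val(1)] by simp }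
  { case 2 then show ?case using val_mult[OF Suc.IH(1) rho_val(1)] Suc.IH(2) rho_val(2) by simp }
qed

lemma ball_div:
  assumes z: "z \<in> carrier F - {\<zero>}" and x: "x \<in> ball n"
  shows "inv z \<otimes> x \<in> ball (n - \<omega> z)" "z \<otimes> (inv z \<otimes> x) = x"
proof -
  have i: "inv z \<in> carrier F - {\<zero>}" "\<omega> (inv z) = - \<omega> z" "z \<otimes> inv z = \<one>" using val_inv[of z] z by auto
  then have "inv z \<in> ball (- \<omega> z)" by (simp add: val_ball_def)
  then show "inv z \<otimes> x \<in> ball (n - \<omega> z)" using ball_mult[of "inv z" "- \<omega> z" x n] x by simp
  show "z \<otimes> (inv z \<otimes> x) = x" using m_assoc[of z "inv z" x] i z ball_carrier[OF x] by simp
qed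

lemma rho_pow_ball: "\<rho> [^] n \<in> ball (int n)"
  using rho_pow[of n] by (simp add: val_ball_def)

lemma rho_ball: "\<rho> \<in> ball 1"
  using rho_val by (simp add: val_ball_def)

lemma ball_eq_cgenideal: "ball (int n) = PIdl\<^bsub>VR\<^esub> (\<rho> [^] n)"
proof
  show "ball (int n) \<subseteq> PIdl\<^bsub>VR\<^esub> (\<rho> [^] n)"
  proof
    fix x assume x: "x \<in> ball (int n)"
    have "inv (\<rho> [^] n) \<otimes> x \<in> ball 0" using ball_div(1)[OF rho_pow(1)[of n] x] rho_pow(2)[of n] by simp
    moreover have "x = (inv (\<rho> [^] n) \<otimes> x) \<otimes> \<rho> [^] n"
      using ball_div(2)[OF rho_pow(1)[of n] x] m_comm[of "\<rho> [^] n"] rho_pow(1)[of n] ball_carrier[OF calculation]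
      by simp
    ultimately show "x \<in> PIdl\<^bsub>VR\<^esub> (\<rho> [^] n)" unfolding cgenideal_def by auto
  qed
  show "PIdl\<^bsub>VR\<^esub> (\<rho> [^] n) \<subseteq> ball (int n)"
    unfolding cgenideal_def using ball_mult[of _ 0 _ "int n"] rho_pow_ball[of n] by auto
qed

text \<open>
  The ring of integers of \<open>K\<close>, as a subset of \<open>F\<close>.
\<close>

abbreviation OK where "OK \<equiv> K \<inter> ball 0"

lemma OK_eq: "carrier (val_ring BK \<nu>) = OK"
  by (simp add: base_ball)

lemma integers_decomp:
  assumes "x \<in> ball 0"
  obtains a b where "a \<in> OK" "b \<in> OK" "x = a \<oplus> b \<otimes> \<rho>"
proof -
  have "x \<in> carrier (val_ring F \<omega>)" using assms by simp
  then show ?thesis using that unfolding integers_eq OK_eq by blast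
qed

lemma OK_carrier: "a \<in> OK \<Longrightarrow> a \<in> carrier F"
  using ball_carrier by blast

lemma sigma_closed: "x \<in> ball 0 \<Longrightarrow> \<sigma> x \<in> ball 0"
  using ring_hom_closed[OF sigma_hom] by simp
lemma sigma_add: "x \<in> ball 0 \<Longrightarrow> y \<in> ball 0 \<Longrightarrow> \<sigma> (x \<oplus> y) = \<sigma> x \<oplus> \<sigma> y"
  using ring_hom_add[OF sigma_hom, of x y] by simp
lemma sigma_mult: "x \<in> ball 0 \<Longrightarrow> y \<in> ball 0 \<Longrightarrow> \<sigma> (x \<otimes> y) = \<sigma> x \<otimes> \<sigma> y"
  using ring_hom_mult[OF sigma_hom, of x y] by simp

lemma rho_ball_0: "\<rho> \<in> ball 0"
  using rho_ball ball_mono by simp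

lemma sigma_decomp:
  assumes a: "a \<in> OK" and b: "b \<in> OK"
  shows "\<sigma> (a \<oplus> b \<otimes> \<rho>) = a \<ominus> b \<otimes> \<rho>"
proof -
  have c: "a \<in> ball 0" "b \<in> ball 0" "b \<otimes> \<rho> \<in> ball 0"
    using a b ball_mult[of b 0 \<rho> 0] rho_ball_0 by auto
  have "\<sigma> a = a" "\<sigma> b = b" using sigma_fixes a b unfolding OK_eq by auto
  then have "\<sigma> (a \<oplus> b \<otimes> \<rho>) = a \<oplus> b \<otimes> (\<ominus> \<rho>)"
    using sigma_add[OF c(1,3)] sigma_mult[OF c(2) rho_ball_0] sigma_rho by simp
  then show ?thesis using OK_carrier[OF b] rho_closed by (simp add: a_minus_def r_minus)
qed

lemma sigma_sigma:
  assumes "x \<in> ball 0"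
  shows "\<sigma> (\<sigma> x) = x"
proof -
  obtain a b where ab: "a \<in> OK" "b \<in> OK" "x = a \<oplus> b \<otimes> \<rho>" using integers_decomp[OF assms] .
  have nb: "\<ominus> b \<in> OK" using ab(2) ball_neg K_props(5)[of b] by blast
  have c: "a \<in> carrier F" "b \<in> carrier F" using ab OK_carrier by auto
  have "\<sigma> x = a \<oplus> (\<ominus> b) \<otimes> \<rho>" using sigma_decomp[OF ab(1,2)] ab(3) c rho_closed
    by (simp add: a_minus_def l_minus)
  then have "\<sigma> (\<sigma> x) = a \<ominus> (\<ominus> b) \<otimes> \<rho>" using sigma_decomp[OF ab(1) nb] by simp
  then show ?thesis using ab(3) c rho_closed by (simp add: a_minus_def l_minus)
qed

lemma sigma_rho_pow: "\<sigma> (\<rho> [^] n) \<in> ball (int n)"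
proof (induction n)
  case 0
  have "\<sigma> \<one> = \<one>" using ring_hom_one[OF sigma_hom] by simp
  then show ?case by simp
next
  case (Suc n)
  have "\<sigma> (\<rho> [^] Suc n) = \<sigma> (\<rho> [^] n) \<otimes> (\<ominus> \<rho>)"
    using sigma_mult[of "\<rho> [^] n" \<rho>] rho_ball_0 ball_mono[OF rho_pow_ball[of n], of 0] sigma_rho by simp
  then show ?case using ball_mult[OF Suc ball_neg[OF rho_ball]] by (simp add: add.commute)
qed

lemma sigma_ball:
  assumes x: "x \<in> ball (int n)"
  shows "\<sigma> x \<in> ball (int n)"
proof -
  have y: "inv (\<rho> [^] n) \<otimes> x \<in> ball 0" "\<rho> [^] n \<otimes> (inv (\<rho> [^] n) \<otimes> x) = x"
    using ball_div[OF rho_pow(1)[of n] x] rho_pow(2)[of n] by auto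
  have "\<sigma> x = \<sigma> (\<rho> [^] n) \<otimes> \<sigma> (inv (\<rho> [^] n) \<otimes> x)"
    using sigma_mult[OF ball_mono[OF rho_pow_ball[of n], of 0] y(1)] y(2) by simp
  then show ?thesis using ball_mult[OF sigma_rho_pow sigma_closed[OF y(1)], of n] by simp
qed

lemma sigma_image_ball: "\<sigma> ` ball (int n) = ball (int n)"
proof
  show "\<sigma> ` ball (int n) \<subseteq> ball (int n)" using sigma_ball by blast
  show "ball (int n) \<subseteq> \<sigma> ` ball (int n)"
  proof
    fix x assume x: "x \<in> ball (int n)"
    then have "x = \<sigma> (\<sigma> x)" using sigma_sigma ball_mono[OF x, of 0] by simp
    then show "x \<in> \<sigma> ` ball (int n)" using sigma_ball[OF x] by blast
  qed
qed

abbreviation res_card :: nat where "res_card \<equiv> card (carrier (residue_field BK \<nu>))"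

text \<open>
  Representatives of the ring of integers of \<open>K\<close> modulo the \<open>n\<close>-th power of its maximal ideal; in
  terms of the valuation of \<open>F\<close> that power is the ball of index \<open>2 n\<close>.  The cardinality is part of
  the definition because it is all that the counts need.
\<close>

definition residue_system :: "nat \<Rightarrow> 'a set \<Rightarrow> bool" where
  "residue_system n T \<longleftrightarrow> T \<subseteq> OK \<and> card T = res_card ^ n \<and> finite T \<and>
     (\<forall>x\<in>OK. \<exists>t\<in>T. x \<ominus> t \<in> ball (2 * int n)) \<and>
     (\<forall>s\<in>T. \<forall>t\<in>T. s \<ominus> t \<in> ball (2 * int n) \<longrightarrow> s = t)"

lemma OK_add: "a \<in> OK \<Longrightarrow> b \<in> OK \<Longrightarrow> a \<oplus> b \<in> OK"
  using ball_add K_props(7) by blast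
lemma OK_mult: "a \<in> OK \<Longrightarrow> b \<in> OK \<Longrightarrow> a \<otimes> b \<in> OK"
  using ball_mult[of a 0 b 0] K_props(6) by auto
lemma OK_neg: "a \<in> OK \<Longrightarrow> \<ominus> a \<in> OK"
  using ball_neg K_props(5) by blast
lemma OK_minus: "a \<in> OK \<Longrightarrow> b \<in> OK \<Longrightarrow> a \<ominus> b \<in> OK"
  unfolding a_minus_def using OK_add OK_neg by blast

lemma base_minus: "x \<in> K \<Longrightarrow> y \<in> K \<Longrightarrow> x \<ominus>\<^bsub>BK\<^esub> y = x \<ominus> y"
proof -
  assume x: "x \<in> K" and y: "y \<in> K"
  have "\<ominus>\<^bsub>BK\<^esub> y = \<ominus> y"
    by (rule base.minus_equality) (use y K_props(5) K_carrier in \<open>auto simp: l_neg\<close>)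
  then show ?thesis by (simp add: a_minus_def)
qed

lemma residue_system_1:
  obtains T where "residue_system 1 T"
proof -
  let ?k = "residue_field BK \<nu>" and ?c = "\<lambda>x. val_ideal BK \<nu> +>\<^bsub>val_ring BK \<nu>\<^esub> x"
  have car: "carrier ?k = ?c ` OK"
    by (auto simp: FactRing_def A_RCOSETS_def' base_ball)
  have eq: "?c x = ?c y \<longleftrightarrow> x \<ominus> y \<in> ball 2" if "x \<in> OK" "y \<in> OK" for x y
  proof -
    have "x \<ominus> y \<in> K" using OK_minus[OF that] by simp
    then show ?thesis using base.residue_coset_eq_iff[of x y] that by (simp add: base_ball base_minus)
  qed
  define r where "r C = (SOME x. x \<in> OK \<and> ?c x = C)" for C
  have r: "r C \<in> OK \<and> ?c (r C) = C" if C: "C \<in> carrier ?k" for C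
    unfolding r_def by (rule someI_ex) (use C car in auto)
  have inj: "inj_on r (carrier ?k)" by (rule inj_on_inverseI[where g = ?c]) (use r in blast)
  have "residue_system 1 (r ` carrier ?k)"
    unfolding residue_system_def
  proof (intro conjI ballI impI)
    show "r ` carrier ?k \<subseteq> OK" using r by auto
    show "card (r ` carrier ?k) = res_card ^ 1" using card_image[OF inj] by simp
    show "finite (r ` carrier ?k)" using base.residue_finite by simp
  next
    fix x assume x: "x \<in> OK"
    then have C: "?c x \<in> carrier ?k" unfolding car by blast
    then have "x \<ominus> r (?c x) \<in> ball (2 * int 1)" using r[OF C] eq[OF x, of "r (?c x)"] by simp
    then show "\<exists>t\<in>r ` carrier ?k. x \<ominus> t \<in> ball (2 * int 1)" using C by blast
  next
    fix s t assume "s \<in> r ` carrier ?k" "t \<in> r ` carrier ?k" and d: "s \<ominus> t \<in> ball (2 * int 1)"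
    then obtain C D where C: "C \<in> carrier ?k" "s = r C" and D: "D \<in> carrier ?k" "t = r D" by blast
    have "?c s = ?c t" using eq[of s t] r[OF C(1)] r[OF D(1)] C D d by simp
    then show "s = t" using r[OF C(1)] r[OF D(1)] C D by simp
  qed
  then show ?thesis by (rule that)
qed

abbreviation pp :: "nat \<Rightarrow> 'a" where "pp n \<equiv> (\<rho> \<otimes> \<rho>) [^] n"

lemma pp: "pp n \<in> K" "pp n \<in> carrier F - {\<zero>}" "\<omega> (pp n) = 2 * int n" "pp n \<in> ball (2 * int n)"
proof -
  have "pp n = \<rho> [^] n \<otimes> \<rho> [^] n" using rho_closed by (simp add: pow_mult_distrib m_comm)
  then show 1: "pp n \<in> carrier F - {\<zero>}" "\<omega> (pp n) = 2 * int n"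
    using val_nz[OF rho_pow(1) rho_pow(1)] val_mult[OF rho_pow(1)[of n] rho_pow(1)[of n]] rho_pow(2) by auto
  show "pp n \<in> ball (2 * int n)" using 1 by (simp add: val_ball_def)
  show "pp n \<in> K"
    by (induction n) (use rho_in_K K_props(3,6) in auto)
qed

lemma pp_div:
  assumes x: "x \<in> K" "x \<in> ball (2 * int n)"
  obtains y where "y \<in> OK" "x = pp n \<otimes> y"
proof
  have "inv (pp n) \<in> K" using subfield_m_inv(1)[OF subfield_axioms] pp(1,2)[of n] by simp
  then show "inv (pp n) \<otimes> x \<in> OK"
    using ball_div(1)[OF pp(2)[of n] x(2)] pp(3)[of n] x(1) K_props(6) by simp
  show "x = pp n \<otimes> (inv (pp n) \<otimes> x)" using ball_div(2)[OF pp(2)[of n] x(2)] by simp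
qed

lemma pp_cancel:
  assumes "y \<in> carrier F" "pp n \<otimes> y \<in> ball (m + 2 * int n)"
  shows "y \<in> ball m"
proof (cases "y = \<zero>")
  case False
  then show ?thesis using assms val_mult[OF pp(2)[of n], of y] pp(2)[of n] pp(3)[of n] val_nz[OF pp(2)[of n], of y]
    by (auto simp: val_ball_def)
qed simp

text \<open>
  Expansion in digits: if \<open>t\<close> represents modulo \<open>\<pi>\<^sup>n\<close> and \<open>s\<close> modulo \<open>\<pi>\<close>, then \<open>t + \<pi>\<^sup>n s\<close> represents modulo
  \<open>\<pi>\<^sup>n\<^sup>+\<^sup>1\<close>, where \<open>\<pi> = \<rho>\<^sup>2\<close>.
\<close>

lemma residue_system_exists: "\<exists>T. residue_system n T"
proof (induction n)
  case 0
  have "residue_system 0 {\<zero>}"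
    unfolding residue_system_def using K_props(2) ball_carrier by (auto simp: a_minus_def)
  then show ?case ..
next
  case (Suc n)
  obtain T where T: "residue_system n T" using Suc by blast
  obtain S where S: "residue_system 1 S" by (rule residue_system_1)
  let ?g = "\<lambda>(t, s). t \<oplus> pp n \<otimes> s"
  have TO: "t \<in> OK" if "t \<in> T" for t using T that unfolding residue_system_def by blast
  have SO: "s \<in> OK" if "s \<in> S" for s using S that unfolding residue_system_def by blast
  have pO: "pp n \<in> OK" using pp(1,4)[of n] ball_mono[of "pp n" "2 * int n" 0] by simp
  have pc: "pp n \<in> carrier F" using pp(2) by blast
  \<comment> \<open>Reduction modulo \<open>\<pi>\<^sup>n\<close> identifies \<open>t\<close> and \<open>t'\<close>, and then \<open>\<pi>\<^sup>n\<close> can be cancelled.\<close>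
  have key: "t = t' \<and> s = s'"
    if t: "t \<in> T" "t' \<in> T" and s: "s \<in> S" "s' \<in> S"
      and d: "(t \<oplus> pp n \<otimes> s) \<ominus> (t' \<oplus> pp n \<otimes> s') \<in> ball (2 * int (Suc n))" for t t' s s'
  proof -
    have c: "t \<in> carrier F" "t' \<in> carrier F" "s \<in> carrier F" "s' \<in> carrier F"
      using t s TO SO OK_carrier by blast+
    have 1: "(t \<oplus> pp n \<otimes> s) \<ominus> (t' \<oplus> pp n \<otimes> s') = (t \<ominus> t') \<oplus> pp n \<otimes> (s \<ominus> s')"
      using c pc by algebra
    have "s \<ominus> s' \<in> ball 0" using OK_minus[OF SO SO, OF s] by simp
    then have p2: "pp n \<otimes> (s \<ominus> s') \<in> ball (2 * int n)" using ball_mult[OF pp(4)[of n], of "s \<ominus> s'" 0] by simp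
    have "((t \<ominus> t') \<oplus> pp n \<otimes> (s \<ominus> s')) \<ominus> pp n \<otimes> (s \<ominus> s') \<in> ball (2 * int n)"
      using ball_minus[OF ball_mono[OF d[unfolded 1], of "2 * int n"] p2] by simp
    moreover have "((t \<ominus> t') \<oplus> pp n \<otimes> (s \<ominus> s')) \<ominus> pp n \<otimes> (s \<ominus> s') = t \<ominus> t'"
      using c pc by (simp add: a_minus_def a_assoc r_neg)
    ultimately have tt: "t = t'" using T t unfolding residue_system_def by simp
    have "(t' \<ominus> t') \<oplus> pp n \<otimes> (s \<ominus> s') = pp n \<otimes> (s \<ominus> s')"
      using c pc by (simp add: a_minus_def r_neg)
    then have "pp n \<otimes> (s \<ominus> s') \<in> ball (2 * int (Suc n))" using d[unfolded 1, unfolded tt] by metis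
    then have "pp n \<otimes> (s \<ominus> s') \<in> ball (2 + 2 * int n)" by simp
    then have "s \<ominus> s' \<in> ball 2" using pp_cancel[of "s \<ominus> s'" n 2] c by simp
    then have "s = s'" using S s unfolding residue_system_def by simp
    with tt show ?thesis by simp
  qed
  have zero: "x \<ominus> x \<in> ball j" if "x \<in> carrier F" for x j using that by (simp add: a_minus_def r_neg)
  have gc: "t \<oplus> pp n \<otimes> s \<in> OK" if "t \<in> T" "s \<in> S" for t s
    using that TO SO pO OK_add OK_mult by blast
  have inj: "inj_on ?g (T \<times> S)"
  proof (rule inj_onI, clarify)
    fix t s t' s' assume ts: "t \<in> T" "s \<in> S" "t' \<in> T" "s' \<in> S" and e: "t \<oplus> pp n \<otimes> s = t' \<oplus> pp n \<otimes> s'"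
    have "(t \<oplus> pp n \<otimes> s) \<ominus> (t' \<oplus> pp n \<otimes> s') \<in> ball (2 * int (Suc n))"
      unfolding e by (rule zero) (use gc[OF ts(3,4)] OK_carrier in blast)
    then show "t = t' \<and> s = s'" using key ts by blast
  qed
  have "residue_system (Suc n) (?g ` (T \<times> S))"
    unfolding residue_system_def
  proof (intro conjI ballI impI)
    show "?g ` (T \<times> S) \<subseteq> OK" using gc by auto
    show "card (?g ` (T \<times> S)) = res_card ^ Suc n"
      using card_image[OF inj] T S by (simp add: card_cartesian_product residue_system_def)
    show "finite (?g ` (T \<times> S))" using T S by (simp add: residue_system_def)
  next
    fix x assume x: "x \<in> OK"
    then obtain t where t: "t \<in> T" "x \<ominus> t \<in> ball (2 * int n)" using T unfolding residue_system_def by blast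
    have "x \<ominus> t \<in> K" using OK_minus[OF x TO[OF t(1)]] by simp
    then obtain y where y: "y \<in> OK" "x \<ominus> t = pp n \<otimes> y" using t(2) by (rule pp_div)
    obtain s where s: "s \<in> S" "y \<ominus> s \<in> ball (2 * int 1)" using S y(1) unfolding residue_system_def by blast
    have c: "x \<in> carrier F" "t \<in> carrier F" "s \<in> carrier F" "y \<in> carrier F"
      using x y t s TO SO OK_carrier by blast+
    have "x \<ominus> (t \<oplus> pp n \<otimes> s) = (x \<ominus> t) \<ominus> pp n \<otimes> s" using c pc by algebra
    also have "\<dots> = pp n \<otimes> (y \<ominus> s)" unfolding y(2) using c pc by algebra
    finally have "x \<ominus> (t \<oplus> pp n \<otimes> s) \<in> ball (2 * int (Suc n))"
      using ball_mult[OF pp(4)[of n] s(2)] by (simp add: add.commute)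
    moreover have "t \<oplus> pp n \<otimes> s \<in> ?g ` (T \<times> S)" using t(1) s(1) by force
    ultimately show "\<exists>t\<in>?g ` (T \<times> S). x \<ominus> t \<in> ball (2 * int (Suc n))" by blast
  next
    fix x y assume xy: "x \<in> ?g ` (T \<times> S)" "y \<in> ?g ` (T \<times> S)" "x \<ominus> y \<in> ball (2 * int (Suc n))"
    then obtain t s t' s' where "t \<in> T" "s \<in> S" "x = t \<oplus> pp n \<otimes> s" "t' \<in> T" "s' \<in> S" "y = t' \<oplus> pp n \<otimes> s'"
      by auto
    then show "x = y" using key[of t t' s s'] xy(3) by simp
  qed
  then show ?case ..
qed

end

section \<open>Finite quotients of the ring of integers\<close>

text \<open>
  The structure of \<open>B\<close> is determined by a surjection \<open>\<psi>\<close> from the ring of integers of \<open>F\<close> that is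
  compatible with the involutions and has the ball of index \<open>l\<close> as its kernel.  Stating this
  separately keeps the computation independent of the way in which the quotient is built.
\<close>

locale integral_quotient =
  ramified_quadratic_extension F \<omega> K \<nu> \<rho> \<sigma> + B: cring B
  for F :: "('a, 'c) ring_scheme" (structure) and \<omega> K \<nu> \<rho> \<sigma>
    and B :: "('b, 'd) ring_scheme" +
  fixes \<psi> :: "'a \<Rightarrow> 'b" and circ :: "'b \<Rightarrow> 'b" and l :: nat
  assumes psi_hom: "\<psi> \<in> ring_hom (val_ring F \<omega>) B"
    and psi_surj: "\<psi> ` val_ball F \<omega> 0 = carrier B"
    and psi_ker: "x \<in> val_ball F \<omega> 0 \<Longrightarrow> \<psi> x = \<zero>\<^bsub>B\<^esub> \<longleftrightarrow> x \<in> val_ball F \<omega> (int l)"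
    and circ_psi: "x \<in> val_ball F \<omega> 0 \<Longrightarrow> circ (\<psi> x) = \<psi> (\<sigma> x)"
    and length_pos: "1 \<le> l"
    and odd_residue_char: "odd (ring_char (residue_field (F\<lparr>carrier := K\<rparr>) \<nu>))"
begin

lemma psi_closed: "x \<in> ball 0 \<Longrightarrow> \<psi> x \<in> carrier B"
  using ring_hom_closed[OF psi_hom] by simp
lemma psi_add: "x \<in> ball 0 \<Longrightarrow> y \<in> ball 0 \<Longrightarrow> \<psi> (x \<oplus> y) = \<psi> x \<oplus>\<^bsub>B\<^esub> \<psi> y"
  using ring_hom_add[OF psi_hom, of x y] by simp
lemma psi_mult: "x \<in> ball 0 \<Longrightarrow> y \<in> ball 0 \<Longrightarrow> \<psi> (x \<otimes> y) = \<psi> x \<otimes>\<^bsub>B\<^esub> \<psi> y"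
  using ring_hom_mult[OF psi_hom, of x y] by simp
lemma psi_one: "\<psi> \<one> = \<one>\<^bsub>B\<^esub>"
  using ring_hom_one[OF psi_hom] by simp

lemma psi_neg:
  assumes x: "x \<in> ball 0"
  shows "\<psi> (\<ominus> x) = \<ominus>\<^bsub>B\<^esub> \<psi> x"
proof (rule B.minus_equality[symmetric])
  have "\<psi> (\<ominus> x) \<oplus>\<^bsub>B\<^esub> \<psi> x = \<psi> (\<ominus> x \<oplus> x)" using psi_add[OF ball_neg[OF x] x] by simp
  also have "\<ominus> x \<oplus> x = \<zero>" using ball_carrier[OF x] by (simp add: l_neg)
  also have "\<psi> \<zero> = \<zero>\<^bsub>B\<^esub>" using psi_ker[of \<zero>] by simp
  finally show "\<psi> (\<ominus> x) \<oplus>\<^bsub>B\<^esub> \<psi> x = \<zero>\<^bsub>B\<^esub>" .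
qed (use x ball_neg[OF x] psi_closed in auto)

lemma psi_minus: "x \<in> ball 0 \<Longrightarrow> y \<in> ball 0 \<Longrightarrow> \<psi> (x \<ominus> y) = \<psi> x \<ominus>\<^bsub>B\<^esub> \<psi> y"
  by (simp add: a_minus_def psi_add psi_neg ball_neg)

lemma psi_eq_iff:
  assumes x: "x \<in> ball 0" and y: "y \<in> ball 0"
  shows "\<psi> x = \<psi> y \<longleftrightarrow> x \<ominus> y \<in> ball (int l)"
  using psi_ker[OF ball_minus[OF x y]] psi_minus[OF x y] B.r_right_minus_eq[of "\<psi> x" "\<psi> y"]
    psi_closed[OF x] psi_closed[OF y] by simp

lemma psi_cases:
  assumes "y \<in> carrier B"
  obtains x where "x \<in> ball 0" "y = \<psi> x"
  using assms psi_surj by blast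

abbreviation \<mm> where "\<mm> \<equiv> \<psi> ` ball 1"

lemma psi_mem_iff:
  assumes x: "x \<in> ball 0"
  shows "\<psi> x \<in> \<mm> \<longleftrightarrow> x \<in> ball 1"
proof
  assume "\<psi> x \<in> \<mm>"
  then obtain p where p: "p \<in> ball 1" "\<psi> x = \<psi> p" by blast
  have p0: "p \<in> ball 0" using ball_mono[OF p(1)] by simp
  have "x \<ominus> p \<in> ball 1" using psi_eq_iff[OF x p0] p(2) ball_mono[of _ "int l" 1] length_pos by simp
  then have "(x \<ominus> p) \<oplus> p \<in> ball 1" using ball_add p by blast
  then show "x \<in> ball 1" using ball_carrier[OF x] ball_carrier[OF p0] by (simp add: a_minus_def a_assoc l_neg)
qed auto

lemma psi_unit:
  assumes x: "x \<in> ball 0" "x \<notin> ball 1"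
  shows "\<psi> x \<in> Units B"
proof -
  have i: "inv x \<in> ball 0" "x \<otimes> inv x = \<one>" using unit_VR[OF x] by auto
  have "\<psi> x \<otimes>\<^bsub>B\<^esub> \<psi> (inv x) = \<one>\<^bsub>B\<^esub>" using psi_mult[OF x(1) i(1)] i(2) psi_one by simp
  then show ?thesis using B.unit_factor[of "\<psi> x" "\<psi> (inv x)"] psi_closed x i by simp
qed

lemma two_not_ball: "\<one> \<oplus> \<one> \<notin> ball 1"
proof
  assume 1: "\<one> \<oplus> \<one> \<in> ball 1"
  have K: "\<one> \<oplus> \<one> \<in> K" using K_props(3,7) by blast
  have "\<one> \<oplus> \<one> \<in> ball 2" using K_ball_even[OF K, of 1] 1 by simp
  then show False using base.residue_two_nonzero[OF odd_residue_char] K by (simp add: base_ball)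
qed

text \<open>
  Balls are stable under \<open>\<sigma>\<close>, so with \<open>a + b \<rho>\<close> they contain \<open>2 a\<close>, and \<open>2\<close> is invertible.
\<close>

lemma split_ball:
  assumes a: "a \<in> OK" and b: "b \<in> OK" and x: "a \<oplus> b \<otimes> \<rho> \<in> ball (int n)"
  shows "a \<in> ball (int n)" "b \<in> ball (int n - 1)"
proof -
  have c: "a \<in> carrier F" "b \<in> carrier F" "b \<otimes> \<rho> \<in> carrier F" using OK_carrier a b rho_closed by auto
  have "\<sigma> (a \<oplus> b \<otimes> \<rho>) \<in> ball (int n)" by (rule sigma_ball[OF x])
  then have "(a \<oplus> b \<otimes> \<rho>) \<oplus> (a \<ominus> b \<otimes> \<rho>) \<in> ball (int n)"
    using ball_add[OF x] by (simp add: sigma_decomp[OF a b])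
  also have "(a \<oplus> b \<otimes> \<rho>) \<oplus> (a \<ominus> b \<otimes> \<rho>) = (\<one> \<oplus> \<one>) \<otimes> a" using c rho_closed by algebra
  finally have 2: "(\<one> \<oplus> \<one>) \<otimes> a \<in> ball (int n)" .
  have two0: "\<one> \<oplus> \<one> \<in> ball 0" using ball_add[OF one_ball one_ball] .
  have i: "inv (\<one> \<oplus> \<one>) \<in> ball 0" "(\<one> \<oplus> \<one>) \<otimes> inv (\<one> \<oplus> \<one>) = \<one>"
    using unit_VR[OF two0 two_not_ball] by auto
  have "inv (\<one> \<oplus> \<one>) \<otimes> ((\<one> \<oplus> \<one>) \<otimes> a) \<in> ball (int n)" using ball_mult[OF i(1) 2] by simp
  also have "inv (\<one> \<oplus> \<one>) \<otimes> ((\<one> \<oplus> \<one>) \<otimes> a) = ((\<one> \<oplus> \<one>) \<otimes> inv (\<one> \<oplus> \<one>)) \<otimes> a"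
    using c ball_carrier[OF i(1)] ball_carrier[OF two0] by (simp add: m_ac)
  also have "\<dots> = a" unfolding i(2) using c by simp
  finally show an: "a \<in> ball (int n)" .
  have "(a \<oplus> b \<otimes> \<rho>) \<ominus> a \<in> ball (int n)" by (rule ball_minus[OF x an])
  also have "(a \<oplus> b \<otimes> \<rho>) \<ominus> a = b \<otimes> \<rho>" using c by (simp add: a_minus_def a_comm[of a] a_assoc r_neg)
  finally have "inv \<rho> \<otimes> (b \<otimes> \<rho>) \<in> ball (int n - 1)" using ball_div(1)[OF rho_val(1)] rho_val(2) by simp
  also have "inv \<rho> \<otimes> (b \<otimes> \<rho>) = (\<rho> \<otimes> inv \<rho>) \<otimes> b"
    using val_inv(1)[of \<rho>] rho_val(1) c by (simp add: m_ac)
  also have "\<dots> = b" using val_inv(3)[of \<rho>] rho_val(1) c by simp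
  finally show "b \<in> ball (int n - 1)" .
qed

lemma decomp_minus:
  assumes "a \<in> OK" "b \<in> OK" "a' \<in> OK" "b' \<in> OK"
  shows "(a \<oplus> b \<otimes> \<rho>) \<ominus> (a' \<oplus> b' \<otimes> \<rho>) = (a \<ominus> a') \<oplus> (b \<ominus> b') \<otimes> \<rho>"
  using OK_carrier[OF assms(1)] OK_carrier[OF assms(2)] OK_carrier[OF assms(3)] OK_carrier[OF assms(4)]
    rho_closed by algebra

lemma decomp_closed: "a \<in> OK \<Longrightarrow> b \<in> OK \<Longrightarrow> a \<oplus> b \<otimes> \<rho> \<in> ball 0"
  using ball_add[of a 0 "b \<otimes> \<rho>"] ball_mult[of b 0 \<rho> 0] rho_ball_0 by simp

context
  fixes f :: nat
  assumes half_length: "if even l then l = 2 * f else l = 2 * f - 1"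
begin

lemma f_bounds: "int l \<le> 2 * int f" "2 * int f - 1 \<le> int l" "f \<le> l" "1 \<le> f"
    "int l \<le> 2 * int (l - f) + 1" "2 * int (l - f) - 1 \<le> int l - 1"
  using half_length length_pos by (auto split: if_splits elim!: oddE evenE)

text \<open>
  An element \<open>a + b \<rho>\<close> lies in the kernel iff \<open>a\<close> has valuation at least \<open>l\<close> and \<open>b\<close> at least \<open>l - 1\<close>.  Since
  the valuations of elements of \<open>K\<close> are even, this means that \<open>\<pi>\<^sup>f\<close> divides \<open>a\<close> and
  \<open>\<pi>\<^sup>l\<^sup>-\<^sup>f\<close> divides \<open>b\<close>.
\<close>

lemma coordinates:
  assumes T: "residue_system f T" and S: "residue_system (l - f) S"
  shows "bij_betw (\<lambda>(a, b). \<psi> (a \<oplus> b \<otimes> \<rho>)) (T \<times> S) (carrier B)"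
proof (rule bij_betw_imageI)
  have TO: "t \<in> OK" if "t \<in> T" for t using T that unfolding residue_system_def by blast
  have SO: "s \<in> OK" if "s \<in> S" for s using S that unfolding residue_system_def by blast
  show "inj_on (\<lambda>(a, b). \<psi> (a \<oplus> b \<otimes> \<rho>)) (T \<times> S)"
  proof (rule inj_onI, clarify)
    fix a b a' b' assume ab: "a \<in> T" "b \<in> S" "a' \<in> T" "b' \<in> S"
      and eq: "\<psi> (a \<oplus> b \<otimes> \<rho>) = \<psi> (a' \<oplus> b' \<otimes> \<rho>)"
    have O: "a \<in> OK" "b \<in> OK" "a' \<in> OK" "b' \<in> OK" using ab TO SO by blast+
    have d: "a \<ominus> a' \<in> OK" "b \<ominus> b' \<in> OK" using O OK_minus by blast+
    have "(a \<ominus> a') \<oplus> (b \<ominus> b') \<otimes> \<rho> \<in> ball (int l)"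
      using eq psi_eq_iff[OF decomp_closed[OF O(1,2)] decomp_closed[OF O(3,4)]]
      unfolding decomp_minus[OF O] by blast
    note sp = split_ball[OF d this]
    have "a \<ominus> a' \<in> ball (2 * int f)"
      using K_ball_even[of "a \<ominus> a'" "int f"] ball_mono[OF sp(1) f_bounds(2)] d(1) by blast
    then have "a = a'" using T ab unfolding residue_system_def by blast
    moreover have "b \<ominus> b' \<in> ball (2 * int (l - f))"
      using K_ball_even[of "b \<ominus> b'" "int (l - f)"] ball_mono[OF sp(2) f_bounds(6)] d(2) by blast
    then have "b = b'" using S ab unfolding residue_system_def by blast
    ultimately show "a = a' \<and> b = b'" by blast
  qed
  show "(\<lambda>(a, b). \<psi> (a \<oplus> b \<otimes> \<rho>)) ` (T \<times> S) = carrier B"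
  proof (intro Set.equalityI subsetI)
    fix y assume "y \<in> (\<lambda>(a, b). \<psi> (a \<oplus> b \<otimes> \<rho>)) ` (T \<times> S)"
    then show "y \<in> carrier B" using psi_closed[OF decomp_closed] TO SO by auto
  next
    fix y assume "y \<in> carrier B"
    then obtain x where x: "x \<in> ball 0" "y = \<psi> x" by (rule psi_cases)
    obtain a b where ab: "a \<in> OK" "b \<in> OK" "x = a \<oplus> b \<otimes> \<rho>" using integers_decomp[OF x(1)] .
    obtain t where t: "t \<in> T" "a \<ominus> t \<in> ball (2 * int f)" using T ab(1) unfolding residue_system_def by blast
    obtain s where s: "s \<in> S" "b \<ominus> s \<in> ball (2 * int (l - f))" using S ab(2) unfolding residue_system_def by blast
    have "(b \<ominus> s) \<otimes> \<rho> \<in> ball (int l)"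
      using ball_mono[OF ball_mult[OF s(2) rho_ball] f_bounds(5)] .
    then have "(a \<ominus> t) \<oplus> (b \<ominus> s) \<otimes> \<rho> \<in> ball (int l)"
      using ball_add[OF ball_mono[OF t(2) f_bounds(1)]] by blast
    then have "x \<ominus> (t \<oplus> s \<otimes> \<rho>) \<in> ball (int l)"
      unfolding ab(3) decomp_minus[OF ab(1,2) TO[OF t(1)] SO[OF s(1)]] .
    then have "y = \<psi> (t \<oplus> s \<otimes> \<rho>)"
      using psi_eq_iff[OF x(1) decomp_closed[OF TO[OF t(1)] SO[OF s(1)]]] x(2) by blast
    then show "y \<in> (\<lambda>(a, b). \<psi> (a \<oplus> b \<otimes> \<rho>)) ` (T \<times> S)" using t(1) s(1) by force
  qed
qed

lemma res_card_pos: "0 < res_card"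
proof -
  obtain T where T: "residue_system 1 T" by (rule residue_system_1)
  have "\<zero> \<in> OK" using K_props(2) by simp
  then have "T \<noteq> {}" using T unfolding residue_system_def by blast
  then have "card T \<noteq> 0" using T unfolding residue_system_def by (metis card_0_eq)
  moreover have "card T = res_card ^ 1" using T unfolding residue_system_def by blast
  ultimately show ?thesis unfolding power_one_right by linarith
qed

lemma card_B: "finite (carrier B)" "card (carrier B) = res_card ^ l"
proof -
  obtain T S where TS: "residue_system f T" "residue_system (l - f) S" using residue_system_exists by blast
  have "card (carrier B) = card (T \<times> S)" using bij_betw_same_card[OF coordinates[OF TS]] by simp
  also have "\<dots> = res_card ^ (f + (l - f))"
    using TS by (simp add: card_cartesian_product residue_system_def power_add)
  finally show "card (carrier B) = res_card ^ l" using f_bounds(3) by simp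
  then show "finite (carrier B)" using res_card_pos by (simp add: card_ge_0_finite)
qed

text \<open>
  An integral element outside the maximal ideal has an integral inverse, which makes \<open>B\<close> local;
  \<open>\<sigma> x - x\<close> is a multiple of \<open>\<rho>\<close>, so the involution is trivial modulo \<open>\<mm>\<close>.
\<close>

lemma local_involution_ring_B: "local_involution_ring B circ \<mm>"
proof -
  have mem: "\<mm> \<subseteq> carrier B" using psi_closed ball_mono[of _ 1 0] by auto
  have unit: "y \<in> Units B" if y: "y \<in> carrier B" "y \<notin> \<mm>" for y
  proof -
    obtain x where x: "x \<in> ball 0" "y = \<psi> x" using psi_cases[OF y(1)] .
    then show ?thesis using y(2) psi_unit[of x] by blast
  qed
  have id: "ideal \<mm> B"
  proof (rule idealI)
    show "ring B" ..
    show "subgroup \<mm> (add_monoid B)"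
    proof (rule B.add.subgroupI)
      show "\<mm> \<noteq> {}" using ball_zero[of 1] by blast
      fix a assume "a \<in> \<mm>"
      then obtain x where x: "x \<in> ball 1" "a = \<psi> x" by blast
      have "\<ominus>\<^bsub>B\<^esub> a = \<psi> (\<ominus> x)" using x psi_neg[of x] ball_mono[of x 1 0] by simp
      then show "\<ominus>\<^bsub>B\<^esub> a \<in> \<mm>" using ball_neg[OF x(1)] by blast
      fix b assume "b \<in> \<mm>"
      then obtain y where y: "y \<in> ball 1" "b = \<psi> y" by blast
      have "a \<oplus>\<^bsub>B\<^esub> b = \<psi> (x \<oplus> y)"
        using x y psi_add[of x y] ball_mono[of x 1 0] ball_mono[of y 1 0] by simp
      then show "a \<oplus>\<^bsub>B\<^esub> b \<in> \<mm>" using ball_add[OF x(1) y(1)] by blast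
    qed (use mem in simp)
  next
    fix a x assume "a \<in> \<mm>" "x \<in> carrier B"
    then obtain b y where b: "b \<in> ball 1" "a = \<psi> b" and y: "y \<in> ball 0" "x = \<psi> y" using psi_cases by blast
    have b0: "b \<in> ball 0" using ball_mono[OF b(1)] by simp
    have "x \<otimes>\<^bsub>B\<^esub> a = \<psi> (y \<otimes> b)" using psi_mult[OF y(1) b0] b y by simp
    then show 1: "x \<otimes>\<^bsub>B\<^esub> a \<in> \<mm>" using ball_mult[OF y(1) b(1)] by auto
    have "a \<otimes>\<^bsub>B\<^esub> x = x \<otimes>\<^bsub>B\<^esub> a"
      using B.m_comm[of a x] psi_closed[OF b0] psi_closed[OF y(1)] b(2) y(2) by simp
    then show "a \<otimes>\<^bsub>B\<^esub> x \<in> \<mm>" using 1 by simp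
  qed
  have one: "\<one>\<^bsub>B\<^esub> \<notin> \<mm>" using psi_mem_iff[OF one_ball] one_not_ball psi_one by simp
  have max: "maximalideal \<mm> B"
  proof (rule maximalidealI[OF id])
    show "carrier B \<noteq> \<mm>" using one B.one_closed by blast
    fix J assume J: "ideal J B" "\<mm> \<subseteq> J" "J \<subseteq> carrier B"
    interpret J: ideal J B by (rule J(1))
    show "J = \<mm> \<or> J = carrier B"
    proof (cases "J \<subseteq> \<mm>")
      case False
      then obtain y where y: "y \<in> J" "y \<notin> \<mm>" by blast
      have yc: "y \<in> carrier B" using y(1) J(3) by blast
      have u: "y \<in> Units B" by (rule unit[OF yc y(2)])
      have "inv\<^bsub>B\<^esub> y \<otimes>\<^bsub>B\<^esub> y \<in> J" using J.I_l_closed[OF y(1)] u by blast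
      then have "\<one>\<^bsub>B\<^esub> \<in> J" using u by simp
      then show ?thesis using J.one_imp_carrier by blast
    qed (use J(2) in blast)
  qed
  show ?thesis
  proof (intro local_involution_ring.intro local_involution_ring_axioms.intro)
    show "cring B" ..
    show "finite (carrier B)" by (rule card_B(1))
    show "maximalideal \<mm> B" by (rule max)
    show "y \<in> Units B" if "y \<in> carrier B" "y \<notin> \<mm>" for y by (rule unit[OF that])
    show "circ \<in> ring_hom B B"
    proof (rule ring_hom_memI)
      fix x y assume x: "x \<in> carrier B" and y: "y \<in> carrier B"
      obtain a where a: "a \<in> ball 0" "x = \<psi> a" using psi_cases[OF x] .
      obtain b where b: "b \<in> ball 0" "y = \<psi> b" using psi_cases[OF y] .
      show "circ x \<in> carrier B" using a circ_psi psi_closed sigma_closed by simp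
      have "circ (\<psi> (a \<otimes> b)) = \<psi> (\<sigma> a \<otimes> \<sigma> b)"
        using circ_psi[of "a \<otimes> b"] sigma_mult[OF a(1) b(1)] ball_mult[OF a(1) b(1)] by simp
      then show "circ (x \<otimes>\<^bsub>B\<^esub> y) = circ x \<otimes>\<^bsub>B\<^esub> circ y"
        using a b psi_mult[OF a(1) b(1)] psi_mult[OF sigma_closed[OF a(1)] sigma_closed[OF b(1)]]
        by (simp add: circ_psi)
      have "circ (\<psi> (a \<oplus> b)) = \<psi> (\<sigma> a \<oplus> \<sigma> b)"
        using circ_psi[of "a \<oplus> b"] sigma_add[OF a(1) b(1)] ball_add[OF a(1) b(1)] by simp
      then show "circ (x \<oplus>\<^bsub>B\<^esub> y) = circ x \<oplus>\<^bsub>B\<^esub> circ y"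
        using a b psi_add[OF a(1) b(1)] psi_add[OF sigma_closed[OF a(1)] sigma_closed[OF b(1)]]
        by (simp add: circ_psi)
    next
      have "\<sigma> \<one> = \<one>" using ring_hom_one[OF sigma_hom] by simp
      then show "circ \<one>\<^bsub>B\<^esub> = \<one>\<^bsub>B\<^esub>" using circ_psi[OF one_ball] psi_one by simp
    qed
    show "circ (circ y) = y" if yc: "y \<in> carrier B" for y
    proof -
      obtain x where x: "x \<in> ball 0" "y = \<psi> x" using psi_cases[OF yc] .
      then show ?thesis using circ_psi[OF x(1)] circ_psi[OF sigma_closed[OF x(1)]] sigma_sigma[OF x(1)] by simp
    qed
    show "circ y \<ominus>\<^bsub>B\<^esub> y \<in> \<mm>" if yc: "y \<in> carrier B" for y
    proof -
      obtain x where x: "x \<in> ball 0" "y = \<psi> x" using psi_cases[OF yc] .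
      obtain a b where ab: "a \<in> OK" "b \<in> OK" "x = a \<oplus> b \<otimes> \<rho>" using integers_decomp[OF x(1)] .
      have c: "a \<in> carrier F" "b \<in> carrier F" using ab OK_carrier by auto
      have "\<sigma> x \<ominus> x = (\<ominus> (b \<oplus> b)) \<otimes> \<rho>"
        unfolding ab(3) sigma_decomp[OF ab(1,2)] using c rho_closed by algebra
      moreover have "(\<ominus> (b \<oplus> b)) \<otimes> \<rho> \<in> ball 1"
        using ball_mult[OF ball_neg[OF ball_add], of b 0 b \<rho> 1] ab(2) rho_ball by simp
      ultimately have "\<psi> (\<sigma> x \<ominus> x) \<in> \<mm>" by simp
      then show ?thesis
        unfolding x(2) circ_psi[OF x(1)] psi_minus[OF sigma_closed[OF x(1)] x(1)] .
    qed
    have two: "\<one> \<oplus> \<one> \<in> ball 0" using ball_add[OF one_ball one_ball] .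
    show "\<one>\<^bsub>B\<^esub> \<oplus>\<^bsub>B\<^esub> \<one>\<^bsub>B\<^esub> \<notin> \<mm>"
      using psi_mem_iff[OF two] two_not_ball psi_add[OF one_ball one_ball] psi_one by simp
  qed
qed

text \<open>
  \<open>\<rho>\<close> vanishes in the residue field, so the representatives for \<open>K\<close> already suffice.
\<close>

lemma card_residue_field_B: "card (carrier (B Quot \<mm>)) = res_card"
proof -
  interpret L: local_involution_ring B circ \<mm> by (rule local_involution_ring_B)
  obtain T where T: "residue_system 1 T" by (rule residue_system_1)
  have TO: "t \<in> OK" if "t \<in> T" for t using T that unfolding residue_system_def by blast
  let ?g = "\<lambda>t. \<mm> +>\<^bsub>B\<^esub> \<psi> t"
  have eq: "?g x = ?g y \<longleftrightarrow> x \<ominus> y \<in> ball 1" if "x \<in> ball 0" "y \<in> ball 0" for x y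
    using L.pr_eq_iff[OF psi_closed[OF that(1)] psi_closed[OF that(2)]] psi_minus[OF that]
      psi_mem_iff[OF ball_minus[OF that]] by simp
  have "bij_betw ?g T (carrier (B Quot \<mm>))"
  proof (rule bij_betw_imageI)
    show "inj_on ?g T"
    proof (rule inj_onI)
      fix s t assume st: "s \<in> T" "t \<in> T" "?g s = ?g t"
      then have "s \<ominus> t \<in> ball 1" using eq[of s t] TO by blast
      then have "s \<ominus> t \<in> ball 2" using K_ball_even[of "s \<ominus> t" 1] OK_minus[OF TO TO, OF st(1,2)] by simp
      then show "s = t" using T st unfolding residue_system_def by simp
    qed
    show "?g ` T = carrier (B Quot \<mm>)"
    proof (intro Set.equalityI subsetI)
      fix C assume "C \<in> ?g ` T"
      then show "C \<in> carrier (B Quot \<mm>)" unfolding L.carrier_k using psi_closed TO by blast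
    next
      fix C assume "C \<in> carrier (B Quot \<mm>)"
      then obtain y where y: "y \<in> carrier B" "C = \<mm> +>\<^bsub>B\<^esub> y" unfolding L.carrier_k by blast
      obtain x where x: "x \<in> ball 0" "y = \<psi> x" using psi_cases[OF y(1)] .
      obtain a b where ab: "a \<in> OK" "b \<in> OK" "x = a \<oplus> b \<otimes> \<rho>" using integers_decomp[OF x(1)] .
      obtain t where t: "t \<in> T" "a \<ominus> t \<in> ball (2 * int 1)" using T ab(1) unfolding residue_system_def by blast
      have c: "a \<in> carrier F" "b \<in> carrier F" "t \<in> carrier F" using ab OK_carrier TO[OF t(1)] by auto
      have "x \<ominus> t = (a \<ominus> t) \<oplus> b \<otimes> \<rho>" unfolding ab(3) using c rho_closed by algebra
      moreover have "(a \<ominus> t) \<oplus> b \<otimes> \<rho> \<in> ball 1"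
        using ball_add[OF ball_mono[OF t(2), of 1], of "b \<otimes> \<rho>"] ball_mult[of b 0 \<rho> 1] ab(2) rho_ball by simp
      ultimately have "?g x = ?g t" using eq[of x t] x(1) TO[OF t(1)] by simp
      then show "C \<in> ?g ` T" using t(1) x y by blast
    qed
  qed
  then have "card (carrier (B Quot \<mm>)) = card T" by (rule bij_betw_same_card[symmetric])
  also have "card T = res_card ^ 1" using T unfolding residue_system_def by blast
  finally show ?thesis by (simp only: power_one_right)
qed

lemma card_mm: "card \<mm> = res_card ^ (l - 1)"
proof -
  interpret L: local_involution_ring B circ \<mm> by (rule local_involution_ring_B)
  have l: "l = Suc (l - 1)" using length_pos by simp
  have "res_card * card \<mm> = res_card ^ Suc (l - 1)"
    unfolding l[symmetric] using L.card_carrier unfolding card_residue_field_B card_B(2) by (rule sym)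
  then have "res_card * card \<mm> = res_card * res_card ^ (l - 1)" by (simp only: power_Suc)
  then show ?thesis using res_card_pos by (metis mult_left_cancel less_not_refl)
qed

text \<open>
  If the image of \<open>a + b \<rho>\<close> is fixed, then \<open>2 b \<rho>\<close> is in the kernel, and so is \<open>b \<rho>\<close>.  Fixed elements
  therefore come from \<open>a\<close> alone, and they lie in \<open>\<mm>\<close> iff \<open>a = \<pi> y\<close>; here \<open>y\<close> counts modulo \<open>\<pi>\<^sup>f\<^sup>-\<^sup>1\<close>.
\<close>

lemma card_fixed_mm: "card {z \<in> \<mm>. circ z = z} = res_card ^ (f - 1)"
proof -
  obtain T where T: "residue_system (f - 1) T" using residue_system_exists by blast
  have TO: "t \<in> OK" if "t \<in> T" for t using T that unfolding residue_system_def by blast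
  have pO: "pp 1 \<in> OK" using pp(1,4)[of 1] ball_mono[of "pp 1" 2 0] by simp
  have pc: "pp 1 \<in> carrier F" using pp(2) by blast
  let ?g = "\<lambda>t. \<psi> (pp 1 \<otimes> t)"
  have f1: "2 * int f = 2 * int (f - 1) + 2 * int 1" using f_bounds(4) by simp
  have "bij_betw ?g T {z \<in> \<mm>. circ z = z}"
  proof (rule bij_betw_imageI)
    show "inj_on ?g T"
    proof (rule inj_onI)
      fix s t assume st: "s \<in> T" "t \<in> T" and eq: "?g s = ?g t"
      have c: "s \<in> carrier F" "t \<in> carrier F" using st TO OK_carrier by blast+
      have O: "pp 1 \<otimes> s \<in> OK" "pp 1 \<otimes> t \<in> OK" using OK_mult pO TO st by blast+
      have "pp 1 \<otimes> s \<ominus> pp 1 \<otimes> t \<in> ball (int l)" using psi_eq_iff[of "pp 1 \<otimes> s" "pp 1 \<otimes> t"] eq O by blast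
      moreover have "pp 1 \<otimes> s \<ominus> pp 1 \<otimes> t \<in> K" using OK_minus[OF O] by blast
      ultimately have "pp 1 \<otimes> s \<ominus> pp 1 \<otimes> t \<in> ball (2 * int f)"
        using K_ball_even[of _ "int f"] ball_mono[OF _ f_bounds(2)] by blast
      moreover have "pp 1 \<otimes> s \<ominus> pp 1 \<otimes> t = pp 1 \<otimes> (s \<ominus> t)" using c pc by algebra
      ultimately have "s \<ominus> t \<in> ball (2 * int (f - 1))"
        using pp_cancel[of "s \<ominus> t" 1 "2 * int (f - 1)"] c unfolding f1 by simp
      then show "s = t" using T st unfolding residue_system_def by blast
    qed
    show "?g ` T = {z \<in> \<mm>. circ z = z}"
    proof (intro Set.equalityI subsetI)
      fix z assume "z \<in> ?g ` T"
      then obtain t where t: "t \<in> T" "z = ?g t" by blast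
      have O: "pp 1 \<otimes> t \<in> OK" using OK_mult pO TO t(1) by blast
      have "pp 1 \<otimes> t \<in> ball 2" using ball_mult[OF pp(4)[of 1], of t 0] TO[OF t(1)] by simp
      then have "pp 1 \<otimes> t \<in> ball 1" using ball_mono[of _ 2 1] by simp
      moreover have "circ z = z"
        unfolding t(2) using circ_psi[of "pp 1 \<otimes> t"] sigma_fixes[of "pp 1 \<otimes> t"] O unfolding OK_eq by simp
      ultimately show "z \<in> {z \<in> \<mm>. circ z = z}" using t(2) by blast
    next
      fix z assume "z \<in> {z \<in> \<mm>. circ z = z}"
      then obtain x where x: "x \<in> ball 1" "z = \<psi> x" and fixed: "circ z = z" by blast
      have x0: "x \<in> ball 0" using ball_mono[OF x(1)] by simp
      obtain a b where ab: "a \<in> OK" "b \<in> OK" "x = a \<oplus> b \<otimes> \<rho>" using integers_decomp[OF x0] .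
      have c: "a \<in> carrier F" "b \<in> carrier F" using ab OK_carrier by auto
      have "\<sigma> x \<ominus> x \<in> ball (int l)"
        using psi_eq_iff[OF sigma_closed[OF x0] x0] circ_psi[OF x0] fixed x(2) by simp
      also have "\<sigma> x \<ominus> x = \<zero> \<oplus> (\<ominus> (b \<oplus> b)) \<otimes> \<rho>"
        unfolding ab(3) sigma_decomp[OF ab(1,2)] using c rho_closed by algebra
      finally have bb: "\<zero> \<oplus> (\<ominus> (b \<oplus> b)) \<otimes> \<rho> \<in> ball (int l)" .
      define w where "w = inv (\<one> \<oplus> \<one>)"
      have two0: "\<one> \<oplus> \<one> \<in> ball 0" using ball_add[OF one_ball one_ball] .
      have w: "w \<in> ball 0" "(\<one> \<oplus> \<one>) \<otimes> w = \<one>"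
        using unit_VR[OF two0 two_not_ball] by (auto simp: w_def)
      have wc: "w \<in> carrier F" using ball_carrier[OF w(1)] .
      \<comment> \<open>multiplication by \<open>- 1 / 2\<close>\<close>
      have "(\<ominus> w) \<otimes> (\<zero> \<oplus> (\<ominus> (b \<oplus> b)) \<otimes> \<rho>) \<in> ball (int l)"
        using ball_mult[OF ball_neg[OF w(1)] bb] by simp
      also have "(\<ominus> w) \<otimes> (\<zero> \<oplus> (\<ominus> (b \<oplus> b)) \<otimes> \<rho>) = ((\<one> \<oplus> \<one>) \<otimes> w) \<otimes> (b \<otimes> \<rho>)"
        using c wc rho_closed by algebra
      also have "\<dots> = b \<otimes> \<rho>" unfolding w(2) using c rho_closed by simp
      finally have brho: "b \<otimes> \<rho> \<in> ball (int l)" .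
      have "x \<ominus> a = b \<otimes> \<rho>" unfolding ab(3) using c rho_closed
        by (simp add: a_minus_def a_comm[of a] a_assoc r_neg)
      then have za: "z = \<psi> a" using psi_eq_iff[OF x0, of a] ab(1) brho x(2) by simp
      have "a \<in> ball 1" using split_ball(1)[OF ab(1,2), of 1] x(1) ab(3) by simp
      then have "a \<in> ball (2 * int 1)" using K_ball_even[of a 1] ab(1) by simp
      then obtain y where y: "y \<in> OK" "a = pp 1 \<otimes> y" using pp_div[of a 1] ab(1) by blast
      obtain t where t: "t \<in> T" "y \<ominus> t \<in> ball (2 * int (f - 1))" using T y(1) unfolding residue_system_def by blast
      have O: "pp 1 \<otimes> t \<in> OK" using OK_mult pO TO t(1) by blast
      have tc: "t \<in> carrier F" "y \<in> carrier F" using TO[OF t(1)] y(1) OK_carrier by auto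
      have "pp 1 \<otimes> (y \<ominus> t) \<in> ball (2 * int 1 + 2 * int (f - 1))" by (rule ball_mult[OF pp(4) t(2)])
      then have "pp 1 \<otimes> (y \<ominus> t) \<in> ball (int l)"
        by (rule ball_mono) (use f_bounds(1) f1 in linarith)
      also have "pp 1 \<otimes> (y \<ominus> t) = a \<ominus> pp 1 \<otimes> t" unfolding y(2) using tc pc by algebra
      finally have "z = ?g t" using psi_eq_iff[of a "pp 1 \<otimes> t"] ab(1) O za by blast
      then show "z \<in> ?g ` T" using t(1) by blast
    qed
  qed
  then have "card {z \<in> \<mm>. circ z = z} = card T" by (rule bij_betw_same_card[symmetric])
  also have "card T = res_card ^ (f - 1)" using T unfolding residue_system_def by blast
  finally show ?thesis .
qed

end
end

section \<open>The index formulas over a finite local ring\<close>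

text \<open>
  All four cases lead to this equation for the length \<open>N\<close> of the orbit.  The quadratic count \<open>c\<close> is
  only available up to a factor \<open>q\<close>, which turns the exponent \<open>f - 1\<close> into \<open>f\<close>.
\<close>

lemma solve_for_count:
  fixes q N c :: nat
  assumes q: "0 < q" and eq: "q ^ (f - 1) * N = (q ^ (l - 1)) ^ m * c"
    and c: "q * c = q ^ r * d" and f: "1 \<le> f" "f \<le> m * l - m + r"
  shows "N = q ^ (m * l - m + r - f) * d"
proof -
  have e: "(l - 1) * m = m * l - m" by (simp only: diff_mult_distrib mult.commute[of l m] mult_1)
  have "q ^ f * N = q * (q ^ (f - 1) * N)" using f(1) by (cases f) auto
  also have "\<dots> = (q ^ (l - 1)) ^ m * (q * c)" unfolding eq by simp
  also have "\<dots> = q ^ (m * l - m + r) * d"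
    unfolding c power_mult[symmetric] e power_add by simp
  also have "\<dots> = q ^ (f + (m * l - m + r - f)) * d" using f(2) by simp
  also have "\<dots> = q ^ f * (q ^ (m * l - m + r - f) * d)" by (simp only: power_add mult.assoc)
  finally show ?thesis using q by simp
qed

context finite_hermitian_module
begin

abbreviation u_perp where "u_perp u \<equiv> perp B W h u"

lemma module_perp:
  assumes u: "u \<in> carrier W"
  shows "module B (u_perp u)"
proof -
  have "submodule {v \<in> carrier W. h u v = \<zero>} B W"
  proof (rule submoduleI)
    show "\<zero>\<^bsub>W\<^esub> \<in> {v \<in> carrier W. h u v = \<zero>}" using u by (simp add: h_zero_r)
    show "\<ominus>\<^bsub>W\<^esub> a \<in> {v \<in> carrier W. h u v = \<zero>}" if "a \<in> {v \<in> carrier W. h u v = \<zero>}" for a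
      using that u by (simp add: h_neg_r)
  qed (use u in \<open>auto simp: h_add_r h_smult_r\<close>)
  then show ?thesis unfolding perp_def by (rule submodule.submodule_is_module) (rule module_axioms)
qed

lemma lincomb_perp:
  assumes u: "u \<in> carrier W" and e: "\<And>i. i < n \<Longrightarrow> e i \<in> carrier (u_perp u)"
    and x: "\<And>i. i < n \<Longrightarrow> x i \<in> carrier B"
  shows "lincomb (u_perp u) n e x = lincomb W n e x"
  using e x
proof (induction n)
  case 0
  then show ?case by (simp add: module.lincomb_0[OF module_perp[OF u]] lincomb_0) (simp add: perp_def)
next
  case (Suc n)
  have "lincomb (u_perp u) (Suc n) e x = lincomb (u_perp u) n e x \<oplus>\<^bsub>u_perp u\<^esub> x n \<odot>\<^bsub>u_perp u\<^esub> e n"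
    using Suc.prems by (rule module.lincomb_Suc[OF module_perp[OF u]])
  also have "\<dots> = lincomb W n e x \<oplus>\<^bsub>W\<^esub> x n \<odot>\<^bsub>W\<^esub> e n"
    using Suc.IH Suc.prems by (simp add: perp_def)
  also have "\<dots> = lincomb W (Suc n) e x"
    by (rule lincomb_Suc[symmetric]) (use Suc.prems in \<open>auto simp: perp_def\<close>)
  finally show ?case .
qed

text \<open>
  Because \<open>h u u\<close> is a unit, subtracting \<open>(h u u)\<^sup>-\<^sup>1 h(u, v) u\<close> from \<open>v\<close> projects onto the orthogonal
  complement of \<open>u\<close>.
\<close>

lemma extend_perp_basis:
  assumes u: "u \<in> carrier W" and unit: "h u u \<in> Units B" and basis: "is_basis B (u_perp u) n e"
  shows "is_basis B W (Suc n) (e(n := u))"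
proof -
  let ?e = "e(n := u)"
  have ep: "e i \<in> carrier (u_perp u)" if "i < n" for i using basis that by (simp add: is_basis_def)
  have e: "e i \<in> carrier W" "h u (e i) = \<zero>" if "i < n" for i using ep[OF that] by (auto simp: perp_def)
  have e': "?e i \<in> carrier W" if "i < Suc n" for i using e u that by (cases "i = n") auto
  have pu: "\<zero>\<^bsub>u_perp u\<^esub> = \<zero>\<^bsub>W\<^esub>" by (simp add: perp_def)
  have tc: "h u u \<in> carrier B" using u by simp
  have comb: "lincomb W (Suc n) ?e c = lincomb (u_perp u) n e c \<oplus>\<^bsub>W\<^esub> c n \<odot>\<^bsub>W\<^esub> u"
    if c: "\<And>i. i < Suc n \<Longrightarrow> c i \<in> carrier B" for c
  proof -
    have "lincomb W (Suc n) ?e c = lincomb W n ?e c \<oplus>\<^bsub>W\<^esub> c n \<odot>\<^bsub>W\<^esub> ?e n"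
      using e' c by (rule lincomb_Suc)
    also have "lincomb W n ?e c = lincomb W n e c"
      by (rule lincomb_cong) (use e c in auto)
    also have "lincomb W n e c = lincomb (u_perp u) n e c"
      by (rule lincomb_perp[symmetric, OF u ep]) (use c in auto)
    finally show ?thesis unfolding fun_upd_same .
  qed
  have perp_comb: "lincomb (u_perp u) n e c \<in> carrier W" "h u (lincomb (u_perp u) n e c) = \<zero>"
    if c: "\<And>i. i < n \<Longrightarrow> c i \<in> carrier B" for c
    using module.lincomb_closed[OF module_perp[OF u] ep c] by (auto simp: perp_def)
  have span: "\<exists>c\<in>{..<n} \<rightarrow> carrier B. v = lincomb (u_perp u) n e c" if "v \<in> carrier (u_perp u)" for v
    using basis that unfolding is_basis_def lincomb_def by blast
  have indep: "c i = \<zero>" if "c \<in> {..<n} \<rightarrow> carrier B" "lincomb (u_perp u) n e c = \<zero>\<^bsub>u_perp u\<^esub>" "i < n" for c i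
    using basis that unfolding is_basis_def lincomb_def by blast
  show ?thesis
    unfolding is_basis_def lincomb_def[symmetric]
  proof (intro conjI ballI allI impI)
    show "?e i \<in> carrier W" if "i < Suc n" for i by (rule e'[OF that])
  next
    fix v assume v: "v \<in> carrier W"
    define a where "a = inv (h u u) \<otimes> h u v"
    have a: "a \<in> carrier B" using unit u v by (simp add: a_def)
    have ta: "h u u \<otimes> a = h u v"
      unfolding a_def using unit tc u v by (simp add: R.m_assoc[symmetric])
    define w where "w = v \<oplus>\<^bsub>W\<^esub> \<ominus>\<^bsub>W\<^esub> (a \<odot>\<^bsub>W\<^esub> u)"
    have "h u w = h u v \<oplus> \<ominus> (h u u \<otimes> a)"
      unfolding w_def using u v a by (simp add: h_add_r h_neg_r h_smult_r)
    also have "\<dots> = \<zero>" unfolding ta using u v by (simp add: R.r_neg)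
    finally have "w \<in> carrier (u_perp u)" using u v a by (simp add: perp_def w_def)
    then obtain c where c: "c \<in> {..<n} \<rightarrow> carrier B" "w = lincomb (u_perp u) n e c" using span by blast
    have wc: "w \<in> carrier W" using u v a by (simp add: w_def)
    have cc: "(c(n := a)) i \<in> carrier B" if "i < Suc n" for i using c a that by (cases "i = n") auto
    have "lincomb (u_perp u) n e (c(n := a)) = w"
      unfolding c(2) by (rule module.lincomb_cong[OF module_perp[OF u]]) (use ep c a in auto)
    then have "lincomb W (Suc n) ?e (c(n := a)) = w \<oplus>\<^bsub>W\<^esub> a \<odot>\<^bsub>W\<^esub> u"
      using comb[of "c(n := a)", OF cc] by simp
    also have "\<dots> = v" unfolding w_def using u v a by (simp add: M.a_assoc M.l_neg)
    finally show "\<exists>c\<in>{..<Suc n} \<rightarrow> carrier B. v = lincomb W (Suc n) ?e c"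
      using cc by (intro bexI[of _ "c(n := a)"]) auto
  next
    fix c i assume c: "c \<in> {..<Suc n} \<rightarrow> carrier B" and zero: "lincomb W (Suc n) ?e c = \<zero>\<^bsub>W\<^esub>" and i: "i < Suc n"
    have cc: "c i \<in> carrier B" if "i < Suc n" for i using c that by auto
    have cn: "c i \<in> carrier B" if "i < n" for i using c that by auto
    let ?w = "lincomb (u_perp u) n e c"
    note w = perp_comb[of c, OF cn]
    have z: "?w \<oplus>\<^bsub>W\<^esub> c n \<odot>\<^bsub>W\<^esub> u = \<zero>\<^bsub>W\<^esub>" using comb[of c, OF cc] zero by simp
    have "h u (?w \<oplus>\<^bsub>W\<^esub> c n \<odot>\<^bsub>W\<^esub> u) = h u u \<otimes> c n"
      using u w cc[of n] by (simp add: h_add_r h_smult_r)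
    then have "h u u \<otimes> c n = \<zero>" unfolding z using u by (simp add: h_zero_r)
    then have "inv (h u u) \<otimes> (h u u \<otimes> c n) = \<zero>" using unit by simp
    then have cn0: "c n = \<zero>" using unit tc cc[of n] by (simp add: R.m_assoc[symmetric])
    have "?w = \<zero>\<^bsub>W\<^esub>" using z w(1) u unfolding cn0 by simp
    moreover have "c \<in> {..<n} \<rightarrow> carrier B" using cn by auto
    ultimately have "c j = \<zero>" if "j < n" for j using indep[of c j] that unfolding pu by blast
    then show "c i = \<zero>" using cn0 i by (cases "i = n") auto
  qed
qed

text \<open>
  Both kinds are treated together: \<open>\<delta> = 1\<close> gives kind I, where the coefficients are those of
  \<^const>\<open>alternating\<close>, and \<open>\<delta> = \<epsilon>\<close> gives kind II.
\<close>

lemma diagonal_residues: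
  assumes del: "\<delta> \<in> carrier B" and n: "n = 2 * r" "1 \<le> r" and i: "i < n"
  shows "pr (if Suc i = n then \<ominus> \<delta> else if even i then \<one> else \<ominus> \<one>)
       = ((alternating k)(2 * r - 1 := \<ominus>\<^bsub>k\<^esub> pr \<delta>)) i"
proof (cases "Suc i = n")
  case True
  then have "i = 2 * r - 1" using n by simp
  then show ?thesis using True del pr.hom_a_inv[of \<delta>] by simp
next
  case False
  then have "i \<noteq> 2 * r - 1" using n by simp
  moreover have "pr \<one> = \<one>\<^bsub>k\<^esub>" "pr (\<ominus> \<one>) = \<ominus>\<^bsub>k\<^esub> \<one>\<^bsub>k\<^esub>"
    using pr.hom_one pr.hom_a_inv[of \<one>] by auto
  ultimately show ?thesis using False by (simp add: alternating_def)
qed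

lemma alternating_last: "1 \<le> r \<Longrightarrow> (alternating k)(2 * r - 1 := \<ominus>\<^bsub>k\<^esub> \<one>\<^bsub>k\<^esub>) = alternating k"
  by (auto simp: fun_eq_iff alternating_def)

lemma card_carrier_ge_2: "2 \<le> card (carrier B)"
proof -
  have "card {\<zero>, \<one>} \<le> card (carrier B)" using fin_carrier by (intro card_mono) auto
  moreover have "\<zero> \<noteq> \<one>"
  proof
    assume "\<zero> = \<one>"
    then have "\<one> \<in> \<mm>" using mm.zero_closed by metis
    then show False using unit_not_mem[of \<one>] by simp
  qed
  ultimately show ?thesis by simp
qed

text \<open>
  Over a finite ring the rank can be read off from the number of elements.
\<close>

lemma rank_unique:
  assumes "card (carrier W) = card (carrier B) ^ m" "is_basis B W n e"
  shows "n = m"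
  using assms(1) card_free[OF assms(2)] card_carrier_ge_2 power_inject_exp[of "card (carrier B)" n m] by simp

lemma card_norm_eq_even:
  assumes rank: "card (carrier W) = card (carrier B) ^ (2 * r)" and r: "1 \<le> r"
    and diag: "diagonalizes_to B W h n \<delta>" and del: "\<delta> \<in> carrier B"
    and t: "t \<in> Units B" "cj t = t"
  shows "card {z \<in> \<mm>. cj z = z} * card {v \<in> carrier W. h v v = t}
       = card \<mm> ^ (2 * r) * quad_count k ((alternating k)(2 * r - 1 := \<ominus>\<^bsub>k\<^esub> pr \<delta>)) (2 * r) (pr t)"
proof -
  obtain e where e: "is_basis B W n e"
    "\<And>i j. i < n \<Longrightarrow> j < n \<Longrightarrow> h (e i) (e j) = (if i \<noteq> j then \<zero> else if Suc i = n then \<ominus> \<delta>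
       else if even i then \<one> else \<ominus> \<one>)"
    using diag unfolding diagonalizes_to_def by blast
  have n: "n = 2 * r" by (rule rank_unique[OF rank e(1)])
  have orth: "orthogonal_system B h n e" using e(2) by (simp add: orthogonal_system_def)
  have "quad_count k (\<lambda>i. pr (h (e i) (e i))) n (pr t)
      = quad_count k ((alternating k)(2 * r - 1 := \<ominus>\<^bsub>k\<^esub> pr \<delta>)) n (pr t)"
    by (rule quad_count_cong) (simp only: e(2) diagonal_residues[OF del n r] not_not simp_thms if_False)
  then show ?thesis using card_norm_eq[OF e(1) orth t] unfolding n by simp
qed

lemma card_norm_eq_odd:
  assumes rank: "card (carrier W) = card (carrier B) ^ Suc (2 * r)" and r: "1 \<le> r"
    and u: "u \<in> carrier W" and unit: "h u u \<in> Units B"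
    and diag: "diagonalizes_to B (u_perp u) h n \<delta>" and del: "\<delta> \<in> carrier B"
  shows "card {z \<in> \<mm>. cj z = z} * card {v \<in> carrier W. h v v = h u u}
       = card \<mm> ^ Suc (2 * r) *
         quad_count k ((alternating k)(2 * r - 1 := \<ominus>\<^bsub>k\<^esub> pr \<delta>, 2 * r := pr (h u u))) (Suc (2 * r)) (pr (h u u))"
proof -
  obtain e where e: "is_basis B (u_perp u) n e"
    "\<And>i j. i < n \<Longrightarrow> j < n \<Longrightarrow> h (e i) (e j) = (if i \<noteq> j then \<zero> else if Suc i = n then \<ominus> \<delta>
       else if even i then \<one> else \<ominus> \<one>)"
    using diag unfolding diagonalizes_to_def by blast
  let ?e = "e(n := u)"
  have basis: "is_basis B W (Suc n) ?e" by (rule extend_perp_basis[OF u unit e(1)])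
  have n: "n = 2 * r" using rank_unique[OF rank basis] by simp
  have eW: "e i \<in> carrier W" "h u (e i) = \<zero>" if "i < n" for i
    using e(1) that unfolding is_basis_def by (auto simp: perp_def)
  have eu: "h (e i) u = \<zero>" if "i < n" for i
    using h_conj[OF u eW(1)[OF that]] eW(2)[OF that] by simp
  have orth: "orthogonal_system B h (Suc n) ?e"
    unfolding orthogonal_system_def using e(2) eW(2) eu by (auto simp: less_Suc_eq)
  have "pr (h (?e i) (?e i)) = ((alternating k)(2 * r - 1 := \<ominus>\<^bsub>k\<^esub> pr \<delta>, 2 * r := pr (h u u))) i"
    if i: "i < Suc n" for i
  proof (cases "i = n")
    case False
    then have "i < n" using i by simp
    then have "pr (h (e i) (e i)) = ((alternating k)(2 * r - 1 := \<ominus>\<^bsub>k\<^esub> pr \<delta>)) i"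
      by (simp only: e(2) diagonal_residues[OF del n r] not_not simp_thms if_False)
    then show ?thesis using False n by simp
  qed (use n in simp)
  then have "quad_count k (\<lambda>i. pr (h (?e i) (?e i))) (Suc n) (pr (h u u))
      = quad_count k ((alternating k)(2 * r - 1 := \<ominus>\<^bsub>k\<^esub> pr \<delta>, 2 * r := pr (h u u))) (Suc n) (pr (h u u))"
    by (rule quad_count_cong)
  then show ?thesis
    using card_norm_eq[OF basis orth unit] cj_h[OF u u] unfolding n by simp
qed

text \<open>
  The orbit length comes from \<open>card_norm_eq\<close> and the quadratic counts with \<open>\<delta> = 1\<close> or \<open>\<delta> = \<epsilon>\<close>.
\<close>

theorem index_formulas:
  fixes l f m r :: nat
  defines "q \<equiv> card (carrier k)"
  assumes rank: "card (carrier W) = card (carrier B) ^ m" and m: "2 \<le> m"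
    and cmm: "card \<mm> = q ^ (l - 1)" and cfix: "card {z \<in> \<mm>. cj z = z} = q ^ (f - 1)"
    and f: "1 \<le> f" "2 * f \<le> l + 1"
    and u: "u \<in> carrier W" and unit: "h u u \<in> Units B"
    and eps: "\<epsilon> \<in> Units B" "cj \<epsilon> = \<epsilon>" "\<And>x. x \<in> Units B \<Longrightarrow> cj x = x \<Longrightarrow> \<epsilon> \<noteq> x \<otimes> x"
  defines "N \<equiv> group_index U (stabilizer U (\<lambda>g. g) u)"
  shows "m = 2 * r + 1 \<Longrightarrow> kind_I B (u_perp u) h \<Longrightarrow> N = q ^ (m * l - m + r - f + 1) * (q ^ r + 1)"
    and "m = 2 * r + 1 \<Longrightarrow> kind_II B \<epsilon> (u_perp u) h \<Longrightarrow> N = q ^ (m * l - m + r - f + 1) * (q ^ r - 1)"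
    and "m = 2 * r \<Longrightarrow> kind_I B W h \<Longrightarrow> N = q ^ (m * l - m + r - f) * (q ^ r - 1)"
    and "m = 2 * r \<Longrightarrow> kind_II B \<epsilon> W h \<Longrightarrow> N = q ^ (m * l - m + r - f) * (q ^ r + 1)"
proof -
  define t where "t = h u u"
  have tc: "t \<in> carrier B" and cjt: "cj t = t" and tU: "t \<in> Units B"
    using u unit cj_h[OF u u] by (auto simp: t_def)
  have T: "pr t \<in> carrier k" "pr t \<noteq> \<zero>\<^bsub>k\<^esub>" using tc pr_zero_iff[OF tc] unit_not_mem[OF tU] by auto
  have N: "N = card {v \<in> carrier W. h v v = t}"
    unfolding N_def t_def by (rule stabilizer_index[OF u unit])
  have q0: "0 < q" unfolding q_def by (rule k.order_k_pos)
  have pe: "pr \<epsilon> \<in> carrier k" using eps(1) Units_closed by simp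
  have ns: "pr \<epsilon> \<noteq> x \<otimes>\<^bsub>k\<^esub> x" if "x \<in> carrier k" for x by (rule nonsquare_mod[OF eps that])
  have ec: "\<epsilon> \<in> carrier B" using eps(1) by (rule Units_closed)
  have p1: "pr \<one> = \<one>\<^bsub>k\<^esub>" by (rule pr.hom_one)
  have fm: "f \<le> m * l - m + r" if r: "1 \<le> r"
  proof -
    have "m * l - m = m * (l - 1)" by (simp only: diff_mult_distrib2 mult_1_right)
    moreover have "l - 1 \<le> m * (l - 1)" using m by simp
    ultimately show ?thesis using f r by linarith
  qed
  { assume "m = 2 * r + 1"
    then have mr: "m = Suc (2 * r)" and r: "1 \<le> r" using m by auto
    \<comment> \<open>In odd rank the count is known without the factor \<open>q\<close>; supplying it raises the exponent
       \<open>r\<close> by one.\<close>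
    have shift: "m * l - m + r - f + 1 = m * l - m + Suc r - f" using fm[OF r] by simp
    have fS: "f \<le> m * l - m + Suc r" using fm[OF r] by simp
    have main: "N = q ^ (m * l - m + r - f + 1) * d"
      if "diagonalizes_to B (u_perp u) h n \<delta>" "\<delta> \<in> carrier B"
        "quad_count k ((alternating k)(2 * r - 1 := \<ominus>\<^bsub>k\<^esub> pr \<delta>, 2 * r := pr t)) (Suc (2 * r)) (pr t) = q ^ r * d"
      for n \<delta> d
      unfolding shift
    proof (rule solve_for_count[OF q0 _ _ f(1) fS])
      show "q ^ (f - 1) * N = (q ^ (l - 1)) ^ m * (q ^ r * d)"
        using card_norm_eq_odd[OF rank[unfolded mr] r u unit that(1,2)] that(3)
        unfolding N cmm cfix t_def[symmetric] mr by simp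
      show "q * (q ^ r * d) = q ^ Suc r * d" by simp
    qed
    show "kind_I B (u_perp u) h \<Longrightarrow> N = q ^ (m * l - m + r - f + 1) * (q ^ r + 1)"
      using main[of _ \<one> "q ^ r + 1"] k.quad_count_odd_split[OF T, of r]
      unfolding kind_I_def p1 alternating_last[OF r] q_def by auto
    show "kind_II B \<epsilon> (u_perp u) h \<Longrightarrow> N = q ^ (m * l - m + r - f + 1) * (q ^ r - 1)"
      using main[of _ \<epsilon> "q ^ r - 1"] k.quad_count_odd_nonsplit[OF T pe ns r] ec
      unfolding kind_II_def q_def by auto }
  { assume mr: "m = 2 * r"
    then have r: "1 \<le> r" using m by auto
    have main: "N = q ^ (m * l - m + r - f) * d"
      if "diagonalizes_to B W h n \<delta>" "\<delta> \<in> carrier B"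
        "q * quad_count k ((alternating k)(2 * r - 1 := \<ominus>\<^bsub>k\<^esub> pr \<delta>)) (2 * r) (pr t) = q ^ r * d"
      for n \<delta> d
    proof (rule solve_for_count[OF q0 _ that(3) f(1) fm[OF r]])
      show "q ^ (f - 1) * N = (q ^ (l - 1)) ^ m *
          quad_count k ((alternating k)(2 * r - 1 := \<ominus>\<^bsub>k\<^esub> pr \<delta>)) (2 * r) (pr t)"
        using card_norm_eq_even[OF rank[unfolded mr] r that(1,2) tU cjt]
        unfolding N cmm cfix mr by simp
    qed
    show "kind_I B W h \<Longrightarrow> N = q ^ (m * l - m + r - f) * (q ^ r - 1)"
      using main[of _ \<one> "q ^ r - 1"] k.quad_count_even_split[OF T, of r]
      unfolding kind_I_def p1 alternating_last[OF r] q_def by auto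
    show "kind_II B \<epsilon> W h \<Longrightarrow> N = q ^ (m * l - m + r - f) * (q ^ r + 1)"
      using main[of _ \<epsilon> "q ^ r + 1"] k.quad_count_even_nonsplit[OF T pe ns r] ec
      unfolding kind_II_def q_def by auto }
qed

end

section \<open>The tower of quotients of the ring of integers\<close>

context ramified_quadratic_extension
begin

text \<open>
  The maximal ideal is generated by \<open>\<rho>\<close>, which has valuation \<open>1\<close>.
\<close>

lemma ideal_pow_ball: "ideal_pow VR (ball 1) n = ball (int n)"
proof -
  interpret VR: cring VR by (rule cring_VR)
  have "ball 1 = PIdl\<^bsub>VR\<^esub> (\<rho> [^] (1::nat))" using ball_eq_cgenideal[of 1] by simp
  then have "ball 1 = PIdl\<^bsub>VR\<^esub> \<rho>" using rho_closed by simp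
  moreover have "ideal_pow VR (PIdl\<^bsub>VR\<^esub> \<rho>) n = PIdl\<^bsub>VR\<^esub> (\<rho> [^]\<^bsub>VR\<^esub> n)"
    by (rule VR.ideal_pow_cgenideal) (simp add: rho_ball_0)
  ultimately show ?thesis by (simp add: nat_pow_consistent[symmetric] ball_eq_cgenideal)
qed

lemma ideal_ball_nat: "ideal (ball (int n)) VR"
proof -
  interpret VR: cring VR by (rule cring_VR)
  have "\<rho> [^] n \<in> carrier VR" using ball_mono[OF rho_pow_ball, of 0] by simp
  then show ?thesis unfolding ball_eq_cgenideal by (rule VR.cgenideal_ideal)
qed

context
  fixes l :: nat and A star rr J B circ
  assumes A: "A = VR Quot ball (2 * int l)" and star: "star = quot_map \<sigma>"
    and rr: "rr = ideal_image VR (ball (2 * int l)) (ball 1)"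
    and J: "J = ideal_pow A rr l" and B: "B = A Quot J" and circ: "circ = quot_map star"
begin

abbreviation cl where "cl x \<equiv> ball (2 * int l) +>\<^bsub>VR\<^esub> x"

lemma ideal_2l: "ideal (ball (2 * int l)) VR"
  using ideal_ball_nat[of "2 * l"] by simp

lemma cring_A: "cring A"
  unfolding A by (rule ideal.quotient_is_cring[OF ideal_2l cring_VR])

lemma cl_hom: "cl \<in> ring_hom VR A"
  unfolding A by (rule ideal.rcos_ring_hom[OF ideal_2l])

lemma carrier_A: "carrier A = cl ` ball 0"
  unfolding A by (auto simp: FactRing_def A_RCOSETS_def')

lemma cl_eq_iff: "x \<in> ball 0 \<Longrightarrow> y \<in> ball 0 \<Longrightarrow> cl x = cl y \<longleftrightarrow> x \<ominus> y \<in> ball (2 * int l)"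
proof -
  assume x: "x \<in> ball 0" and y: "y \<in> ball 0"
  interpret VR: cring VR by (rule cring_VR)
  show ?thesis using VR.quotient_eq_iff_same_a_r_cos[OF ideal_2l, of x y] x y
    by (simp add: minus_VR ball_carrier)
qed

text \<open>
  Forming powers and passing to a quotient preserve principal ideals together with a generator, so
  \<open>\<rr>\<^sup>l\<close> is generated by the class of \<open>\<rho>\<^sup>l\<close>.
\<close>

lemma J_eq: "J = cl ` ball (int l)"
proof -
  interpret VR: cring VR by (rule cring_VR)
  interpret A: cring A by (rule cring_A)
  have rV: "\<rho> \<in> carrier VR" using rho_ball_0 by simp
  have pV: "\<rho> [^]\<^bsub>VR\<^esub> l \<in> carrier VR" using rV by (rule VR.nat_pow_closed)
  have b1: "ball 1 = PIdl\<^bsub>VR\<^esub> \<rho>" using ball_eq_cgenideal[of 1] rho_closed by simp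
  have "rr = PIdl\<^bsub>A\<^esub> (cl \<rho>)"
    unfolding rr A b1 by (rule VR.ideal_image_cgenideal[OF ideal_2l rV])
  then have "J = PIdl\<^bsub>A\<^esub> (cl \<rho> [^]\<^bsub>A\<^esub> l)"
    unfolding J using A.ideal_pow_cgenideal[of "cl \<rho>" l] ring_hom_closed[OF cl_hom rV] by simp
  also have "cl \<rho> [^]\<^bsub>A\<^esub> l = cl (\<rho> [^]\<^bsub>VR\<^esub> l)"
  proof -
    interpret h: ring_hom_cring VR A cl
      by (rule ring_hom_cring.intro[OF cring_VR cring_A]) (rule ring_hom_cring_axioms.intro[OF cl_hom])
    show ?thesis using h.ring.hom_nat_pow[OF rV] by simp
  qed
  also have "PIdl\<^bsub>A\<^esub> (cl (\<rho> [^]\<^bsub>VR\<^esub> l)) = ideal_image VR (ball (2 * int l)) (PIdl\<^bsub>VR\<^esub> (\<rho> [^]\<^bsub>VR\<^esub> l))"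
    unfolding A by (rule VR.ideal_image_cgenideal[OF ideal_2l pV, symmetric])
  also have "PIdl\<^bsub>VR\<^esub> (\<rho> [^]\<^bsub>VR\<^esub> l) = ball (int l)"
    by (simp add: nat_pow_consistent[symmetric] ball_eq_cgenideal)
  finally show ?thesis unfolding ideal_image_def .
qed

lemma ideal_J: "ideal J A"
proof -
  interpret VR: cring VR by (rule cring_VR)
  interpret A: cring A by (rule cring_A)
  have p: "\<rho> [^] l \<in> carrier VR" using ball_mono[OF rho_pow_ball, of 0] by simp
  have "J = PIdl\<^bsub>A\<^esub> (cl (\<rho> [^] l))"
    unfolding J_eq ball_eq_cgenideal ideal_image_def[symmetric]
    unfolding A by (rule VR.ideal_image_cgenideal[OF ideal_2l p])
  then show ?thesis using A.cgenideal_ideal[OF ring_hom_closed[OF cl_hom p]] by simp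
qed

lemma star_cl: "x \<in> ball 0 \<Longrightarrow> star (cl x) = cl (\<sigma> x)"
  unfolding star using quot_map_coset[OF sigma_hom, of "ball (2 * int l)" x] sigma_image_ball[of "2 * l"]
    ball_mono[of _ "2 * int l" 0] by auto

lemma star_hom: "star \<in> ring_hom A A"
proof (rule ring_hom_memI)
  fix C D assume C: "C \<in> carrier A" and D: "D \<in> carrier A"
  obtain x where x: "x \<in> ball 0" "C = cl x" using C unfolding carrier_A by blast
  obtain y where y: "y \<in> ball 0" "D = cl y" using D unfolding carrier_A by blast
  show "star C \<in> carrier A" unfolding carrier_A x(2) star_cl[OF x(1)] using sigma_closed[OF x(1)] by blast
  have s: "\<sigma> x \<in> ball 0" "\<sigma> y \<in> ball 0" using sigma_closed x(1) y(1) by auto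
  have xy: "x \<otimes> y \<in> ball 0" using ball_mult[OF x(1) y(1)] by simp
  have "C \<otimes>\<^bsub>A\<^esub> D = cl (x \<otimes> y)" using ring_hom_mult[OF cl_hom, of x y] x y by simp
  moreover have "star C \<otimes>\<^bsub>A\<^esub> star D = cl (\<sigma> x \<otimes> \<sigma> y)"
    using ring_hom_mult[OF cl_hom, of "\<sigma> x" "\<sigma> y"] s x y star_cl by simp
  ultimately show "star (C \<otimes>\<^bsub>A\<^esub> D) = star C \<otimes>\<^bsub>A\<^esub> star D"
    using star_cl[OF xy] sigma_mult[OF x(1) y(1)] by simp
  have "C \<oplus>\<^bsub>A\<^esub> D = cl (x \<oplus> y)" using ring_hom_add[OF cl_hom, of x y] x y by simp
  moreover have "star C \<oplus>\<^bsub>A\<^esub> star D = cl (\<sigma> x \<oplus> \<sigma> y)"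
    using ring_hom_add[OF cl_hom, of "\<sigma> x" "\<sigma> y"] s x y star_cl by simp
  ultimately show "star (C \<oplus>\<^bsub>A\<^esub> D) = star C \<oplus>\<^bsub>A\<^esub> star D"
    using star_cl[OF ball_add[OF x(1) y(1)]] sigma_add[OF x(1) y(1)] by simp
next
  have "\<sigma> \<one> = \<one>" using ring_hom_one[OF sigma_hom] by simp
  moreover have "cl \<one> = \<one>\<^bsub>A\<^esub>" using ring_hom_one[OF cl_hom] by simp
  ultimately show "star \<one>\<^bsub>A\<^esub> = \<one>\<^bsub>A\<^esub>" using star_cl[OF one_ball] by simp
qed

lemma star_J: "star ` J = J"
proof -
  have "star ` J = (\<lambda>x. star (cl x)) ` ball (int l)" unfolding J_eq by (rule image_image)
  also have "\<dots> = (\<lambda>x. cl (\<sigma> x)) ` ball (int l)"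
    by (rule image_cong[OF refl], rule star_cl) (use ball_mono in auto)
  also have "\<dots> = cl ` (\<sigma> ` ball (int l))" by (rule image_image[symmetric])
  finally show ?thesis unfolding sigma_image_ball J_eq .
qed

lemma circ_coset:
  assumes "C \<in> carrier A"
  shows "circ (J +>\<^bsub>A\<^esub> C) = J +>\<^bsub>A\<^esub> star C"
  unfolding circ using ideal.Icarr[OF ideal_J] by (intro quot_map_coset[OF star_hom star_J _ assms]) auto

text \<open>
  An element whose class lies in the image of the ball of index \<open>l\<close> differs from an element of that
  ball by one of the smaller ball of index \<open>2 l\<close>, so it belongs to the ball of index \<open>l\<close> itself.
\<close>

lemma integral_quotient_B:
  assumes l: "1 \<le> l" and odd: "odd (ring_char (residue_field BK \<nu>))"
  shows "integral_quotient F \<omega> K \<nu> \<rho> \<sigma> B (\<lambda>x. J +>\<^bsub>A\<^esub> cl x) circ l"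
proof -
  interpret A: cring A by (rule cring_A)
  interpret J: ideal J A by (rule ideal_J)
  have B': "cring B" unfolding B by (rule J.quotient_is_cring[OF cring_A])
  have qh: "(\<lambda>C. J +>\<^bsub>A\<^esub> C) \<in> ring_hom A B" unfolding B by (rule J.rcos_ring_hom)
  have clA: "cl x \<in> carrier A" if "x \<in> ball 0" for x using that unfolding carrier_A by blast
  show ?thesis
  proof (intro integral_quotient.intro integral_quotient_axioms.intro)
    show "ramified_quadratic_extension F \<omega> K \<nu> \<rho> \<sigma>" by (rule ramified_quadratic_extension_axioms)
    show "cring B" by (rule B')
    show "(\<lambda>x. J +>\<^bsub>A\<^esub> cl x) \<in> ring_hom VR B"
      using ring_hom_trans[OF cl_hom qh] by (simp add: comp_def)
    show "(\<lambda>x. J +>\<^bsub>A\<^esub> cl x) ` ball 0 = carrier B"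
      unfolding B using carrier_A by (auto simp: FactRing_def A_RCOSETS_def' image_image[symmetric])
    show "(J +>\<^bsub>A\<^esub> cl x = \<zero>\<^bsub>B\<^esub>) = (x \<in> ball (int l))" if x: "x \<in> ball 0" for x
    proof -
      have "J +>\<^bsub>A\<^esub> cl x = \<zero>\<^bsub>B\<^esub> \<longleftrightarrow> J +>\<^bsub>A\<^esub> cl x = J" by (simp add: B FactRing_def)
      also have "\<dots> \<longleftrightarrow> cl x \<in> J"
        using J.a_rcos_const J.a_rcos_self[OF clA[OF x]] by auto
      also have "\<dots> \<longleftrightarrow> x \<in> ball (int l)"
      proof
        assume "cl x \<in> J"
        then obtain y where y: "y \<in> ball (int l)" "cl x = cl y" unfolding J_eq by blast
        have y0: "y \<in> ball 0" using ball_mono[OF y(1)] by simp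
        have "x \<ominus> y \<in> ball (int l)" using cl_eq_iff[OF x y0] y(2) ball_mono[of "x \<ominus> y" "2 * int l" "int l"] by simp
        then have "(x \<ominus> y) \<oplus> y \<in> ball (int l)" using ball_add y(1) by blast
        then show "x \<in> ball (int l)"
          using ball_carrier[OF x] ball_carrier[OF y0] by (simp add: a_minus_def a_assoc l_neg)
      qed (auto simp: J_eq)
      finally show ?thesis .
    qed
    show "circ (J +>\<^bsub>A\<^esub> cl x) = J +>\<^bsub>A\<^esub> cl (\<sigma> x)" if x: "x \<in> ball 0" for x
      unfolding circ_coset[OF clA[OF x]] star_cl[OF x] ..
    show "1 \<le> l" by (rule l)
    show "odd (ring_char (residue_field BK \<nu>))" by (rule odd)
  qed
qed

end
end

section \<open>The index of the stabilizer of a vector of unit norm\<close>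

theorem theorem8p2:
  fixes F :: "'a ring" and K :: "'a set" and \<omega> \<nu> :: "'a \<Rightarrow> int" and \<rho> :: 'a and \<sigma> :: "'a \<Rightarrow> 'a"
    and q l m f r :: nat
    and \<R> :: "'a ring" and \<P> :: "'a set"
    and A :: "'a set ring" and star :: "'a set \<Rightarrow> 'a set" and \<rr> :: "'a set set"
    and B :: "'a set set ring" and circ :: "'a set set \<Rightarrow> 'a set set"
    and Rbar :: "'a set set ring" and \<epsilon> :: "'a set set"
    and V :: "('a set, 'v) module" and h :: "'v \<Rightarrow> 'v \<Rightarrow> 'a set"
    and Vbar :: "('a set set, 'v set) module" and hbar :: "'v set \<Rightarrow> 'v set \<Rightarrow> 'a set set"
    and u :: "'v set" and t :: "'a set set"
    and U :: "('v set \<Rightarrow> 'v set) monoid" and S :: "('v set \<Rightarrow> 'v set) set"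
  assumes ext: "ramified_quadratic_extension F \<omega> K \<nu> \<rho> \<sigma>"
    and q: "q = card (carrier (residue_field (F\<lparr>carrier := K\<rparr>) \<nu>))"
    and odd_char: "odd (ring_char (residue_field (F\<lparr>carrier := K\<rparr>) \<nu>))"
    and integers: "\<R> = val_ring F \<omega>" "\<P> = val_ideal F \<omega>"
    and l: "l \<ge> 1" and m: "m \<ge> 2"
    and f: "if even l then l = 2 * f else l = 2 * f - 1"
    and A: "A = \<R> Quot ideal_pow \<R> \<P> (2 * l)" "star = quot_map \<sigma>"
      "\<rr> = ideal_image \<R> (ideal_pow \<R> \<P> (2 * l)) \<P>"
    and B: "B = A Quot ideal_pow A \<rr> l" "circ = quot_map star"
    and Rbar: "Rbar = B\<lparr>carrier := {x \<in> carrier B. circ x = x}\<rparr>"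
    and eps: "\<epsilon> \<in> Units Rbar" "\<not> (\<exists>x \<in> Units Rbar. \<epsilon> = x [^]\<^bsub>Rbar\<^esub> (2::nat))"
    and V: "free_of_rank A V m" "hermitian_form A star V h" "nondegenerate A V h"
    and Vbar: "Vbar = quot_module (ideal_pow A \<rr> l) V" "hbar = quot_form A (ideal_pow A \<rr> l) h"
    and U: "U = unitary_group B Vbar hbar"
    and u: "primitive B Vbar u"
    and S: "S = stabilizer U (\<lambda>g. g) u"
    and t: "t = hbar u u" "t \<in> Units B"
  shows "(m = 2 * r + 1 \<longrightarrow>
           (kind_I B (perp B Vbar hbar u) hbar \<longrightarrow>
              group_index U S = q ^ (m * l - m + r - f + 1) * (q ^ r + 1)) \<and>
           (kind_II B \<epsilon> (perp B Vbar hbar u) hbar \<longrightarrow>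
              group_index U S = q ^ (m * l - m + r - f + 1) * (q ^ r - 1))) \<and>
         (m = 2 * r \<longrightarrow>
           (kind_I B Vbar hbar \<longrightarrow>
              group_index U S = q ^ (m * l - m + r - f) * (q ^ r - 1)) \<and>
           (kind_II B \<epsilon> Vbar hbar \<longrightarrow>
              group_index U S = q ^ (m * l - m + r - f) * (q ^ r + 1)))"
proof -
  interpret E: ramified_quadratic_extension F \<omega> K \<nu> \<rho> \<sigma> by (rule ext)
  define J where "J = ideal_pow A \<rr> l"
  have I: "ideal_pow \<R> \<P> (2 * l) = val_ball F \<omega> (2 * int l)"
    unfolding integers using E.ideal_pow_ball[of "2 * l"] by simp
  have A': "A = val_ring F \<omega> Quot val_ball F \<omega> (2 * int l)"
    "\<rr> = ideal_image (val_ring F \<omega>) (val_ball F \<omega> (2 * int l)) (val_ball F \<omega> 1)"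
    using A(1,3) unfolding I unfolding integers by auto
  have B': "B = A Quot J" using B(1) unfolding J_def .
  note tower = A'(1) A(2) A'(2) J_def B' B(2)
  let ?\<psi> = "\<lambda>x. J +>\<^bsub>A\<^esub> (val_ball F \<omega> (2 * int l) +>\<^bsub>val_ring F \<omega>\<^esub> x)"
  interpret Q: integral_quotient F \<omega> K \<nu> \<rho> \<sigma> B ?\<psi> circ l
    by (rule E.integral_quotient_B[OF tower l odd_char])
  interpret L: local_involution_ring B circ Q.\<mm> by (rule Q.local_involution_ring_B[OF f])
  have cA: "cring A" by (rule E.cring_A[OF tower])
  have modV: "module A V" using V(1) by (simp add: free_of_rank_def)
  obtain e where e: "is_basis A V m e" using V(1) unfolding free_of_rank_def by blast
  have idJ: "ideal J A" by (rule E.ideal_J[OF tower])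
  interpret MQ: module_mod_ideal A V J
    by (rule module_mod_ideal.intro[OF modV idJ])
  have Vb: "Vbar = quot_module J V" "hbar = quot_form A J h" using Vbar unfolding J_def by auto
  have starJ: "star a \<in> J" if "a \<in> J" for a using E.star_J[OF tower] that by blast
  have herm: "hermitian_form B circ Vbar hbar"
    unfolding Vb B'
  proof (rule MQ.hermitian_Q[OF V(2)])
    show "star a \<in> J" if "a \<in> J" for a by (rule starJ[OF that])
    show "circ (J +>\<^bsub>A\<^esub> a) = J +>\<^bsub>A\<^esub> star a" if "a \<in> carrier A" for a
      by (rule E.circ_coset[OF tower that])
  qed
  have modVb: "module B Vbar" unfolding Vb B' by (rule MQ.module_Q)
  have basis: "is_basis B Vbar m (\<lambda>i. MQ.cls (e i))" unfolding Vb B' by (rule MQ.basis_Q[OF e])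
  have cardV: "card (carrier Vbar) = card (carrier B) ^ m" by (rule module.card_free[OF modVb basis])
  have "0 < card (carrier B)" unfolding Q.card_B(2)[OF f] using Q.res_card_pos[OF f] by (rule zero_less_power)
  then have finV: "finite (carrier Vbar)"
    by (intro card_ge_0_finite) (simp only: cardV zero_less_power)
  interpret H: finite_hermitian_module B circ Q.\<mm> Vbar hbar
    by (intro finite_hermitian_module.intro finite_hermitian_module_axioms.intro
        L.local_involution_ring_axioms modVb herm finV)
  have uV: "u \<in> carrier Vbar" using u unfolding primitive_def is_basis_def by auto
  have unit: "hbar u u \<in> Units B" using t by simp
  have kq: "card (carrier (B Quot Q.\<mm>)) = q" using Q.card_residue_field_B[OF f] q by simp
  have cm: "card Q.\<mm> = card (carrier (B Quot Q.\<mm>)) ^ (l - 1)" unfolding kq q by (rule Q.card_mm[OF f])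
  have cf: "card {z \<in> Q.\<mm>. circ z = z} = card (carrier (B Quot Q.\<mm>)) ^ (f - 1)"
    unfolding kq q by (rule Q.card_fixed_mm[OF f])
  have f1: "1 \<le> f" "2 * f \<le> l + 1" using f l by (auto split: if_splits)
  have Rb: "Units Rbar = {x \<in> Units B. circ x = x}"
  proof (intro Set.equalityI subsetI)
    fix x assume "x \<in> Units Rbar"
    then show "x \<in> {x \<in> Units B. circ x = x}" unfolding Rbar Units_def by auto
  next
    fix x assume "x \<in> {x \<in> Units B. circ x = x}"
    then have x: "x \<in> Units B" "circ x = x" by auto
    have i: "circ (inv\<^bsub>B\<^esub> x) = inv\<^bsub>B\<^esub> x" using L.cj_inv[OF x(1)] x(2) by simp
    show "x \<in> Units Rbar"
      unfolding Rbar Units_def using x i Q.B.Units_closed[OF x(1)] Q.B.Units_inv_closed[OF x(1)]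
        Q.B.Units_l_inv[OF x(1)] Q.B.Units_r_inv[OF x(1)] by auto
  qed
  have ep: "\<epsilon> \<in> Units B" "circ \<epsilon> = \<epsilon>" using eps(1) unfolding Rb by auto
  have ns: "\<epsilon> \<noteq> x \<otimes>\<^bsub>B\<^esub> x" if "x \<in> Units B" "circ x = x" for x
  proof -
    have "x [^]\<^bsub>Rbar\<^esub> (2::nat) = x \<otimes>\<^bsub>B\<^esub> x"
      unfolding Rbar using Q.B.Units_closed[OF that(1)] by (simp add: numeral_2_eq_2)
    then show ?thesis using eps(2) that unfolding Rb by auto
  qed
  note formulas = H.index_formulas[OF cardV m cm cf f1 uV unit ep ns, unfolded kq]
  show ?thesis
    unfolding S U using formulas by blast
qed

end
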